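(* Let $D=\sum_{s=1}^N\gamma_s\varpi_{i_s}[\mathsf x_s]+\mu^+[\infty]+\mu^-[0]$ be as in the context (with $\mu^\pm\in\Lambda$ arbitrary) satisfying $\lambda+\mu^++\mu^-=\sum_{i=1}^{n-1}a_i\alpha_i$, $a_i\in\mathbb{Z}_{\ge0}$. Then there is a unique $\mathbb{C}(v)$-algebra homomorphism $\Psi_D\colon U_{-\mu^+,-\mu^-}(L\mathfrak{gl}_n)\to\widetilde{\mathcal A}^v_{\mathrm{frac}}$ such that $$E_i(z)\mapsto z^{-\alpha^\vee_i(\mu^+)}\prod_{t=1}^{a_i}\mathsf w_{i,t}\prod_{t=1}^{a_{i-1}}\mathsf w_{i-1,t}^{-1/2}\sum_{r=1}^{a_i}\delta\Big(\frac{v^i\mathsf w_{i,r}}{z}\Big)\frac{\mathsf Z_i(\mathsf w_{i,r})}{\mathsf W_{i,r}(\mathsf w_{i,r})}\mathsf W_{i-1}(v^{-1}\mathsf w_{i,r})D_{i,r}^{-1},$$ $$F_i(z)\mapsto-v^{-1}\prod_{t=1}^{a_{i+1}}\mathsf w_{i+1,t}^{-1/2}\sum_{r=1}^{a_i}\delta\Big(\frac{v^{i+2}\mathsf w_{i,r}}{z}\Big)\frac{\mathsf W_{i+1}(v\mathsf w_{i,r})}{\mathsf W_{i,r}(\mathsf w_{i,r})}D_{i,r},$$ $$\varphi^\pm_i(z)\mapsto\prod_{t=1}^{a_i}\mathsf w_{i,t}^{-1/2}\prod_{t=1}^{a_{i-1}}\mathsf w_{i-1,t}^{1/2}\Big(z^{\epsilon^\vee_i(\mu^+)}\frac{\mathsf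 W_i(v^{-i}z)}{\mathsf W_{i-1}(v^{-i-1}z)}\prod_{\mathsf x\in\mathbb{C}^\times}(1-\mathsf x/z)^{-\epsilon^\vee_i(\lambda_{\mathsf x})}\Big)^\pm,$$ where $\gamma(z)^\pm$ denotes the expansion of a rational function $\gamma(z)$ in $z^{\mp1}$.
   Context: Let $n\ge2$, $\Lambda=\bigoplus_{j=1}^n\mathbb{Z}\epsilon_j$, $\epsilon^\vee_j$ dual basis, $\alpha^\vee_i=\epsilon^\vee_i-\epsilon^\vee_{i+1}$, $\alpha_i=\epsilon_i-\epsilon_{i+1}$, $\varpi_i=-\sum_{j>i}\epsilon_j$ ($0\le i\le n-1$), $\Lambda^+=\{\nu:\alpha^\vee_i(\nu)\ge0\ \forall i\}$. Divisor data: $N\ge0$, $0\le i_s\le n-1$, $\mathsf x_s\in\mathbb{C}^\times$, $\gamma_s=1$ if $i_s\ne0$ and $\gamma_s\in\{\pm1\}$ if $i_s=0$, $\mu^\pm\in\Lambda$; $\lambda=\sum_s\gamma_s\varpi_{i_s}$, $\lambda_{\mathsf x}=\sum_{s:\mathsf x_s=\mathsf x}\gamma_s\varpi_{i_s}$; $a_0=a_n=0$. $\widetilde{\mathcal A}^v$: the $\mathbb{C}[v,v^{-1}]$-algebra generated by $D_{i,r}^{\pm1},\mathsf w_{i,r}^{\pm1/2}$, $(\mathsf w_{i,r}-v^m\mathsf w_{i,s})^{-1}$, $(1-v^l)^{-1}$ ($1\le i<n$, $1\le r\ne s\le a_i$, $m\in\mathbb{Z}$, $l\in\mathbb{Z}\setminus\{0\}$)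 with relations $D_{i,r}\mathsf w^{1/2}_{j,s}=v^{\delta_{ij}\delta_{rs}}\mathsf w^{1/2}_{j,s}D_{i,r}$, the $D$'s commute, the $\mathsf w^{1/2}$'s commute, $D^{\pm1}_{i,r}D^{\mp1}_{i,r}=1=\mathsf w^{\pm1/2}_{i,r}\mathsf w^{\mp1/2}_{i,r}$ (and $\mathsf w_{i,r}:=(\mathsf w^{1/2}_{i,r})^2$). $\widetilde{\mathcal A}^v_{\mathrm{frac}}=\widetilde{\mathcal A}^v\otimes_{\mathbb{C}[v,v^{-1}]}\mathbb{C}(v)$. $\mathsf Z_i(z)=\prod_{s:i_s=i}(1-v^{-i}\mathsf x_s/z)^{\gamma_s}$, $\mathsf W_j(z)=\prod_{r=1}^{a_j}(1-\mathsf w_{j,r}/z)$, $\mathsf W_{j,r}(z)=\prod_{s\ne r}(1-\mathsf w_{j,s}/z)$, $\mathsf W_0=\mathsf W_n=1$; $\delta(z)=\sum_{m\in\mathbb{Z}}z^m$. For $\nu^\pm\in\Lambda$ with $d^\pm_j:=\epsilon^\vee_j(\nu^\pm)$, $U_{\nu^+,\nu^-}(L\mathfrak{gl}_n)$ is the $\mathbb{C}(v)$-algebra generated by $E_{i,r},F_{i,r}$ ($1\le i<n$, $r\in\mathbb{Z}$), $\varphi^\pm_{i,\pm s}$ ($s\ge d^\pm_i$), $(\varphi^\pm_{i,\pm d^\pm_i})^{-1}$, with $E_i(z)=\sum_rE_{i,r}z^{-r}$, $F_i(z)=\sum_rF_{i,r}z^{-r}$, $\varphi^\pm_i(z)=\sum_{r\ge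 d^\pm_i}\varphi^\pm_{i,\pm r}z^{\mp r}$ and relations (rational-function relations understood after clearing denominators; $[a,b]_x=ab-xba$): (U0) $[\varphi^\epsilon_i(z),\varphi^{\epsilon'}_j(w)]=0$, $\varphi^\pm_{i,\pm d^\pm_i}$ inverse to $(\varphi^\pm_{i,\pm d^\pm_i})^{-1}$; (U1) $[E_i(z),F_j(w)]=(v-v^{-1})\delta_{ij}\delta(z/w)(\varphi^+_i(z)^{-1}\varphi^+_{i+1}(z)-\varphi^-_i(z)^{-1}\varphi^-_{i+1}(z))$; (U2) $\varphi^\epsilon_i(z)E_j(w)=(\frac{z-w}{v^{-1}z-vw})^{\delta_{i,j+1}}(\frac{z-w}{vz-v^{-1}w})^{\delta_{ij}}E_j(w)\varphi^\epsilon_i(z)$; (U3) $\varphi^\epsilon_i(z)F_j(w)=(\frac{v^{-1}z-vw}{z-w})^{\delta_{i,j+1}}(\frac{vz-v^{-1}w}{z-w})^{\delta_{ij}}F_j(w)\varphi^\epsilon_i(z)$; (U4) $E_i(z)E_j(w)=(\frac{vz-v^{-1}w}{v^{-1}z-vw})^{\delta_{ij}}(\frac{z-w}{vz-v^{-1}w})^{\delta_{i,j-1}}(\frac{v^{-1}z-vw}{z-w})^{\delta_{i,j+1}}E_j(w)E_i(z)$; (U5) $F_i(z)F_j(w)=(\frac{v^{-1}z-vw}{vz-v^{-1}w})^{\delta_{ij}}(\frac{vz-v^{-1}w}{z-w})^{\delta_{i,j-1}}(\frac{z-w}{v^{-1}z-vw})^{\delta_{i,j+1}}F_j(w)F_i(z)$;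 (U6),(U7) for $|i-j|=1$: $[E_i(z_1),[E_i(z_2),E_j(w)]_v]_{v^{-1}}+[E_i(z_2),[E_i(z_1),E_j(w)]_v]_{v^{-1}}=0$, and the same for $F$. *)

theory Defs
  imports Complex_Main "HOL-Algebra.QuotRing" "HOL-Computational_Algebra.Polynomial" "HOL-Computational_Algebra.Fraction_Field"
begin

type_synonym K = "complex poly fract"

definition vv :: K where "vv = Fract [:0, 1:] 1"
definition cK :: "complex \<Rightarrow> K" where "cK c = Fract [:c:] 1"

type_synonym 'g fa = "'g list \<Rightarrow> K"

definition fmul :: "'g fa \<Rightarrow> 'g fa \<Rightarrow> 'g fa" where
  "fmul f g = (\<lambda>w. \<Sum>i\<le>length w. f (take i w) * g (drop i w))"
definition fadd :: "'g fa \<Rightarrow> 'g fa \<Rightarrow> 'g fa" where "fadd f g = (\<lambda>w. f w + g w)"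
definition fsub :: "'g fa \<Rightarrow> 'g fa \<Rightarrow> 'g fa" where "fsub f g = (\<lambda>w. f w - g w)"
definition fscal :: "K \<Rightarrow> 'g fa \<Rightarrow> 'g fa" where "fscal c f = (\<lambda>w. c * f w)"
definition sc :: "K \<Rightarrow> 'g fa" where "sc c = (\<lambda>w. if w = [] then c else 0)"
definition fone :: "'g fa" where "fone = sc 1"
definition fzero :: "'g fa" where "fzero = (\<lambda>w. 0)"
definition gen :: "'g \<Rightarrow> 'g fa" where "gen g = (\<lambda>w. if w = [g] then 1 else 0)"

definition FA :: "'g set \<Rightarrow> 'g fa ring" where
  "FA G = \<lparr>carrier = {f. finite {w. f w \<noteq> 0} \<and> (\<forall>w. f w \<noteq> 0 \<longrightarrow> set w \<subseteq> G)},
           Group.monoid.mult = fmul, one = fone, zero = fzero, add = fadd\<rparr>"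

definition Pres :: "'g set \<Rightarrow> 'g fa set \<Rightarrow> 'g fa set ring" where
  "Pres G Rel = FA G Quot genideal (FA G) Rel"

definition cls :: "'g set \<Rightarrow> 'g fa set \<Rightarrow> 'g fa \<Rightarrow> 'g fa set" where
  "cls G Rel f = a_r_coset (FA G) (genideal (FA G) Rel) f"

definition lsum :: "('a, 'b) ring_scheme \<Rightarrow> 'a list \<Rightarrow> 'a" where
  "lsum R xs = foldr (add R) xs (zero R)"
definition lprod :: "('a, 'b) ring_scheme \<Rightarrow> 'a list \<Rightarrow> 'a" where
  "lprod R xs = foldr (Group.monoid.mult R) xs (one R)"

text \<open>A series (lo, c) stands for \<Sum>_{m \<ge> lo} c m t^m.\<close>
type_synonym 'a ser = "int \<times> (int \<Rightarrow> 'a)"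

definition scoef :: "('a, 'b) ring_scheme \<Rightarrow> 'a ser \<Rightarrow> int \<Rightarrow> 'a" where
  "scoef R S m = (if m < fst S then zero R else snd S m)"
definition smul :: "('a, 'b) ring_scheme \<Rightarrow> 'a ser \<Rightarrow> 'a ser \<Rightarrow> 'a ser" where
  "smul R S T = (fst S + fst T,
     \<lambda>m. lsum R (map (\<lambda>j. Group.monoid.mult R (scoef R S j) (scoef R T (m - j))) [fst S..m - fst T]))"
definition sone :: "('a, 'b) ring_scheme \<Rightarrow> 'a ser" where
  "sone R = (0, \<lambda>m. if m = 0 then one R else zero R)"
definition sconst :: "('a, 'b) ring_scheme \<Rightarrow> 'a \<Rightarrow> 'a ser" where
  "sconst R c = (0, \<lambda>m. if m = 0 then c else zero R)"
definition sshift :: "int \<Rightarrow> 'a ser \<Rightarrow> 'a ser" where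
  "sshift k S = (fst S + k, \<lambda>m. snd S (m - k))"
definition sprod :: "('a, 'b) ring_scheme \<Rightarrow> 'a ser list \<Rightarrow> 'a ser" where
  "sprod R Ss = foldr (smul R) Ss (sone R)"

text \<open>Coefficients c_0..c_k of the inverse series, b = inverse of the leading coefficient.\<close>
primrec sinvL :: "('a, 'b) ring_scheme \<Rightarrow> 'a ser \<Rightarrow> 'a \<Rightarrow> nat \<Rightarrow> 'a list" where
  "sinvL R S b 0 = [b]"
| "sinvL R S b (Suc k) = (let cs = sinvL R S b k in
     cs @ [a_inv R (Group.monoid.mult R b (lsum R (map (\<lambda>j. Group.monoid.mult R (scoef R S (fst S + int j + 1)) (cs ! (k - j)))
                                          [0..<Suc k])))])"

definition sinvb :: "('a, 'b) ring_scheme \<Rightarrow> 'a ser \<Rightarrow> 'a \<Rightarrow> 'a ser" where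
  "sinvb R S b = (- fst S, \<lambda>m. if m < - fst S then zero R
                               else sinvL R S b (nat (m + fst S)) ! nat (m + fst S))"

section \<open>Weight lattice data (\<Lambda> = Z^n, \<nu> j = \<epsilon>^\<or>_j(\<nu>))\<close>

definition varpi :: "nat \<Rightarrow> nat \<Rightarrow> int" where "varpi i j = (if i < j then -1 else 0)"
definition alpha :: "nat \<Rightarrow> nat \<Rightarrow> int" where
  "alpha i j = (if j = i then 1 else if j = i + 1 then -1 else 0)"
definition lam :: "nat \<Rightarrow> (nat \<Rightarrow> nat) \<Rightarrow> (nat \<Rightarrow> int) \<Rightarrow> nat \<Rightarrow> int" where
  "lam N is gam j = (\<Sum>s=1..N. gam s * varpi (is s) j)"
definition lamx :: "nat \<Rightarrow> (nat \<Rightarrow> nat) \<Rightarrow> (nat \<Rightarrow> complex) \<Rightarrow> (nat \<Rightarrow> int) \<Rightarrow> complex \<Rightarrow> nat \<Rightarrow> int" where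
  "lamx N is xs gam x j = (\<Sum>s\<in>{s\<in>{1..N}. xs s = x}. gam s * varpi (is s) j)"
definition aa :: "nat \<Rightarrow> (nat \<Rightarrow> nat) \<Rightarrow> nat \<Rightarrow> nat" where
  "aa n a i = (if i = 0 \<or> n \<le> i then 0 else a i)"

section \<open>The algebra U_{\<nu>+,\<nu>-}(L gl_n), with \<nu>\<pm> = -\<mu>\<pm>\<close>

text \<open>UPp i s = \<phi>^+_{i,s} (coefficient of z^{-s}, s \<ge> d^+_i);
      UPm i s = \<phi>^-_{i,-s} (coefficient of z^{s}, s \<ge> d^-_i);
      UPpI i, UPmI i = the inverses of the leading coefficients.\<close>
datatype Ugen = UE nat int | UF nat int | UPp nat int | UPm nat int | UPpI nat | UPmI nat

definition UG :: "nat \<Rightarrow> (nat \<Rightarrow> int) \<Rightarrow> (nat \<Rightarrow> int) \<Rightarrow> Ugen set" where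
  "UG n mp mm = {UE i k | i k. 1 \<le> i \<and> i < n} \<union> {UF i k | i k. 1 \<le> i \<and> i < n}
    \<union> {UPp i s | i s. 1 \<le> i \<and> i \<le> n \<and> - mp i \<le> s} \<union> {UPm i s | i s. 1 \<le> i \<and> i \<le> n \<and> - mm i \<le> s}
    \<union> {UPpI i | i. 1 \<le> i \<and> i \<le> n} \<union> {UPmI i | i. 1 \<le> i \<and> i \<le> n}"

text \<open>Coefficient of z^{-m} in \<phi>^+_i(z) and \<phi>^-_i(z).\<close>
definition PhiP :: "(nat \<Rightarrow> int) \<Rightarrow> nat \<Rightarrow> int \<Rightarrow> Ugen fa" where
  "PhiP mp i m = (if - mp i \<le> m then gen (UPp i m) else fzero)"
definition PhiM :: "(nat \<Rightarrow> int) \<Rightarrow> nat \<Rightarrow> int \<Rightarrow> Ugen fa" where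
  "PhiM mm i m = (if - mm i \<le> - m then gen (UPm i (- m)) else fzero)"
definition phiz :: "(nat \<Rightarrow> int) \<Rightarrow> (nat \<Rightarrow> int) \<Rightarrow> bool \<Rightarrow> nat \<Rightarrow> int \<Rightarrow> Ugen fa" where
  "phiz mp mm eps i m = (if eps then PhiP mp i m else PhiM mm i m)"

definition FU :: "Ugen fa ring" where "FU = FA UNIV"

text \<open>Coefficient of z^{-m} in \<phi>^+_i(z)^{-1}\<phi>^+_{i+1}(z) (expanded in z^{-1}) and in
  \<phi>^-_i(z)^{-1}\<phi>^-_{i+1}(z) (expanded in z).\<close>
definition Cp :: "(nat \<Rightarrow> int) \<Rightarrow> nat \<Rightarrow> int \<Rightarrow> Ugen fa" where
  "Cp mp i m = scoef FU (smul FU (sinvb FU (- mp i, PhiP mp i) (gen (UPpI i)))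
                                 (- mp (i+1), PhiP mp (i+1))) m"
definition Cm :: "(nat \<Rightarrow> int) \<Rightarrow> nat \<Rightarrow> int \<Rightarrow> Ugen fa" where
  "Cm mm i m = scoef FU (smul FU (sinvb FU (- mm i, \<lambda>s. PhiM mm i (- s)) (gen (UPmI i)))
                                 (- mm (i+1), \<lambda>s. PhiM mm (i+1) (- s))) (- m)"

text \<open>Coefficient of z^{-k} w^{-l} in (a z + b w) X(z)Y(w) - (c z + e w) Y(w)X(z).\<close>
definition linrel :: "K \<times> K \<times> K \<times> K \<Rightarrow> (int \<Rightarrow> 'g fa) \<Rightarrow> (int \<Rightarrow> 'g fa) \<Rightarrow> int \<Rightarrow> int \<Rightarrow> 'g fa" where
  "linrel cf X Y k l = (case cf of (a, b, c, e) \<Rightarrow>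
     fsub (fadd (fscal a (fmul (X (k+1)) (Y l))) (fscal b (fmul (X k) (Y (l+1)))))
          (fadd (fscal c (fmul (Y l) (X (k+1)))) (fscal e (fmul (Y (l+1)) (X k)))))"

definition qc :: "'g fa \<Rightarrow> 'g fa \<Rightarrow> K \<Rightarrow> 'g fa" where
  "qc x y c = fsub (fmul x y) (fscal c (fmul y x))"

definition cU2 :: "nat \<Rightarrow> nat \<Rightarrow> K \<times> K \<times> K \<times> K" where
  "cU2 i j = (if i = j then (vv, - inverse vv, 1, -1)
              else if i = j + 1 then (inverse vv, - vv, 1, -1) else (1, 0, 1, 0))"
definition cU3 :: "nat \<Rightarrow> nat \<Rightarrow> K \<times> K \<times> K \<times> K" where
  "cU3 i j = (if i = j then (1, -1, vv, - inverse vv)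
              else if i = j + 1 then (1, -1, inverse vv, - vv) else (1, 0, 1, 0))"
definition cU4 :: "nat \<Rightarrow> nat \<Rightarrow> K \<times> K \<times> K \<times> K" where
  "cU4 i j = (if i = j then (inverse vv, - vv, vv, - inverse vv)
              else if j = i + 1 then (vv, - inverse vv, 1, -1)
              else if i = j + 1 then (1, -1, inverse vv, - vv) else (1, 0, 1, 0))"
definition cU5 :: "nat \<Rightarrow> nat \<Rightarrow> K \<times> K \<times> K \<times> K" where
  "cU5 i j = (if i = j then (vv, - inverse vv, inverse vv, - vv)
              else if j = i + 1 then (1, -1, vv, - inverse vv)
              else if i = j + 1 then (inverse vv, - vv, 1, -1) else (1, 0, 1, 0))"

definition PhiGens :: "nat \<Rightarrow> (nat \<Rightarrow> int) \<Rightarrow> (nat \<Rightarrow> int) \<Rightarrow> Ugen fa set" where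
  "PhiGens n mp mm = gen ` ({UPp i s | i s. 1 \<le> i \<and> i \<le> n \<and> - mp i \<le> s}
                         \<union> {UPm i s | i s. 1 \<le> i \<and> i \<le> n \<and> - mm i \<le> s})"

definition UR :: "nat \<Rightarrow> (nat \<Rightarrow> int) \<Rightarrow> (nat \<Rightarrow> int) \<Rightarrow> Ugen fa set" where
  "UR n mp mm =
     \<comment> \<open>(U0)\<close>
     {fsub (fmul x y) (fmul y x) | x y. x \<in> PhiGens n mp mm \<and> y \<in> PhiGens n mp mm}
   \<union> {fsub (fmul (gen (UPp i (- mp i))) (gen (UPpI i))) fone | i. 1 \<le> i \<and> i \<le> n}
   \<union> {fsub (fmul (gen (UPpI i)) (gen (UPp i (- mp i)))) fone | i. 1 \<le> i \<and> i \<le> n}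
   \<union> {fsub (fmul (gen (UPm i (- mm i))) (gen (UPmI i))) fone | i. 1 \<le> i \<and> i \<le> n}
   \<union> {fsub (fmul (gen (UPmI i)) (gen (UPm i (- mm i)))) fone | i. 1 \<le> i \<and> i \<le> n}
     \<comment> \<open>(U1)\<close>
   \<union> {fsub (fsub (fmul (gen (UE i k)) (gen (UF j l))) (fmul (gen (UF j l)) (gen (UE i k))))
          (fscal (if i = j then vv - inverse vv else 0) (fsub (Cp mp i (k + l)) (Cm mm i (k + l))))
       | i j k l. 1 \<le> i \<and> i < n \<and> 1 \<le> j \<and> j < n}
     \<comment> \<open>(U2), (U3)\<close>
   \<union> {linrel (cU2 i j) (phiz mp mm eps i) (\<lambda>m. gen (UE j m)) k l
       | eps i j k l. 1 \<le> i \<and> i \<le> n \<and> 1 \<le> j \<and> j < n}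
   \<union> {linrel (cU3 i j) (phiz mp mm eps i) (\<lambda>m. gen (UF j m)) k l
       | eps i j k l. 1 \<le> i \<and> i \<le> n \<and> 1 \<le> j \<and> j < n}
     \<comment> \<open>(U4), (U5)\<close>
   \<union> {linrel (cU4 i j) (\<lambda>m. gen (UE i m)) (\<lambda>m. gen (UE j m)) k l
       | i j k l. 1 \<le> i \<and> i < n \<and> 1 \<le> j \<and> j < n}
   \<union> {linrel (cU5 i j) (\<lambda>m. gen (UF i m)) (\<lambda>m. gen (UF j m)) k l
       | i j k l. 1 \<le> i \<and> i < n \<and> 1 \<le> j \<and> j < n}
     \<comment> \<open>(U6), (U7)\<close>
   \<union> {fadd (qc (gen (UE i k1)) (qc (gen (UE i k2)) (gen (UE j l)) vv) (inverse vv))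
           (qc (gen (UE i k2)) (qc (gen (UE i k1)) (gen (UE j l)) vv) (inverse vv))
       | i j k1 k2 l. 1 \<le> i \<and> i < n \<and> 1 \<le> j \<and> j < n \<and> (i = j + 1 \<or> j = i + 1)}
   \<union> {fadd (qc (gen (UF i k1)) (qc (gen (UF i k2)) (gen (UF j l)) vv) (inverse vv))
           (qc (gen (UF i k2)) (qc (gen (UF i k1)) (gen (UF j l)) vv) (inverse vv))
       | i j k1 k2 l. 1 \<le> i \<and> i < n \<and> 1 \<le> j \<and> j < n \<and> (i = j + 1 \<or> j = i + 1)}"

definition Ualg :: "nat \<Rightarrow> (nat \<Rightarrow> int) \<Rightarrow> (nat \<Rightarrow> int) \<Rightarrow> Ugen fa set ring" where
  "Ualg n mp mm = Pres (UG n mp mm) (UR n mp mm)"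
definition gU :: "nat \<Rightarrow> (nat \<Rightarrow> int) \<Rightarrow> (nat \<Rightarrow> int) \<Rightarrow> Ugen \<Rightarrow> Ugen fa set" where
  "gU n mp mm g = cls (UG n mp mm) (UR n mp mm) (gen g)"
definition sU :: "nat \<Rightarrow> (nat \<Rightarrow> int) \<Rightarrow> (nat \<Rightarrow> int) \<Rightarrow> K \<Rightarrow> Ugen fa set" where
  "sU n mp mm c = cls (UG n mp mm) (UR n mp mm) (sc c)"

text \<open>AD i r = D_{i,r}, ADi i r = D_{i,r}^{-1}, AW i r = w_{i,r}^{1/2}, AWi i r = w_{i,r}^{-1/2},
  AInvD i r s m = (w_{i,r} - v^m w_{i,s})^{-1}, AInvV l = (1 - v^l)^{-1}.\<close>
datatype Agen = AD nat nat | ADi nat nat | AW nat nat | AWi nat nat | AInvD nat nat nat int | AInvV int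

definition AI :: "nat \<Rightarrow> (nat \<Rightarrow> nat) \<Rightarrow> (nat \<times> nat) set" where
  "AI n a = {(i, r). 1 \<le> i \<and> i < n \<and> 1 \<le> r \<and> r \<le> aa n a i}"

definition AG :: "nat \<Rightarrow> (nat \<Rightarrow> nat) \<Rightarrow> Agen set" where
  "AG n a = {AD i r | i r. (i, r) \<in> AI n a} \<union> {ADi i r | i r. (i, r) \<in> AI n a}
    \<union> {AW i r | i r. (i, r) \<in> AI n a} \<union> {AWi i r | i r. (i, r) \<in> AI n a}
    \<union> {AInvD i r s m | i r s m. (i, r) \<in> AI n a \<and> (i, s) \<in> AI n a \<and> r \<noteq> s}
    \<union> {AInvV l | l. l \<noteq> 0}"

definition wsq :: "nat \<Rightarrow> nat \<Rightarrow> Agen fa" where "wsq i r = fmul (gen (AW i r)) (gen (AW i r))"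

definition AR :: "nat \<Rightarrow> (nat \<Rightarrow> nat) \<Rightarrow> Agen fa set" where
  "AR n a =
     {fsub (fmul (gen (AD i r)) (gen (AW j s)))
           (fscal (if i = j \<and> r = s then vv else 1) (fmul (gen (AW j s)) (gen (AD i r))))
       | i r j s. (i, r) \<in> AI n a \<and> (j, s) \<in> AI n a}
   \<union> {fsub (fmul (gen (AD i r)) (gen (AD j s))) (fmul (gen (AD j s)) (gen (AD i r)))
       | i r j s. (i, r) \<in> AI n a \<and> (j, s) \<in> AI n a}
   \<union> {fsub (fmul (gen (AW i r)) (gen (AW j s))) (fmul (gen (AW j s)) (gen (AW i r)))
       | i r j s. (i, r) \<in> AI n a \<and> (j, s) \<in> AI n a}
   \<union> {fsub (fmul (gen (AD i r)) (gen (ADi i r))) fone | i r. (i, r) \<in> AI n a}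
   \<union> {fsub (fmul (gen (ADi i r)) (gen (AD i r))) fone | i r. (i, r) \<in> AI n a}
   \<union> {fsub (fmul (gen (AW i r)) (gen (AWi i r))) fone | i r. (i, r) \<in> AI n a}
   \<union> {fsub (fmul (gen (AWi i r)) (gen (AW i r))) fone | i r. (i, r) \<in> AI n a}
   \<union> {fsub (fmul (fsub (wsq i r) (fscal (vv powi m) (wsq i s))) (gen (AInvD i r s m))) fone
       | i r s m. (i, r) \<in> AI n a \<and> (i, s) \<in> AI n a \<and> r \<noteq> s}
   \<union> {fsub (fmul (gen (AInvD i r s m)) (fsub (wsq i r) (fscal (vv powi m) (wsq i s)))) fone
       | i r s m. (i, r) \<in> AI n a \<and> (i, s) \<in> AI n a \<and> r \<noteq> s}
   \<union> {fsub (fmul (fsub fone (fscal (vv powi l) fone)) (gen (AInvV l))) fone | l. l \<noteq> 0}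
   \<union> {fsub (fmul (gen (AInvV l)) (fsub fone (fscal (vv powi l) fone))) fone | l. l \<noteq> 0}"

definition Aalg :: "nat \<Rightarrow> (nat \<Rightarrow> nat) \<Rightarrow> Agen fa set ring" where
  "Aalg n a = Pres (AG n a) (AR n a)"
definition gA :: "nat \<Rightarrow> (nat \<Rightarrow> nat) \<Rightarrow> Agen \<Rightarrow> Agen fa set" where
  "gA n a g = cls (AG n a) (AR n a) (gen g)"
definition sA :: "nat \<Rightarrow> (nat \<Rightarrow> nat) \<Rightarrow> K \<Rightarrow> Agen fa set" where
  "sA n a c = cls (AG n a) (AR n a) (sc c)"

definition wA :: "nat \<Rightarrow> (nat \<Rightarrow> nat) \<Rightarrow> nat \<Rightarrow> nat \<Rightarrow> Agen fa set" where
  "wA n a i r = Group.monoid.mult (Aalg n a) (gA n a (AW i r)) (gA n a (AW i r))"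
definition wpowA :: "nat \<Rightarrow> (nat \<Rightarrow> nat) \<Rightarrow> nat \<Rightarrow> nat \<Rightarrow> int \<Rightarrow> Agen fa set" where
  "wpowA n a i r p = (if 0 \<le> p then pow (Aalg n a) (wA n a i r) (nat p)
      else pow (Aalg n a) (Group.monoid.mult (Aalg n a) (gA n a (AWi i r)) (gA n a (AWi i r))) (nat (- p)))"

definition WA :: "nat \<Rightarrow> (nat \<Rightarrow> nat) \<Rightarrow> nat \<Rightarrow> Agen fa set \<Rightarrow> Agen fa set" where
  "WA n a j u = lprod (Aalg n a) (map (\<lambda>r. a_minus (Aalg n a) (one (Aalg n a))
       (Group.monoid.mult (Aalg n a) (wA n a j r) (m_inv (Aalg n a) u))) [1..<aa n a j + 1])"
definition WexA :: "nat \<Rightarrow> (nat \<Rightarrow> nat) \<Rightarrow> nat \<Rightarrow> nat \<Rightarrow> Agen fa set \<Rightarrow> Agen fa set" where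
  "WexA n a j r u = lprod (Aalg n a) (map (\<lambda>s. a_minus (Aalg n a) (one (Aalg n a))
       (Group.monoid.mult (Aalg n a) (wA n a j s) (m_inv (Aalg n a) u))) (filter (\<lambda>s. s \<noteq> r) [1..<aa n a j + 1]))"

definition ZA :: "nat \<Rightarrow> (nat \<Rightarrow> nat) \<Rightarrow> nat \<Rightarrow> (nat \<Rightarrow> nat) \<Rightarrow> (nat \<Rightarrow> complex) \<Rightarrow> (nat \<Rightarrow> int)
                   \<Rightarrow> nat \<Rightarrow> Agen fa set \<Rightarrow> Agen fa set" where
  "ZA n a N is xs gam i u = lprod (Aalg n a) (map (\<lambda>s.
       let f = a_minus (Aalg n a) (one (Aalg n a))
                 (Group.monoid.mult (Aalg n a) (sA n a (vv powi (- int i) * cK (xs s))) (m_inv (Aalg n a) u))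
       in if gam s = 1 then f else m_inv (Aalg n a) f)
     (filter (\<lambda>s. is s = i) [1..<N + 1]))"

text \<open>Image of E_{i,k} (coefficient of z^{-k}).\<close>
definition Eimg :: "nat \<Rightarrow> (nat \<Rightarrow> nat) \<Rightarrow> (nat \<Rightarrow> int) \<Rightarrow> nat \<Rightarrow> (nat \<Rightarrow> nat) \<Rightarrow> (nat \<Rightarrow> complex)
                     \<Rightarrow> (nat \<Rightarrow> int) \<Rightarrow> nat \<Rightarrow> int \<Rightarrow> Agen fa set" where
  "Eimg n a mp N is xs gam i k = (let A = Aalg n a; p = k - (mp i - mp (i + 1)) in
     lprod A (map (wA n a i) [1..<aa n a i + 1]
            @ map (\<lambda>t. gA n a (AWi (i - 1) t)) [1..<aa n a (i - 1) + 1]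
            @ [lsum A (map (\<lambda>r. lprod A
                  [sA n a (vv powi (int i * p)), wpowA n a i r p,
                   ZA n a N is xs gam i (wA n a i r),
                   m_inv A (WexA n a i r (wA n a i r)),
                   WA n a (i - 1) (Group.monoid.mult A (sA n a (inverse vv)) (wA n a i r)),
                   gA n a (ADi i r)]) [1..<aa n a i + 1])]))"

text \<open>Image of F_{i,k} (coefficient of z^{-k}).\<close>
definition Fimg :: "nat \<Rightarrow> (nat \<Rightarrow> nat) \<Rightarrow> nat \<Rightarrow> int \<Rightarrow> Agen fa set" where
  "Fimg n a i k = (let A = Aalg n a in
     a_inv A (lprod A ([sA n a (inverse vv)]
            @ map (\<lambda>t. gA n a (AWi (i + 1) t)) [1..<aa n a (i + 1) + 1]
            @ [lsum A (map (\<lambda>r. lprod A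
                  [sA n a (vv powi (int (i + 2) * k)), wpowA n a i r k,
                   WA n a (i + 1) (Group.monoid.mult A (sA n a vv) (wA n a i r)),
                   m_inv A (WexA n a i r (wA n a i r)),
                   gA n a (AD i r)]) [1..<aa n a i + 1])])))"

text \<open>Series of (1 - c/z): eps = True: expanded in t = z^{-1}; eps = False: expanded in t = z.\<close>
definition facA :: "nat \<Rightarrow> (nat \<Rightarrow> nat) \<Rightarrow> bool \<Rightarrow> Agen fa set \<Rightarrow> Agen fa set ser" where
  "facA n a eps c = (if eps
      then (0, \<lambda>m. if m = 0 then one (Aalg n a) else if m = 1 then a_inv (Aalg n a) c else zero (Aalg n a))
      else (-1, \<lambda>m. if m = -1 then a_inv (Aalg n a) c else if m = 0 then one (Aalg n a) else zero (Aalg n a)))"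

definition sinvA :: "nat \<Rightarrow> (nat \<Rightarrow> nat) \<Rightarrow> Agen fa set ser \<Rightarrow> Agen fa set ser" where
  "sinvA n a S = sinvb (Aalg n a) S (m_inv (Aalg n a) (scoef (Aalg n a) S (fst S)))"

definition spowA :: "nat \<Rightarrow> (nat \<Rightarrow> nat) \<Rightarrow> int \<Rightarrow> Agen fa set ser \<Rightarrow> Agen fa set ser" where
  "spowA n a e S = (if 0 \<le> e then sprod (Aalg n a) (replicate (nat e) S)
                    else sprod (Aalg n a) (replicate (nat (- e)) (sinvA n a S)))"

text \<open>Series of W_j(z / s') = \<Prod>_r (1 - s w_{j,r}/z), s = 1/s'.\<close>
definition WserA :: "nat \<Rightarrow> (nat \<Rightarrow> nat) \<Rightarrow> bool \<Rightarrow> nat \<Rightarrow> K \<Rightarrow> Agen fa set ser" where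
  "WserA n a eps j s = sprod (Aalg n a)
     (map (\<lambda>r. facA n a eps (Group.monoid.mult (Aalg n a) (sA n a s) (wA n a j r))) [1..<aa n a j + 1])"

text \<open>Expansion (eps = True: in z^{-1}, variable t = z^{-1}; eps = False: in z, t = z) of the
  image of \<phi>^\<pm>_i(z).\<close>
definition phiS :: "nat \<Rightarrow> (nat \<Rightarrow> nat) \<Rightarrow> (nat \<Rightarrow> int) \<Rightarrow> nat \<Rightarrow> (nat \<Rightarrow> nat) \<Rightarrow> (nat \<Rightarrow> complex)
                     \<Rightarrow> (nat \<Rightarrow> int) \<Rightarrow> bool \<Rightarrow> nat \<Rightarrow> Agen fa set ser" where
  "phiS n a mp N is xs gam eps i = (let A = Aalg n a in
     sshift (if eps then - mp i else mp i)
       (sprod A ([sconst A (lprod A (map (\<lambda>t. gA n a (AWi i t)) [1..<aa n a i + 1]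
                                    @ map (\<lambda>t. gA n a (AW (i - 1) t)) [1..<aa n a (i - 1) + 1])),
                  WserA n a eps i (vv ^ i),
                  sinvA n a (WserA n a eps (i - 1) (vv ^ (i + 1)))]
          @ map (\<lambda>x. spowA n a (- lamx N is xs gam x i) (facA n a eps (sA n a (cK x))))
                (remdups (map xs [1..<N + 1])))))"

end

theory Submission
  imports Defs "HOL-Computational_Algebra.Formal_Laurent_Series" "HOL-Library.Poly_Mapping" "HOL-Library.Nat_Bijection"
begin

text \<open>The images of the E and F currents are finite sums of terms f D with f in the commutative part of
the target and D one of the shift operators, so a relation holds as soon as it holds term by term.
There it is an identity between f's transported along D. The commutative part need not be a domain, but the
assignment of its generators to variables defines a partial homomorphism from the field L of rational
functions in the square roots of the variables \<open>w\<close>, defined on the fractions whose denominator becomes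
invertible. Hence every relation reduces to an identity in the field L: the
exchange and Serre relations become identities between ratios of linear factors, and [E, F] is the
partial fraction decomposition, at the points \<open>v\<close>-proportional to the \<open>w\<close>'s, of the rational function whose two
expansions are the images of the Cartan quotients. Balancedness of the divisor is what makes
the expansion at 0 start in the prescribed degree.\<close>

section \<open>Free algebras\<close>

text \<open>Conjugation by a shift operator carries the value of a fraction to the value of the
  shifted fraction. So the domain of the partial homomorphism is stable under shifts, and f D g D'
  may be rewritten as f (shifted g) D D' without knowledge of any kernel. In (U1) Cartan series
  occur in two guises: as explicit products in the target and as formal quotients \<open>Cp\<close>,
  \<open>Cm\<close> over the free algebra. Being represented coefficientwise by a Laurent series
  over L is therefore set up for a general coefficient ring and applied to both, with one common
  series \<open>Phi\<close>. The support points of the deltas of E_i and F_i differ by the factor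
  v^2, which is what D does to w. Hence E_i F_i and F_i E_i leave deltas at v^i w and at v^(i+2) w,
  the two families of poles of the Cartan quotient; the remaining products cancel. The constants
  match because (v - 1/v) / (1 - v^2) = -1/v. For uniqueness, the inverses of the leading Cartan
  coefficients are generators without prescribed image; they are fixed because ring homomorphisms
  preserve inverses.\<close>

lemma finite_splits: "finite {p :: 'g list \<times> 'g list. fst p @ snd p = w}"
proof (rule finite_subset)
  show "{p. fst p @ snd p = w} \<subseteq> (\<lambda>i. (take i w, drop i w)) ` {..length w}"
  proof
    fix p assume "p \<in> {p. fst p @ snd p = w}"
    then have "p = (take (length (fst p)) w, drop (length (fst p)) w)" "length (fst p) \<le> length w"
      by (auto simp: prod_eq_iff)
    then show "p \<in> (\<lambda>i. (take i w, drop i w)) ` {..length w}" by blast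
  qed
qed simp

text \<open>Summing over factorizations of the word instead of cut positions makes associativity a
  bijection between factorizations into three pieces.\<close>

lemma fmul_splits: "fmul f g w = (\<Sum>p | fst p @ snd p = w. f (fst p) * g (snd p))"
  unfolding fmul_def
  by (rule sum.reindex_bij_witness[of _ "\<lambda>p. length (fst p)" "\<lambda>i. (take i w, drop i w)"])
    (auto simp: prod_eq_iff)

lemma fmul_assoc: "fmul (fmul f g) h = fmul f (fmul g h)"
proof
  fix w
  have "fmul (fmul f g) h w =
      (\<Sum>(p, q)\<in>(SIGMA p:{p. fst p @ snd p = w}. {q. fst q @ snd q = fst p}). f (fst q) * g (snd q) * h (snd p))"
    by (subst sum.Sigma[symmetric])
      (auto simp: fmul_splits finite_splits sum_distrib_right)
  also have "\<dots> = (\<Sum>(p, q)\<in>(SIGMA p:{p. fst p @ snd p = w}. {q. fst q @ snd q = snd p}).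
      f (fst p) * (g (fst q) * h (snd q)))"
    by (rule sum.reindex_bij_witness
        [of _ "\<lambda>(p, q). ((fst p @ fst q, snd q), (fst p, fst q))"
              "\<lambda>(p, q). ((fst q, snd q @ snd p), (snd q, snd p))"])
      (auto simp: mult.assoc)
  also have "\<dots> = fmul f (fmul g h) w"
    by (subst sum.Sigma[symmetric])
      (auto simp: fmul_splits finite_splits sum_distrib_left)
  finally show "fmul (fmul f g) h w = fmul f (fmul g h) w" .
qed

lemma fmul_fone_left: "fmul fone f = f"
proof
  fix w
  have "fmul fone f w = (\<Sum>i\<le>length w. if i = 0 then f w else 0)"
    unfolding fmul_def by (rule sum.cong) (auto simp: fone_def sc_def)
  then show "fmul fone f w = f w" by simp
qed

lemma fmul_sc_left: "fmul (sc c) f = fscal c f"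
proof
  fix w
  have "fmul (sc c) f w = (\<Sum>i\<le>length w. if i = 0 then c * f w else 0)"
    unfolding fmul_def by (rule sum.cong) (auto simp: sc_def)
  then show "fmul (sc c) f w = fscal c f w" by (simp add: fscal_def)
qed

lemma fmul_sc_right: "fmul f (sc c) = fscal c f"
proof
  fix w
  have "fmul f (sc c) w = (\<Sum>i\<le>length w. if i = length w then c * f w else 0)"
    unfolding fmul_def by (rule sum.cong) (auto simp: sc_def)
  then show "fmul f (sc c) w = fscal c f w" by (simp add: fscal_def)
qed

lemma fmul_fone_right: "fmul f fone = f"
  by (simp add: fone_def fmul_sc_right fscal_def)

lemma fmul_fadd_right: "fmul f (fadd g h) = fadd (fmul f g) (fmul f h)"
  by (auto simp: fmul_def fadd_def algebra_simps sum.distrib)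

lemma fmul_fadd_left: "fmul (fadd g h) f = fadd (fmul g f) (fmul h f)"
  by (auto simp: fmul_def fadd_def algebra_simps sum.distrib)

lemma supp_fmul: "{w. fmul f g w \<noteq> 0} \<subseteq> (\<lambda>p. fst p @ snd p) ` ({w. f w \<noteq> 0} \<times> {w. g w \<noteq> 0})"
proof
  fix w assume "w \<in> {w. fmul f g w \<noteq> 0}"
  then obtain p where "fst p @ snd p = w" "f (fst p) * g (snd p) \<noteq> 0"
    unfolding fmul_splits by (auto elim: sum.not_neutral_contains_not_neutral)
  then show "w \<in> (\<lambda>p. fst p @ snd p) ` ({w. f w \<noteq> 0} \<times> {w. g w \<noteq> 0})"
    by (intro image_eqI[of _ _ p]) (auto simp: mem_Times_iff)
qed

lemma FA_simps [simp]:
  "Group.monoid.mult (FA G) = fmul" "one (FA G) = fone" "zero (FA G) = fzero" "add (FA G) = fadd"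
  by (simp_all add: FA_def)

lemma carrier_FA: "f \<in> carrier (FA G) \<longleftrightarrow> finite {w. f w \<noteq> 0} \<and> (\<forall>w. f w \<noteq> 0 \<longrightarrow> set w \<subseteq> G)"
  by (simp add: FA_def)

lemma fmul_FA:
  assumes "f \<in> carrier (FA G)" "g \<in> carrier (FA G)"
  shows "fmul f g \<in> carrier (FA G)"
proof -
  have "finite {w. fmul f g w \<noteq> 0}"
    using assms by (intro finite_subset[OF supp_fmul]) (auto simp: carrier_FA)
  moreover have "set w \<subseteq> G" if "fmul f g w \<noteq> 0" for w
    using that supp_fmul[of f g] assms by (fastforce simp: carrier_FA)
  ultimately show ?thesis by (auto simp: carrier_FA)
qed

lemma fadd_FA:
  assumes "f \<in> carrier (FA G)" "g \<in> carrier (FA G)"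
  shows "fadd f g \<in> carrier (FA G)"
proof -
  have "{w. fadd f g w \<noteq> 0} \<subseteq> {w. f w \<noteq> 0} \<union> {w. g w \<noteq> 0}" by (auto simp: fadd_def)
  with assms show ?thesis by (auto simp: carrier_FA dest: finite_subset)
qed

lemma sc_FA [simp]: "sc c \<in> carrier (FA G)"
proof -
  have "{w. sc c w \<noteq> 0} \<subseteq> {[]}" by (auto simp: sc_def)
  then show ?thesis by (auto simp: carrier_FA dest: finite_subset)
qed

lemma fone_FA [simp]: "fone \<in> carrier (FA G)"
  by (simp add: fone_def)

lemma fzero_FA [simp]: "fzero \<in> carrier (FA G)"
  by (simp add: carrier_FA fzero_def)

lemma gen_FA [simp]: "gen x \<in> carrier (FA G) \<longleftrightarrow> x \<in> G"
  by (auto simp: carrier_FA gen_def)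

lemma fscal_FA: "f \<in> carrier (FA G) \<Longrightarrow> fscal c f \<in> carrier (FA G)"
  by (metis fmul_FA fmul_sc_left sc_FA)

lemma fsub_eq: "fsub f g = fadd f (fscal (- 1) g)"
  by (auto simp: fsub_def fadd_def fscal_def)

lemma fsub_FA: "f \<in> carrier (FA G) \<Longrightarrow> g \<in> carrier (FA G) \<Longrightarrow> fsub f g \<in> carrier (FA G)"
  by (simp add: fsub_eq fadd_FA fscal_FA)

lemma FA_mono: "G \<subseteq> H \<Longrightarrow> carrier (FA G) \<subseteq> carrier (FA H)"
  by (fastforce simp: carrier_FA)

lemma ring_FA: "ring (FA G)"
proof (rule ringI)
  show "abelian_group (FA G)"
  proof (rule abelian_groupI)
    fix x assume x: "x \<in> carrier (FA G)"
    show "\<exists>y\<in>carrier (FA G). y \<oplus>\<^bsub>FA G\<^esub> x = \<zero>\<^bsub>FA G\<^esub>"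
      using fscal_FA[OF x, of "- 1"] by (intro bexI) (auto simp: fscal_def fadd_def fzero_def)
  qed (auto simp: fadd_FA, auto simp: fadd_def fzero_def)
  show "Group.monoid (FA G)"
    by (rule Group.monoidI) (auto simp: fmul_FA fmul_assoc fmul_fone_left fmul_fone_right)
qed (auto simp: fmul_fadd_left fmul_fadd_right)

lemma a_inv_FA: "f \<in> carrier (FA G) \<Longrightarrow> a_inv (FA G) f = fscal (- 1) f"
proof -
  interpret ring "FA G" by (rule ring_FA)
  assume f: "f \<in> carrier (FA G)"
  have "fscal (- 1) f \<oplus>\<^bsub>FA G\<^esub> f = \<zero>\<^bsub>FA G\<^esub>" by (auto simp: fscal_def fadd_def fzero_def)
  then show ?thesis using f by (intro minus_equality) (auto simp: fscal_FA)
qed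

text \<open>Scalars and generators generate the algebra: monomials arise letter by letter, and a
  general element is reduced by removing one word of its finite support at a time.\<close>

lemma FA_induct:
  assumes f: "f \<in> carrier (FA G)"
    and sc: "\<And>c. sc c \<in> S" and gen: "\<And>x. x \<in> G \<Longrightarrow> gen x \<in> S"
    and add: "\<And>x y. x \<in> carrier (FA G) \<Longrightarrow> y \<in> carrier (FA G) \<Longrightarrow> x \<in> S \<Longrightarrow> y \<in> S \<Longrightarrow> fadd x y \<in> S"
    and mul: "\<And>x y. x \<in> carrier (FA G) \<Longrightarrow> y \<in> carrier (FA G) \<Longrightarrow> x \<in> S \<Longrightarrow> y \<in> S \<Longrightarrow> fmul x y \<in> S"
  shows "f \<in> S"
proof -
  define mo :: "'a list \<Rightarrow> K \<Rightarrow> 'a fa" where "mo w c = (\<lambda>x. if x = w then c else 0)" for w c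
  have mo: "mo w c \<in> carrier (FA G) \<inter> S" if "set w \<subseteq> G" for w c
    using that
  proof (induction w)
    case Nil
    have "mo [] c = sc c" by (auto simp: mo_def sc_def)
    then show ?case using sc by simp
  next
    case (Cons g w)
    have "mo (g # w) c = fmul (gen g) (mo w c)"
    proof
      fix x
      have "fmul (gen g) (mo w c) x = (\<Sum>i\<le>length x. if i = 1 \<and> x = g # w then c else 0)"
        unfolding fmul_def
      proof (rule sum.cong)
        fix i assume "i \<in> {..length x}"
        moreover have "take i x = [g] \<and> drop i x = w \<longleftrightarrow> i = 1 \<and> x = g # w" if "i \<le> length x"
          using that by (cases x; cases i) auto
        ultimately show "gen g (take i x) * mo w c (drop i x) = (if i = 1 \<and> x = g # w then c else 0)"
          by (auto simp: gen_def mo_def)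
      qed simp
      then show "mo (g # w) c x = fmul (gen g) (mo w c) x"
        by (cases "x = g # w") (auto simp: mo_def Suc_le_eq)
    qed
    with Cons gen mul show ?case by (auto simp: fmul_FA)
  qed
  have "\<forall>f. {w. f w \<noteq> 0} = W \<longrightarrow> f \<in> carrier (FA G) \<longrightarrow> f \<in> S" if "finite W" for W
    using that
  proof (induction W)
    case empty
    have "f = sc 0" if "{w. f w \<noteq> 0} = {}" for f :: "'a fa" using that by (auto simp: sc_def)
    then show ?case using sc by blast
  next
    case (insert w W)
    show ?case
    proof (intro allI impI)
      fix f assume f: "{w. f w \<noteq> 0} = insert w W" "f \<in> carrier (FA G)"
      define f' where "f' = f(w := 0)"
      have W: "{w. f' w \<noteq> 0} = W" using f(1) insert(2) by (auto simp: f'_def split: if_splits)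
      have "set w \<subseteq> G" using f by (auto simp: carrier_FA)
      moreover have f'c: "f' \<in> carrier (FA G)" using f(2) W insert(1) by (auto simp: carrier_FA f'_def)
      moreover have "f = fadd (mo w (f w)) f'" by (auto simp: mo_def f'_def fadd_def)
      ultimately show "f \<in> S" using mo[of w "f w"] insert W add by (metis IntE)
    qed
  qed
  with f show ?thesis by (auto simp: carrier_FA)
qed

section \<open>Presentations\<close>

lemma ideal_genideal: "Rel \<subseteq> carrier (FA G) \<Longrightarrow> ideal (genideal (FA G) Rel) (FA G)"
  by (rule ring.genideal_ideal[OF ring_FA])

lemma ring_Pres: "Rel \<subseteq> carrier (FA G) \<Longrightarrow> ring (Pres G Rel)"
  unfolding Pres_def by (rule ideal.quotient_is_ring[OF ideal_genideal])

lemma cls_hom: "Rel \<subseteq> carrier (FA G) \<Longrightarrow> cls G Rel \<in> ring_hom (FA G) (Pres G Rel)"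
  using ideal.rcos_ring_hom[OF ideal_genideal, of Rel G]
  by (simp add: Pres_def cls_def[abs_def])

lemma carrier_Pres: "carrier (Pres G Rel) = cls G Rel ` carrier (FA G)"
  by (auto simp: Pres_def FactRing_def A_RCOSETS_def' cls_def)

lemma cls_eq_zero:
  assumes "Rel \<subseteq> carrier (FA G)" "f \<in> genideal (FA G) Rel"
  shows "cls G Rel f = zero (Pres G Rel)"
proof -
  interpret I: ideal "genideal (FA G) Rel" "FA G" by (rule ideal_genideal[OF assms(1)])
  show ?thesis using assms(2) by (simp add: cls_def Pres_def FactRing_def I.a_rcos_const)
qed

lemma cls_rel:
  assumes "Rel \<subseteq> carrier (FA G)" "r \<in> Rel"
  shows "cls G Rel r = zero (Pres G Rel)"
  using cls_eq_zero[OF assms(1)] ring.genideal_self[OF ring_FA assms(1)] assms(2) by blast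

text \<open>A ring homomorphism need not be linear over the scalars, so agreement on their classes
  is a separate condition. Extensionality turns agreement on the carrier into equality of
  functions.\<close>

lemma Pres_hom_eqI:
  assumes Rel: "Rel \<subseteq> carrier (FA G)" and R: "ring R"
    and h: "h \<in> ring_hom (Pres G Rel) R" "h' \<in> ring_hom (Pres G Rel) R"
    and ext: "h \<in> extensional (carrier (Pres G Rel))" "h' \<in> extensional (carrier (Pres G Rel))"
    and sc: "\<And>c. h (cls G Rel (sc c)) = h' (cls G Rel (sc c))"
    and gen: "\<And>x. x \<in> G \<Longrightarrow> h (cls G Rel (gen x)) = h' (cls G Rel (gen x))"
  shows "h = h'"
proof (rule extensionalityI[OF ext])
  fix X assume "X \<in> carrier (Pres G Rel)"
  then obtain f where f: "f \<in> carrier (FA G)" and X: "X = cls G Rel f" by (auto simp: carrier_Pres)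
  have "f \<in> {f. h (cls G Rel f) = h' (cls G Rel f)}"
    using f
  proof (rule FA_induct)
    note hom = ring_hom_mult[OF cls_hom[OF Rel], simplified] ring_hom_add[OF cls_hom[OF Rel], simplified]
      ring_hom_closed[OF cls_hom[OF Rel]]
    fix x y assume *: "x \<in> carrier (FA G)" "y \<in> carrier (FA G)" "x \<in> {f. h (cls G Rel f) = h' (cls G Rel f)}"
      "y \<in> {f. h (cls G Rel f) = h' (cls G Rel f)}"
    then show "fadd x y \<in> {f. h (cls G Rel f) = h' (cls G Rel f)}"
      by (simp add: hom ring_hom_add[OF h(1)] ring_hom_add[OF h(2)])
    show "fmul x y \<in> {f. h (cls G Rel f) = h' (cls G Rel f)}"
      using * by (simp add: hom ring_hom_mult[OF h(1)] ring_hom_mult[OF h(2)])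
  qed (use sc gen in auto)
  then show "h X = h' X" by (simp add: X)
qed

text \<open>The kernel of h is an ideal containing the relations, so h is constant on each coset and
  \<open>the_elem\<close> picks the common value.\<close>

lemma Pres_hom_exists:
  assumes Rel: "Rel \<subseteq> carrier (FA G)" and R: "ring R"
    and h: "h \<in> ring_hom (FA G) R" and kill: "\<And>r. r \<in> Rel \<Longrightarrow> h r = zero R"
  obtains \<Psi> where "\<Psi> \<in> ring_hom (Pres G Rel) R" "\<Psi> \<in> extensional (carrier (Pres G Rel))"
    "\<And>f. f \<in> carrier (FA G) \<Longrightarrow> \<Psi> (cls G Rel f) = h f"
proof -
  let ?I = "genideal (FA G) Rel"
  interpret F: ring "FA G" by (rule ring_FA)
  interpret R: ring R by (rule R)
  have hr: "ring_hom_ring (FA G) R h" by (rule ring_hom_ringI2[OF ring_FA R h])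
  interpret I: ideal ?I "FA G" by (rule ideal_genideal[OF Rel])
  have "?I \<subseteq> a_kernel (FA G) R h"
    using Rel kill by (intro F.genideal_minimal ring_hom_ring.kernel_is_ideal[OF hr]) (auto simp: a_kernel_def')
  then have I: "h x = zero R" if "x \<in> ?I" for x using that by (auto simp: a_kernel_def')
  note hh = ring_hom_closed[OF h] ring_hom_mult[OF h, simplified] ring_hom_add[OF h, simplified]
    ring_hom_one[OF h, simplified]
  define \<Psi> where "\<Psi> = (\<lambda>X\<in>carrier (Pres G Rel). the_elem (h ` X))"
  have cls: "\<Psi> (cls G Rel f) = h f" if f: "f \<in> carrier (FA G)" for f
  proof -
    have "h ` cls G Rel f = {h f}"
    proof -
      have "h x = h f" if "x \<in> cls G Rel f" for x
        using that f I I.a_Hcarr by (auto simp: cls_def a_r_coset_def' hh)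
      moreover have "f \<in> cls G Rel f" using I.a_rcos_self[OF f] by (simp add: cls_def)
      ultimately show ?thesis by blast
    qed
    then show ?thesis using f by (simp add: \<Psi>_def carrier_Pres)
  qed
  have "\<Psi> \<in> ring_hom (Pres G Rel) R"
  proof (rule ring_hom_memI)
    fix X Y assume "X \<in> carrier (Pres G Rel)" "Y \<in> carrier (Pres G Rel)"
    then obtain f g where fg: "f \<in> carrier (FA G)" "g \<in> carrier (FA G)" "X = cls G Rel f" "Y = cls G Rel g"
      by (auto simp: carrier_Pres)
    show "\<Psi> (X \<otimes>\<^bsub>Pres G Rel\<^esub> Y) = \<Psi> X \<otimes>\<^bsub>R\<^esub> \<Psi> Y"
      using fg cls[OF fmul_FA[OF fg(1,2)]] ring_hom_mult[OF cls_hom[OF Rel] fg(1,2)]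
      by (simp add: cls hh)
    show "\<Psi> (X \<oplus>\<^bsub>Pres G Rel\<^esub> Y) = \<Psi> X \<oplus>\<^bsub>R\<^esub> \<Psi> Y"
      using fg cls[OF fadd_FA[OF fg(1,2)]] ring_hom_add[OF cls_hom[OF Rel] fg(1,2)]
      by (simp add: cls hh)
  next
    fix X assume "X \<in> carrier (Pres G Rel)"
    then show "\<Psi> X \<in> carrier R" using cls by (auto simp: carrier_Pres hh)
  next
    show "\<Psi> \<one>\<^bsub>Pres G Rel\<^esub> = \<one>\<^bsub>R\<^esub>"
      using cls[OF fone_FA] ring_hom_one[OF cls_hom[OF Rel]] by (simp add: hh)
  qed
  moreover have "\<Psi> \<in> extensional (carrier (Pres G Rel))" by (simp add: \<Psi>_def)
  ultimately show ?thesis using that cls by blast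
qed

section \<open>Embedding rings with carriers into a type of class ring\<close>

text \<open>The product of all rings carried by subsets of \<open>'a\<close>: a non-unital ring in the type class sense that
contains each of them, so that identities in a ring with carrier can be proved without membership side conditions.
The unit of the embedded ring becomes an idempotent, called e below.\<close>

typedef 'a ringprod = "{f :: 'a ring \<Rightarrow> 'a. \<forall>R. if ring R then f R \<in> carrier R else f R = undefined}"
  by (intro exI[of _ "\<lambda>R. if ring R then zero R else undefined"]) (auto intro: ring.ring_simprules(2))

setup_lifting type_definition_ringprod

instantiation ringprod :: (type) ring
begin

lift_definition zero_ringprod :: "'a ringprod" is "\<lambda>R. if ring R then zero R else undefined"
  by (simp add: ring.ring_simprules(2))
lift_definition plus_ringprod :: "'a ringprod \<Rightarrow> 'a ringprod \<Rightarrow> 'a ringprod" is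
  "\<lambda>f g R. if ring R then f R \<oplus>\<^bsub>R\<^esub> g R else undefined"
  by (simp add: ring.ring_simprules(1))
lift_definition times_ringprod :: "'a ringprod \<Rightarrow> 'a ringprod \<Rightarrow> 'a ringprod" is
  "\<lambda>f g R. if ring R then f R \<otimes>\<^bsub>R\<^esub> g R else undefined"
  by (simp add: ring.ring_simprules(5))
lift_definition uminus_ringprod :: "'a ringprod \<Rightarrow> 'a ringprod" is
  "\<lambda>f R. if ring R then \<ominus>\<^bsub>R\<^esub> f R else undefined"
  by (simp add: ring.ring_simprules(3))
definition minus_ringprod :: "'a ringprod \<Rightarrow> 'a ringprod \<Rightarrow> 'a ringprod" where
  "minus_ringprod f g = f + (- g)"

instance
proof
  fix a b c :: "'a ringprod"
  show "a + b + c = a + (b + c)" by transfer (rule ext, auto, metis ring.ring_simprules(7))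
  show "a + b = b + a" by transfer (rule ext, auto, metis ring.ring_simprules(10))
  show "0 + a = a" by transfer (rule ext, auto, metis ring.ring_simprules(8))
  show "- a + a = 0" by transfer (rule ext, auto, metis ring.ring_simprules(9))
  show "a - b = a + - b" by (simp add: minus_ringprod_def)
  show "a * b * c = a * (b * c)" by transfer (rule ext, auto, metis ring.ring_simprules(11))
  show "(a + b) * c = a * c + b * c" by transfer (rule ext, auto, metis ring.ring_simprules(13))
  show "a * (b + c) = a * b + a * c" by transfer (rule ext, auto, metis ring.ring_simprules(23))
qed

end

definition emb :: "'a ring \<Rightarrow> 'a \<Rightarrow> 'a ringprod" where
  "emb R x = Abs_ringprod (\<lambda>S. if S = R then x else if ring S then zero S else undefined)"

definition component :: "'a ring \<Rightarrow> 'a ringprod \<Rightarrow> 'a" where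
  "component R b = Rep_ringprod b R"

lemma Rep_emb:
  assumes "ring R" "x \<in> carrier R"
  shows "Rep_ringprod (emb R x) = (\<lambda>S. if S = R then x else if ring S then zero S else undefined)"
  unfolding emb_def using assms by (intro Abs_ringprod_inverse) (auto simp: ring.ring_simprules(2))

lemma component_emb: "ring R \<Longrightarrow> x \<in> carrier R \<Longrightarrow> component R (emb R x) = x"
  by (simp add: component_def Rep_emb)

lemma emb_mult:
  assumes "ring R" "x \<in> carrier R" "y \<in> carrier R"
  shows "emb R (x \<otimes>\<^bsub>R\<^esub> y) = emb R x * emb R y"
proof -
  have "zero S \<otimes>\<^bsub>S\<^esub> zero S = zero S" if "ring S" for S :: "'a ring"
    using ring.ring_simprules(2,24)[OF that] by blast
  with assms show ?thesis
    by (auto simp: Rep_ringprod_inject[symmetric] times_ringprod.rep_eq Rep_emb ring.ring_simprules(5) fun_eq_iff)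
qed

lemma emb_add:
  assumes "ring R" "x \<in> carrier R" "y \<in> carrier R"
  shows "emb R (x \<oplus>\<^bsub>R\<^esub> y) = emb R x + emb R y"
proof -
  have "zero S \<oplus>\<^bsub>S\<^esub> zero S = zero S" if "ring S" for S :: "'a ring"
    using ring.ring_simprules(2,8)[OF that] by blast
  with assms show ?thesis
    by (auto simp: Rep_ringprod_inject[symmetric] plus_ringprod.rep_eq Rep_emb ring.ring_simprules(1) fun_eq_iff)
qed

text \<open>The codomain is only of class \<open>ring\<close>, which has no unit; e records the
  image of the unit and acts as a unit on the image. The locale serves both the embedded target
  algebra and the evaluation of the free algebra.\<close>

locale ghom = ring R for R :: "('a, 'm) ring_scheme" (structure) +
  fixes g :: "'a \<Rightarrow> 'b::ring" and e :: 'b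
  assumes g_mult: "x \<in> carrier R \<Longrightarrow> y \<in> carrier R \<Longrightarrow> g (x \<otimes> y) = g x * g y"
    and g_add: "x \<in> carrier R \<Longrightarrow> y \<in> carrier R \<Longrightarrow> g (x \<oplus> y) = g x + g y"
    and g_one: "g \<one> = e"
begin

lemma g_zero: "g \<zero> = 0"
  using g_add[of \<zero> \<zero>] by simp

lemma g_a_inv: "x \<in> carrier R \<Longrightarrow> g (\<ominus> x) = - g x"
  using g_add[of "\<ominus> x" x] by (simp add: l_neg g_zero eq_neg_iff_add_eq_0)

lemma lsum_simps [simp]: "lsum R [] = \<zero>" "lsum R (x # xs) = x \<oplus> lsum R xs"
  by (simp_all add: lsum_def)

lemma lprod_simps [simp]: "lprod R [] = \<one>" "lprod R (x # xs) = x \<otimes> lprod R xs"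
  by (simp_all add: lprod_def)

lemma lsum_closed: "set xs \<subseteq> carrier R \<Longrightarrow> lsum R xs \<in> carrier R"
  by (induction xs) auto

lemma lprod_closed: "set xs \<subseteq> carrier R \<Longrightarrow> lprod R xs \<in> carrier R"
  by (induction xs) auto

lemma g_lsum: "set xs \<subseteq> carrier R \<Longrightarrow> g (lsum R xs) = sum_list (map g xs)"
  by (induction xs) (auto simp: g_zero g_add lsum_closed)

end

lemma ghom_emb: "ring R \<Longrightarrow> ghom R (emb R) (emb R (one R))"
  by (simp add: ghom_def ghom_axioms_def emb_mult emb_add)


section \<open>Evaluation of the free algebra\<close>

locale scalars =
  fixes e :: "'b::ring" and s :: "K \<Rightarrow> 'b"
  assumes s_add: "s (c + d) = s c + s d" and s_mult: "s (c * d) = s c * s d" and s_one: "s 1 = e"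
begin

lemma s_zero: "s 0 = 0"
  using s_add[of 0 0] by simp

lemma s_minus: "s (- c) = - s c"
  using s_add[of "- c" c] by (simp add: s_zero eq_neg_iff_add_eq_0)

lemma e_s: "e * s c = s c" and s_e: "s c * e = s c"
  using s_mult[of 1 c] s_mult[of c 1] by (simp_all add: s_one)

lemma e_e: "e * e = e"
  using e_s[of 1] by (simp add: s_one)

lemma s_comm: "s c * s d = s d * s c"
  by (metis s_mult mult.commute)

end

text \<open>Substitution of ring elements for the generators; the scalars have to commute with these
  elements. It lives on the algebra over all letters of the type and is restricted to the prescribed
  generators at the end.\<close>

locale faeval = scalars e s for e :: "'b::ring" and s +
  fixes g :: "'g \<Rightarrow> 'b"
  assumes e_g: "e * g x = g x" and s_g: "s c * g x = g x * s c"
begin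

lemma g_e: "g x * e = g x"
  using s_g[of 1 x] by (simp add: s_one e_g)

definition bp :: "'g list \<Rightarrow> 'b" where "bp w = foldr (\<lambda>x y. g x * y) w e"

lemma bp_simps [simp]: "bp [] = e" "bp (x # w) = g x * bp w"
  by (simp_all add: bp_def)

definition ev :: "'g fa \<Rightarrow> 'b" where "ev f = (\<Sum>w | f w \<noteq> 0. s (f w) * bp w)"

lemma ev_superset: "finite W \<Longrightarrow> {w. f w \<noteq> 0} \<subseteq> W \<Longrightarrow> ev f = (\<Sum>w\<in>W. s (f w) * bp w)"
  unfolding ev_def by (rule sum.mono_neutral_left) (auto simp: s_zero)

lemma ev_fadd:
  assumes "f \<in> carrier (FA UNIV)" "h \<in> carrier (FA UNIV)"
  shows "ev (fadd f h) = ev f + ev h"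
proof -
  let ?W = "{w. f w \<noteq> 0} \<union> {w. h w \<noteq> 0}"
  have "finite ?W" using assms by (simp add: carrier_FA)
  then have "ev (fadd f h) = (\<Sum>w\<in>?W. s (fadd f h w) * bp w)" "ev f = (\<Sum>w\<in>?W. s (f w) * bp w)"
    "ev h = (\<Sum>w\<in>?W. s (h w) * bp w)"
    by (auto intro!: ev_superset simp: fadd_def)
  then show ?thesis by (simp add: fadd_def s_add sum.distrib algebra_simps)
qed

lemma ev_sc [simp]: "ev (sc c) = s c"
  by (subst ev_superset[of "{[]}"]) (auto simp: sc_def s_e)

lemma ev_fone: "ev fone = e" and ev_fzero: "ev fzero = 0"
  by (simp_all add: fone_def s_one) (simp add: ev_def fzero_def)

lemma ev_fscal: 
  assumes "f \<in> carrier (FA UNIV)"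
  shows "ev (fscal c f) = s c * ev f"
proof -
  have "finite {w. f w \<noteq> 0}" using assms by (simp add: carrier_FA)
  then have "ev (fscal c f) = (\<Sum>w | f w \<noteq> 0. s (fscal c f w) * bp w)"
    by (intro ev_superset) (auto simp: fscal_def)
  then show ?thesis by (simp add: ev_def fscal_def s_mult sum_distrib_left mult.assoc)
qed

lemma fmul_gen: "fmul (gen x) f w = (case w of [] \<Rightarrow> 0 | y # v \<Rightarrow> if y = x then f v else 0)"
proof (cases w)
  case (Cons y v)
  have "fmul (gen x) f w = (\<Sum>i\<le>length w. if i = 1 then (if y = x then f v else 0) else 0)"
    unfolding fmul_def
  proof (rule sum.cong)
    fix i assume "i \<in> {..length w}"
    then have "take i w = [x] \<longleftrightarrow> i = 1 \<and> y = x" by (cases i) (auto simp: Cons)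
    then show "gen x (take i w) * f (drop i w) = (if i = 1 then (if y = x then f v else 0) else 0)"
      by (auto simp: gen_def Cons)
  qed simp
  then show ?thesis by (auto simp: Cons Suc_le_eq)
qed (simp add: fmul_def gen_def)

lemma e_ev: "e * ev f = ev f"
  by (simp add: ev_def sum_distrib_left e_s flip: mult.assoc)

lemma ev_gen_fmul:
  assumes "f \<in> carrier (FA UNIV)"
  shows "ev (fmul (gen x) f) = g x * ev f"
proof -
  have "finite {w. f w \<noteq> 0}" using assms by (simp add: carrier_FA)
  then have "ev (fmul (gen x) f) = (\<Sum>w\<in>Cons x ` {w. f w \<noteq> 0}. s (fmul (gen x) f w) * bp w)"
    by (intro ev_superset) (auto simp: fmul_gen neq_Nil_conv split: list.splits if_splits)
  also have "\<dots> = (\<Sum>w | f w \<noteq> 0. s (f w) * (g x * bp w))"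
    by (subst sum.reindex) (auto simp: fmul_gen)
  also have "\<dots> = g x * ev f"
    by (simp add: ev_def sum_distrib_left s_g flip: mult.assoc)
  finally show ?thesis .
qed

lemma ev_gen [simp]: "ev (gen x) = g x"
  using ev_gen_fmul[of fone x] by (simp add: fmul_fone_right ev_fone g_e)

text \<open>Induction on the left factor alone, with the right factor kept general; the product case
  is then associativity.\<close>

lemma ev_fmul:
  assumes "f \<in> carrier (FA UNIV)" "h \<in> carrier (FA UNIV)"
  shows "ev (fmul f h) = ev f * ev h"
proof -
  have "f \<in> {f. \<forall>h\<in>carrier (FA UNIV). ev (fmul f h) = ev f * ev h}"
    using assms(1)
    by (rule FA_induct) 
      (auto simp: fmul_sc_left ev_fscal ev_gen_fmul fmul_fadd_left ev_fadd fmul_FA algebra_simps fmul_assoc)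
  with assms(2) show ?thesis by blast
qed

lemma ev_fsub:
  assumes "f \<in> carrier (FA UNIV)" "h \<in> carrier (FA UNIV)"
  shows "ev (fsub f h) = ev f - ev h"
  using assms by (simp add: fsub_eq ev_fadd fscal_FA ev_fscal s_minus s_one e_ev)

lemma ghom_ev: "ghom (FA UNIV) ev e"
  by (simp add: ghom_def ghom_axioms_def ring_FA ev_fmul ev_fadd ev_fone)

end

section \<open>Rational functions in the half-power variables\<close>

text \<open>Countably many variables, indexed by numbers that will encode the pairs (i, r), so that
  one field serves all n and all a_i.\<close>

type_synonym P = "(nat \<Rightarrow>\<^sub>0 nat) \<Rightarrow>\<^sub>0 K"
type_synonym L = "P fract"

abbreviation "lk \<equiv> Poly_Mapping.lookup"
abbreviation "sg \<equiv> Poly_Mapping.single"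

lemma P_sum_single: "(p :: 'x \<Rightarrow>\<^sub>0 'y::comm_monoid_add) = (\<Sum>m\<in>Poly_Mapping.keys p. sg m (lk p m))"
  by (rule poly_mapping_eqI) (auto simp: lookup_sum lookup_single when_def sum.delta' not_in_keys_iff_lookup_eq_zero)

lemma additive_sum:
  fixes F :: "'p::ab_group_add \<Rightarrow> 'b::ab_group_add"
  assumes "\<And>p q. F (p + q) = F p + F q"
  shows "F (sum f A) = (\<Sum>x\<in>A. F (f x))"
proof -
  have "F 0 = 0" using assms[of 0 0] by simp
  then show ?thesis by (induction A rule: infinite_finite_induct) (simp_all add: assms)
qed

text \<open>Both sides are biadditive, and every element is a finite sum of singles.\<close>

lemma multiplicative_if_on_singles:
  fixes F :: "('x::comm_monoid_add \<Rightarrow>\<^sub>0 'y::comm_ring_1) \<Rightarrow> 'b::ring"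
  assumes add: "\<And>p q. F (p + q) = F p + F q"
    and mul: "\<And>m c m' c'. F (sg (m + m') (c * c')) = F (sg m c) * F (sg m' c')"
  shows "F (p * q) = F p * F q"
proof -
  have F: "F p = (\<Sum>m\<in>Poly_Mapping.keys p. F (sg m (lk p m)))" for p
    using arg_cong[OF P_sum_single, of F p] additive_sum[of F, OF add] by simp
  have "p * q = (\<Sum>m\<in>Poly_Mapping.keys p. sg m (lk p m)) * (\<Sum>m\<in>Poly_Mapping.keys q. sg m (lk q m))"
    by (rule arg_cong2[OF P_sum_single P_sum_single])
  then have "F (p * q) = (\<Sum>m\<in>Poly_Mapping.keys p. \<Sum>m'\<in>Poly_Mapping.keys q. F (sg m (lk p m)) * F (sg m' (lk q m')))"
    by (simp only: sum_product additive_sum[of F, OF add] mult_single mul)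
  then show ?thesis
    by (simp only: F[of p] F[of q] sum_product)
qed

text \<open>Since h may have a kernel, it does not extend to the whole fraction field, only to the
  fractions admitting a denominator with invertible image. The codomain need be neither commutative
  nor unital, so invertibility is meant in the corner of the idempotent e.\<close>

locale fract_ext =
  fixes h :: "'p::idom \<Rightarrow> 'b::ring" and e :: 'b
  assumes h_add: "h (p + q) = h p + h q" and h_mult: "h (p * q) = h p * h q" and h_one: "h 1 = e"
begin

lemma e_h: "e * h p = h p" and h_e: "h p * e = h p"
  using h_mult[of 1 p] h_mult[of p 1] by (simp_all add: h_one)

lemma h_zero: "h 0 = 0"
  using h_add[of 0 0] by simp

lemma h_minus: "h (- p) = - h p"
  using h_add[of "- p" p] by (simp add: h_zero eq_neg_iff_add_eq_0)

lemma h_comm: "h p * h q = h q * h p"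
  by (metis h_mult mult.commute)

text \<open>The clause \<open>e * y = y\<close> keeps the inverse inside the corner of e.\<close>

definition cinv :: "'b \<Rightarrow> 'b \<Rightarrow> bool" where
  "cinv x y \<longleftrightarrow> e * y = y \<and> x * y = e \<and> y * x = e"

lemma cinv_mult:
  assumes "cinv (h q) y" "cinv (h q') y'"
  shows "cinv (h (q * q')) (y' * y)"
proof -
  have "h q * h q' * (y' * y) = h q * (h q' * y') * y" by (simp add: mult.assoc)
  moreover have "y' * y * (h q * h q') = y' * ((y * h q) * h q')" by (simp add: mult.assoc)
  ultimately show ?thesis
    using assms by (simp add: cinv_def h_mult h_e e_h) (simp flip: mult.assoc)
qed

text \<open>States without division that b is the quotient of \<open>h p\<close> by
  \<open>h q\<close>. The clause \<open>b * e = b\<close> is what makes \<open>h q\<close>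
  cancellable, since cancelling it leaves \<open>b * e\<close>.\<close>

definition represents :: "'p fract \<Rightarrow> 'b \<Rightarrow> bool" where
  "represents x b \<longleftrightarrow> (\<exists>p q y. q \<noteq> 0 \<and> x = Fract p q \<and> cinv (h q) y \<and> b * h q = h p \<and> b * e = b)"

text \<open>Over the common denominator both values have the same product with
  \<open>h (q * q')\<close>, which is invertible.\<close>

lemma represents_unique:
  assumes "represents x b" "represents x b'"
  shows "b = b'"
proof -
  obtain p q y p' q' y' where *: "q \<noteq> 0" "x = Fract p q" "cinv (h q) y" "b * h q = h p" "b * e = b"
    "q' \<noteq> 0" "x = Fract p' q'" "cinv (h q') y'" "b' * h q' = h p'" "b' * e = b'"
    using assms unfolding represents_def by blast
  then have eq: "p * q' = p' * q" by (simp add: eq_fract)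
  have "b * h (q * q') = h (p * q')" by (simp add: h_mult * flip: mult.assoc)
  moreover have "b' * h (q * q') = h (p' * q)"
    unfolding mult.commute[of q q'] by (simp add: h_mult * flip: mult.assoc)
  ultimately have "b * h (q * q') * (y' * y) = b' * h (q * q') * (y' * y)" by (simp add: eq)
  with cinv_mult[OF *(3,8)] * show ?thesis by (simp add: cinv_def mult.assoc)
qed

text \<open>The value of io outside dom is meaningless.\<close>

definition dom :: "'p fract set" where "dom = {x. \<exists>b. represents x b}"
definition io :: "'p fract \<Rightarrow> 'b" where "io x = (THE b. represents x b)"

lemma io_eq: "represents x b \<Longrightarrow> x \<in> dom \<and> io x = b"
  unfolding dom_def io_def using represents_unique by blast

lemma represents_io: "x \<in> dom \<Longrightarrow> represents x (io x)"
  using io_eq dom_def by auto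

lemma represents_add:
  assumes "represents x b" "represents x' b'"
  shows "represents (x + x') (b + b')"
proof -
  obtain p q y p' q' y' where *: "q \<noteq> 0" "x = Fract p q" "cinv (h q) y" "b * h q = h p" "b * e = b"
    "q' \<noteq> 0" "x' = Fract p' q'" "cinv (h q') y'" "b' * h q' = h p'" "b' * e = b'"
    using assms unfolding represents_def by blast
  have "b * (h q * h q') = h p * h q'" by (simp add: * flip: mult.assoc)
  moreover have "b' * (h q * h q') = h p' * h q"
    unfolding h_comm[of q q'] by (simp add: * flip: mult.assoc)
  ultimately have "(b + b') * h (q * q') = h (p * q' + p' * q)" by (simp add: h_add h_mult distrib_right)
  then show ?thesis
    unfolding represents_def using * cinv_mult[OF *(3,8)]
    by (intro exI[of _ "p * q' + p' * q"] exI[of _ "q * q'"] exI[of _ "y' * y"]) (simp add: distrib_right)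
qed

lemma represents_mult:
  assumes "represents x b" "represents x' b'"
  shows "represents (x * x') (b * b')"
proof -
  obtain p q y p' q' y' where *: "q \<noteq> 0" "x = Fract p q" "cinv (h q) y" "b * h q = h p" "b * e = b"
    "q' \<noteq> 0" "x' = Fract p' q'" "cinv (h q') y'" "b' * h q' = h p'" "b' * e = b'"
    using assms unfolding represents_def by blast
  have "b * b' * h (q * q') = b * (b' * h q') * h q"
    unfolding mult.commute[of q q'] by (simp add: h_mult mult.assoc)
  also have "\<dots> = b * (h q * h p')" by (simp add: * h_comm[of q p'] mult.assoc)
  also have "\<dots> = h (p * p')" by (simp add: h_mult * flip: mult.assoc)
  finally show ?thesis
    unfolding represents_def using * cinv_mult[OF *(3,8)]
    by (intro exI[of _ "p * p'"] exI[of _ "q * q'"] exI[of _ "y' * y"]) (simp add: mult.assoc)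
qed

lemma represents_h: "represents (Fract p 1) (h p)"
  unfolding represents_def
  by (intro exI[of _ p] exI[of _ 1] exI[of _ e]) (use h_e[of 1] in \<open>simp add: cinv_def h_one h_e\<close>)

text \<open>Since \<open>h p = b * h q\<close> is a product of units of the corner, p is an
  admissible denominator for the inverse fraction.\<close>

lemma represents_inverse:
  assumes "represents x b" "cinv b c" "x \<noteq> 0"
  shows "represents (inverse x) c"
proof -
  obtain p q y where *: "q \<noteq> 0" "x = Fract p q" "cinv (h q) y" "b * h q = h p" "b * e = b"
    using assms unfolding represents_def by blast
  have c: "c * h p = h q" using assms(2) by (simp add: cinv_def e_h flip: *(4) mult.assoc)
  have "c * e = c"
    using assms(2) by (metis cinv_def mult.assoc)
  moreover have "cinv (h p) (y * c)"
    unfolding cinv_def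
  proof (intro conjI)
    show "e * (y * c) = y * c" using *(3) by (simp add: cinv_def flip: mult.assoc)
    have "h p * (y * c) = b * (h q * y) * c" by (simp add: mult.assoc flip: *(4))
    then show "h p * (y * c) = e" using * assms(2) by (simp add: cinv_def)
    show "y * c * h p = e" using * by (simp add: mult.assoc c cinv_def)
  qed
  moreover have "p \<noteq> 0" using * assms by (auto simp: Zero_fract_def eq_fract)
  ultimately show ?thesis
    unfolding represents_def using c by (intro exI[of _ q] exI[of _ p] exI[of _ "y * c"]) (simp add: *)
qed

lemma io_Fract1: "Fract p 1 \<in> dom" "io (Fract p 1) = h p"
  using io_eq[OF represents_h] by auto

lemma dom_add: "x \<in> dom \<Longrightarrow> y \<in> dom \<Longrightarrow> x + y \<in> dom"
  and io_add: "x \<in> dom \<Longrightarrow> y \<in> dom \<Longrightarrow> io (x + y) = io x + io y"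
  using io_eq[OF represents_add] represents_io by blast+

lemma dom_mult: "x \<in> dom \<Longrightarrow> y \<in> dom \<Longrightarrow> x * y \<in> dom"
  and io_mult: "x \<in> dom \<Longrightarrow> y \<in> dom \<Longrightarrow> io (x * y) = io x * io y"
  using io_eq[OF represents_mult] represents_io by blast+

lemma dom_inverse: "x \<in> dom \<Longrightarrow> cinv (io x) c \<Longrightarrow> x \<noteq> 0 \<Longrightarrow> inverse x \<in> dom"
  and io_inverse: "x \<in> dom \<Longrightarrow> cinv (io x) c \<Longrightarrow> x \<noteq> 0 \<Longrightarrow> io (inverse x) = c"
  using io_eq[OF represents_inverse] represents_io by blast+

lemma dom_zero: "0 \<in> dom" and io_zero: "io 0 = 0" and dom_one: "1 \<in> dom" and io_one: "io 1 = e"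
  using io_Fract1[of 0] io_Fract1[of 1] by (simp_all add: Zero_fract_def One_fract_def h_zero h_one)

lemma dom_minus: "x \<in> dom \<Longrightarrow> - x \<in> dom" and io_minus: "x \<in> dom \<Longrightarrow> io (- x) = - io x"
proof -
  have m1: "- 1 \<in> dom" "io (- 1) = - e"
    using io_Fract1[of "- 1"] by (simp_all add: One_fract_def h_minus h_one)
  assume x: "x \<in> dom"
  show "- x \<in> dom" using dom_mult[OF m1(1) x] by simp
  have "io x = io (1 * x)" by simp
  then have "e * io x = io x" unfolding io_mult[OF dom_one x] io_one by simp
  then show "io (- x) = - io x" using io_mult[OF m1(1) x] m1 by simp
qed

lemma dom_diff: "x \<in> dom \<Longrightarrow> y \<in> dom \<Longrightarrow> x - y \<in> dom"
  and io_diff: "x \<in> dom \<Longrightarrow> y \<in> dom \<Longrightarrow> io (x - y) = io x - io y"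
  using dom_add[of x "- y"] io_add[of x "- y"] by (auto simp: dom_minus io_minus)

lemma e_io: "x \<in> dom \<Longrightarrow> e * io x = io x" and io_e: "x \<in> dom \<Longrightarrow> io x * e = io x"
  using io_mult[OF dom_one, of x] io_mult[OF _ dom_one, of x] by (auto simp: io_one)

lemma io_comm: "x \<in> dom \<Longrightarrow> y \<in> dom \<Longrightarrow> io x * io y = io y * io x"
  by (metis io_mult mult.commute)

lemma dom_sum: "(\<And>x. x \<in> A \<Longrightarrow> f x \<in> dom) \<Longrightarrow> sum f A \<in> dom"
  and io_sum: "(\<And>x. x \<in> A \<Longrightarrow> f x \<in> dom) \<Longrightarrow> io (sum f A) = (\<Sum>x\<in>A. io (f x))"
proof -
  have "(\<forall>x\<in>A. f x \<in> dom) \<longrightarrow> sum f A \<in> dom \<and> io (sum f A) = (\<Sum>x\<in>A. io (f x))"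
    by (induction A rule: infinite_finite_induct) (simp_all add: dom_zero io_zero dom_add io_add)
  then show "(\<And>x. x \<in> A \<Longrightarrow> f x \<in> dom) \<Longrightarrow> sum f A \<in> dom"
    "(\<And>x. x \<in> A \<Longrightarrow> f x \<in> dom) \<Longrightarrow> io (sum f A) = (\<Sum>x\<in>A. io (f x))" by blast+
qed

lemma io_inverse_cinv:
  assumes "x \<in> dom" "inverse x \<in> dom" "x \<noteq> 0"
  shows "cinv (io x) (io (inverse x))"
  using assms io_mult[of x "inverse x"] io_mult[of "inverse x" x]
  by (simp add: cinv_def e_io io_one)

end


section \<open>The field L: constants, variables and shift automorphisms\<close>

definition cst :: "K \<Rightarrow> L" where "cst c = Fract (sg 0 c) 1"
definition var :: "nat \<Rightarrow> L" where "var k = Fract (sg (sg k 1) 1) 1"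

lemma cst_add: "cst (c + d) = cst c + cst d" and cst_mult: "cst (c * d) = cst c * cst d"
  and cst_minus: "cst (- c) = - cst c"
  by (simp_all add: cst_def single_add mult_single single_uminus)

lemma cst_0 [simp]: "cst 0 = 0" and cst_1 [simp]: "cst 1 = 1"
  by (simp_all add: cst_def fract_collapse)

lemma cst_eq_0_iff [simp]: "cst c = 0 \<longleftrightarrow> c = 0"
proof -
  have "sg 0 c = 0 \<longleftrightarrow> c = 0" for c :: K by (metis lookup_single_eq lookup_zero single_zero)
  then show ?thesis by (simp add: cst_def Zero_fract_def eq_fract)
qed

lemma cst_diff: "cst (c - d) = cst c - cst d"
  using cst_add[of c "- d"] by (simp add: cst_minus)

lemma cst_inverse: "cst (inverse c) = inverse (cst c)"
proof (cases "c = 0")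
  case False
  then have "cst c * cst (inverse c) = 1" by (simp flip: cst_mult)
  then show ?thesis by (rule inverse_unique[symmetric])
qed simp

lemma cst_power: "cst (c ^ n) = cst c ^ n"
  by (induction n) (simp_all add: cst_mult)

lemma cst_power_int: "cst (c powi n) = cst c powi n"
  by (simp add: power_int_def cst_power cst_inverse)

lemma cst_eq_iff: "cst c = cst d \<longleftrightarrow> c = d"
  using cst_eq_0_iff[of "c - d"] by (simp add: cst_diff)

lemma single_nat_eq_iff: "sg k (a::nat) = sg l b \<longleftrightarrow> (k = l \<and> a = b) \<or> (a = 0 \<and> b = 0)"
proof (cases "k = l")
  case True
  then show ?thesis by (metis lookup_single_eq)
next
  case False
  then show ?thesis by (metis lookup_single_eq lookup_single_not_eq single_zero)
qed

lemma var_nonzero [simp]: "var k \<noteq> 0"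
proof -
  have "sg (sg k 1) 1 \<noteq> (0 :: P)" by (metis lookup_single_eq lookup_zero one_neq_zero)
  then show ?thesis by (simp add: var_def Zero_fract_def eq_fract)
qed

text \<open>The exponents of the two monomials differ. As the coordinates \<open>w\<close> will be
  squares of variables, this is why differences of multiples of distinct coordinates can serve as
  denominators.\<close>

lemma var_sq_neq:
  assumes "k \<noteq> l" "c \<noteq> 0"
  shows "cst c * (var k)\<^sup>2 \<noteq> cst d * (var l)\<^sup>2"
proof
  have *: "cst c * (var k)\<^sup>2 = Fract (sg (sg k 2) c) 1" for c k
    by (simp add: cst_def var_def power2_eq_square mult_single single_add[symmetric] numeral_2_eq_2)
  assume "cst c * (var k)\<^sup>2 = cst d * (var l)\<^sup>2"
  then have "sg (sg k 2) c = (sg (sg l 2) d :: P)" by (simp add: * eq_fract)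
  then have "c = (d when sg l 2 = sg k (2::nat))" by (metis lookup_single lookup_single_eq)
  with assms show False by (simp add: single_nat_eq_iff)
qed

text \<open>The substitution that multiplies the k-th variable by c: each monomial is rescaled by c
  to the power of its exponent in that variable.\<close>

definition scale :: "nat \<Rightarrow> K \<Rightarrow> P \<Rightarrow> P" where
  "scale k c = Poly_Mapping.mapp (\<lambda>m x. c ^ lk m k * x)"

lemma lookup_scale: "lk (scale k c p) m = c ^ lk m k * lk p m"
  by (auto simp: scale_def lookup_mapp when_def not_in_keys_iff_lookup_eq_zero)

lemma scale_add: "scale k c (p + q) = scale k c p + scale k c q"
  by (rule poly_mapping_eqI) (simp add: lookup_scale lookup_add algebra_simps)

lemma scale_single: "scale k c (sg m a) = sg m (c ^ lk m k * a)"
  by (rule poly_mapping_eqI) (simp add: lookup_scale lookup_single when_def)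

lemma scale_mult: "scale k c (p * q) = scale k c p * scale k c q"
  by (rule multiplicative_if_on_singles)
    (simp_all add: scale_add scale_single mult_single lookup_add power_add algebra_simps)

lemma scale_1: "scale k c 1 = 1"
  using scale_single[of k c 0 1] by simp

lemma scale_eq_0: "c \<noteq> 0 \<Longrightarrow> scale k c p = 0 \<longleftrightarrow> p = 0"
  by (simp add: poly_mapping_eq_iff fun_eq_iff lookup_scale)

text \<open>The same substitution on fractions, obtained from \<open>fract_ext\<close> with L itself
  as codomain. For c \<noteq> 0 it is total, because \<open>scale\<close> is then injective.\<close>

definition sig :: "nat \<Rightarrow> K \<Rightarrow> L \<Rightarrow> L" where
  "sig k c = fract_ext.io (\<lambda>p. Fract (scale k c p) 1) 1"

lemma fract_ext_scale: "fract_ext (\<lambda>p. Fract (scale k c p) 1 :: L) 1"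
  by unfold_locales (simp_all add: scale_add scale_mult scale_1 One_fract_def)

lemma sig_represents:
  assumes "c \<noteq> 0" "q \<noteq> 0"
  shows "fract_ext.represents (\<lambda>p. Fract (scale k c p) 1 :: L) 1 (Fract p q) (Fract (scale k c p) (scale k c q))"
proof -
  interpret fract_ext "\<lambda>p. Fract (scale k c p) 1 :: L" 1 by (rule fract_ext_scale)
  have "scale k c q \<noteq> 0" using assms by (simp add: scale_eq_0)
  with assms show ?thesis unfolding represents_def cinv_def
    by (intro exI[of _ p] exI[of _ q] exI[of _ "Fract 1 (scale k c q)"])
      (simp add: eq_fract One_fract_def)
qed

context
  fixes k :: nat and c :: K
  assumes c: "c \<noteq> 0"
begin

interpretation fract_ext "\<lambda>p. Fract (scale k c p) 1 :: L" 1 by (rule fract_ext_scale)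

lemma sig_Fract: "q \<noteq> 0 \<Longrightarrow> sig k c (Fract p q) = Fract (scale k c p) (scale k c q)"
  unfolding sig_def using io_eq[OF sig_represents[OF c]] by simp

lemma dom_sig: "x \<in> dom"
  by (cases x) (use io_eq[OF sig_represents[OF c]] in auto)

lemma sig_add: "sig k c (x + y) = sig k c x + sig k c y" and sig_mult: "sig k c (x * y) = sig k c x * sig k c y"
  and sig_0: "sig k c 0 = 0" and sig_1: "sig k c 1 = 1" and sig_minus: "sig k c (- x) = - sig k c x"
  and sig_diff: "sig k c (x - y) = sig k c x - sig k c y"
  unfolding sig_def by (simp_all add: io_add io_mult io_zero io_one io_minus io_diff dom_sig)

lemma sig_cst: "sig k c (cst a) = cst a"
  by (simp add: cst_def sig_Fract scale_1 scale_single)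

lemma sig_var: "sig k c (var l) = (if l = k then cst c else 1) * var l"
  by (auto simp: var_def cst_def sig_Fract scale_1 scale_single lookup_single mult_single when_def)

lemma sig_inverse: "sig k c (inverse x) = inverse (sig k c x)"
proof (cases "x = 0")
  case False
  then have "sig k c x * sig k c (inverse x) = 1" by (simp add: sig_1 flip: sig_mult)
  then show ?thesis by (rule inverse_unique[symmetric])
qed (simp add: sig_0)

lemma sig_divide: "sig k c (x / y) = sig k c x / sig k c y"
  by (simp add: divide_inverse sig_mult sig_inverse)

lemma sig_power: "sig k c (x ^ n) = sig k c x ^ n"
  by (induction n) (simp_all add: sig_1 sig_mult)

lemma sig_power_int: "sig k c (x powi n) = sig k c x powi n"
  by (simp add: power_int_def sig_power sig_inverse)

lemma sig_prod: "sig k c (prod f A) = (\<Prod>x\<in>A. sig k c (f x))"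
  by (induction A rule: infinite_finite_induct) (simp_all add: sig_1 sig_mult)

lemma sig_sum: "sig k c (sum f A) = (\<Sum>x\<in>A. sig k c (f x))"
  by (induction A rule: infinite_finite_induct) (simp_all add: sig_0 sig_add)

end

lemmas sig_simps = sig_add sig_mult sig_0 sig_1 sig_minus sig_diff sig_cst sig_var sig_inverse sig_divide
  sig_power sig_power_int sig_prod sig_sum

section \<open>Evaluation of rational functions in a quantum torus\<close>

text \<open>Abstract commutative part of the target, with \<open>U k\<close> as the value of the
  k-th variable. The monomials in the \<open>U k\<close> may satisfy unknown relations.\<close>

locale torus = scalars e s for e :: "'b::ring" and s +
  fixes U :: "nat \<Rightarrow> 'b" and ks :: "nat list"
  assumes e_U: "k \<in> set ks \<Longrightarrow> e * U k = U k" and s_U: "k \<in> set ks \<Longrightarrow> s c * U k = U k * s c"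
    and U_comm: "k \<in> set ks \<Longrightarrow> l \<in> set ks \<Longrightarrow> U k * U l = U l * U k"
    and distinct_ks: "distinct ks"
begin

primrec pw :: "'b \<Rightarrow> nat \<Rightarrow> 'b" where "pw x 0 = e" | "pw x (Suc n) = x * pw x n"

lemma U_e: "k \<in> set ks \<Longrightarrow> U k * e = U k"
  using s_U[of k 1] by (simp add: s_one e_U)

lemma e_pw: "e * x = x \<Longrightarrow> e * pw x n = pw x n"
  by (cases n) (simp_all add: e_e flip: mult.assoc)

lemma pw_commute: "x * y = y * x \<Longrightarrow> e * y = y \<Longrightarrow> y * e = y \<Longrightarrow> pw x n * y = y * pw x n"
  by (induction n) (simp_all add: mult.assoc, simp flip: mult.assoc)

lemma pw_add: "e * x = x \<Longrightarrow> pw x (m + n) = pw x m * pw x n"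
  by (induction m) (simp_all add: e_pw mult.assoc)

definition monl :: "nat list \<Rightarrow> (nat \<Rightarrow>\<^sub>0 nat) \<Rightarrow> 'b" where
  "monl l m = foldr (\<lambda>k acc. pw (U k) (lk m k) * acc) l e"

lemma monl_simps [simp]: "monl [] m = e" "monl (k # l) m = pw (U k) (lk m k) * monl l m"
  by (simp_all add: monl_def)

lemma pw_U_comm:
  assumes "k \<in> set ks" "l \<in> set ks"
  shows "pw (U k) a * pw (U l) b = pw (U l) b * pw (U k) a"
proof (rule pw_commute)
  have "pw (U l) b * U k = U k * pw (U l) b"
    by (rule pw_commute) (simp_all add: assms U_comm e_U U_e)
  then show "U k * pw (U l) b = pw (U l) b * U k" by simp
  show "e * pw (U l) b = pw (U l) b" by (simp add: e_pw e_U assms)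
  show "pw (U l) b * e = pw (U l) b"
    by (rule trans[OF pw_commute]) (simp_all add: e_e e_U U_e assms e_pw)
qed

lemma monl_comm: "set l \<subseteq> set ks \<Longrightarrow> k \<in> set ks \<Longrightarrow> monl l m * pw (U k) a = pw (U k) a * monl l m"
proof (induction l)
  case Nil
  then show ?case using pw_commute[of "U k" e a] by (simp add: e_U U_e e_e)
next
  case (Cons j l)
  have "monl (j # l) m * pw (U k) a = pw (U j) (lk m j) * pw (U k) a * monl l m"
    using Cons by (simp add: mult.assoc)
  also have "\<dots> = pw (U k) a * monl (j # l) m"
    using Cons by (simp add: pw_U_comm[of j k] mult.assoc)
  finally show ?case .
qed

lemma monl_add: "set l \<subseteq> set ks \<Longrightarrow> monl l (m + m') = monl l m * monl l m'"
proof (induction l)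
  case Nil then show ?case by (simp add: e_e)
next
  case (Cons k l)
  have "pw (U k) (lk m k) * pw (U k) (lk m' k) * (monl l m * monl l m')
     = pw (U k) (lk m k) * (pw (U k) (lk m' k) * monl l m) * monl l m'" by (simp add: mult.assoc)
  also have "\<dots> = pw (U k) (lk m k) * (monl l m * pw (U k) (lk m' k)) * monl l m'"
    using Cons by (simp add: monl_comm)
  finally show ?case using Cons by (simp add: lookup_add pw_add e_U mult.assoc)
qed

lemma s_monl: "set l \<subseteq> set ks \<Longrightarrow> s c * monl l m = monl l m * s c"
proof (induction l)
  case (Cons k l)
  have "s c * pw (U k) a = pw (U k) a * s c" for a
    using Cons by (intro pw_commute[symmetric]) (simp_all add: s_U e_s s_e)
  then have "s c * monl (k # l) m = pw (U k) (lk m k) * (s c * monl l m)"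
    by (simp flip: mult.assoc)
  with Cons show ?case by (simp add: mult.assoc)
qed (simp add: e_s s_e)

definition E :: "P \<Rightarrow> 'b" where "E p = (\<Sum>m\<in>Poly_Mapping.keys p. s (lk p m) * monl ks m)"

lemma E_superset: "finite M \<Longrightarrow> Poly_Mapping.keys p \<subseteq> M \<Longrightarrow> E p = (\<Sum>m\<in>M. s (lk p m) * monl ks m)"
  unfolding E_def by (rule sum.mono_neutral_left) (auto simp: s_zero not_in_keys_iff_lookup_eq_zero)

lemma E_add: "E (p + q) = E p + E q"
proof -
  let ?M = "Poly_Mapping.keys p \<union> Poly_Mapping.keys q"
  have "E (p + q) = (\<Sum>m\<in>?M. s (lk (p + q) m) * monl ks m)" "E p = (\<Sum>m\<in>?M. s (lk p m) * monl ks m)"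
    "E q = (\<Sum>m\<in>?M. s (lk q m) * monl ks m)"
    using Poly_Mapping.keys_add[of p q] by (auto intro!: E_superset)
  then show ?thesis by (simp add: lookup_add s_add distrib_right sum.distrib)
qed

lemma E_single: "E (sg m c) = s c * monl ks m"
  by (subst E_superset[of "{m}"]) auto

lemma E_mult: "E (p * q) = E p * E q"
proof (rule multiplicative_if_on_singles)
  fix m m' :: "nat \<Rightarrow>\<^sub>0 nat" and c c'
  have "s c * s c' * (monl ks m * monl ks m') = s c * (s c' * monl ks m) * monl ks m'" by (simp add: mult.assoc)
  also have "\<dots> = s c * monl ks m * (s c' * monl ks m')"
    by (subst s_monl) (simp_all add: mult.assoc)
  finally show "E (sg (m + m') (c * c')) = E (sg m c) * E (sg m' c')"
    by (simp add: E_single monl_add s_mult mult.assoc)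
qed (rule E_add)

lemma monl_0: "monl l 0 = e"
  by (induction l) (simp_all add: e_e)

lemma E_1: "E 1 = e"
  using E_single[of 0 1] by (simp add: monl_0 s_one e_e)

text \<open>From here on \<open>dom\<close> and \<open>io\<close> belong to the partial homomorphism
  defined on L.\<close>

sublocale fract_ext E e
  by unfold_locales (simp_all add: E_add E_mult E_1)

lemma cst_dom: "cst c \<in> dom" and io_cst: "io (cst c) = s c"
  using io_Fract1[of "sg 0 c"] by (simp_all add: cst_def E_single monl_0 s_e)

text \<open>True for every k, because polynomials always have a value; a variable outside
  \<open>ks\<close> evaluates to e, as \<open>monl\<close> reads only the exponents at
  \<open>ks\<close>.\<close>

lemma var_dom: "var k \<in> dom"
  using io_Fract1(1)[of "sg (sg k 1) 1"] by (simp add: var_def)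

lemma io_var:
  assumes "k \<in> set ks"
  shows "io (var k) = U k"
proof -
  have "monl l (sg k 1) = (if k \<in> set l then U k else e)" if "distinct l" "set l \<subseteq> set ks" for l
    using that by (induction l) (auto simp: lookup_single when_def e_e e_U U_e)
  then have "monl ks (sg k 1) = U k" using assms distinct_ks by simp
  then show ?thesis using io_Fract1(2)[of "sg (sg k 1) 1"] assms
    by (simp add: var_def E_single s_one e_U)
qed

text \<open>Models a shift operator D_{i,r}, with c = v, or its inverse, with c = 1/v; k is the code
  of (i, r).\<close>

definition twists :: "'b \<Rightarrow> nat \<Rightarrow> K \<Rightarrow> bool" where
  "twists T k c \<longleftrightarrow> k \<in> set ks \<and> c \<noteq> 0 \<and> e * T = T \<and> T * e = T \<and> (\<exists>T'. e * T' = T' \<and> T' * e = T' \<and> T * T' = e \<and> T' * T = e)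
     \<and> (\<forall>a. T * s a = s a * T) \<and> (\<forall>l\<in>set ks. T * U l = s (if l = k then c else 1) * U l * T)"

lemma twists_monl:
  assumes T: "twists T k c"
  shows "distinct l \<Longrightarrow> set l \<subseteq> set ks \<Longrightarrow> T * monl l m = s (if k \<in> set l then c ^ lk m k else 1) * monl l m * T"
proof (induction l)
  case Nil
  then show ?case using T by (simp add: s_one e_e twists_def)
next
  case (Cons j l)
  define d where "d = (if j = k then c else 1)"
  have pw: "T * pw (U j) n = s (d ^ n) * pw (U j) n * T" for n
  proof (induction n)
    case 0
    then show ?case using T by (simp add: s_one e_e twists_def)
  next
    case (Suc n)
    have "T * pw (U j) (Suc n) = s d * U j * (T * pw (U j) n)"
      using T Cons by (simp add: d_def twists_def flip: mult.assoc)
    also have "\<dots> = s d * (U j * s (d ^ n)) * pw (U j) n * T" by (simp add: Suc mult.assoc)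
    also have "\<dots> = s (d ^ Suc n) * pw (U j) (Suc n) * T"
      using Cons by (simp add: s_mult mult.assoc flip: s_U)
    finally show ?case .
  qed
  define f where "f = (if k \<in> set l then c ^ lk m k else 1)"
  have "T * monl (j # l) m = s (d ^ lk m j) * pw (U j) (lk m j) * (T * monl l m)"
    by (simp add: pw flip: mult.assoc)
  also have "\<dots> = s (d ^ lk m j) * (pw (U j) (lk m j) * s f) * monl l m * T"
    using Cons by (simp add: f_def mult.assoc)
  also have "pw (U j) (lk m j) * s f = s f * pw (U j) (lk m j)"
    using Cons by (intro pw_commute) (simp_all add: s_U e_s s_e)
  also have "s (d ^ lk m j) * (s f * pw (U j) (lk m j)) * monl l m * T
      = s (d ^ lk m j * f) * monl (j # l) m * T" by (simp add: s_mult mult.assoc)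
  also have "d ^ lk m j * f = (if k \<in> set (j # l) then c ^ lk m k else 1)"
    using Cons by (auto simp: d_def f_def)
  finally show ?case .
qed

lemma twists_E:
  assumes T: "twists T k c"
  shows "T * E p = E (scale k c p) * T"
proof -
  have "T * (s a * monl ks m) = s (c ^ lk m k * a) * monl ks m * T" for a m
  proof -
    have "T * (s a * monl ks m) = s a * (T * monl ks m)"
      using T by (simp add: twists_def flip: mult.assoc)
    then show ?thesis using twists_monl[OF T distinct_ks] T
      by (simp add: s_mult s_comm[of "c ^ _"] twists_def mult.assoc)
  qed
  moreover have "E (scale k c p) = (\<Sum>m\<in>Poly_Mapping.keys p. s (lk (scale k c p) m) * monl ks m)"
    by (intro E_superset) (auto simp: in_keys_iff lookup_scale)
  ultimately show ?thesis by (simp add: E_def sum_distrib_left sum_distrib_right lookup_scale)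
qed

text \<open>If y inverts the value of the denominator, then T y T' inverts the value of the scaled
  denominator. So conjugation by T turns a presentation of x into one of its shift, and the shift
  stays in \<open>dom\<close>.\<close>

lemma twists_io:
  assumes T: "twists T k c" and x: "x \<in> dom"
  shows "sig k c x \<in> dom" "T * io x = io (sig k c x) * T"
proof -
  obtain p q y where *: "q \<noteq> 0" "x = Fract p q" "cinv (E q) y" "io x * E q = E p" "io x * e = io x"
    using represents_io[OF x] unfolding represents_def by blast
  obtain T' where T': "e * T' = T'" "T' * e = T'" "T * T' = e" "T' * T = e"
    using T by (auto simp: twists_def)
  have c: "c \<noteq> 0" and eT: "e * T = T" "T * e = T" using T by (auto simp: twists_def)
  \<comment> \<open>The commutation rule for T' follows from the one for T by inserting T T' =
    e.\<close>
  have TT: "T' * E (scale k c p) = E p * T'" for p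
  proof -
    have "T' * E (scale k c p) = T' * (E (scale k c p) * (T * T'))" by (simp add: T' h_e)
    also have "\<dots> = T' * (T * E p) * T'" by (simp add: twists_E[OF T] mult.assoc)
    also have "\<dots> = E p * T'" by (simp add: T' e_h flip: mult.assoc)
    finally show ?thesis .
  qed
  have "represents (sig k c x) (T * io x * T')"
    unfolding represents_def
  proof (intro exI conjI)
    show "scale k c q \<noteq> 0" using * c by (simp add: scale_eq_0)
    show "sig k c x = Fract (scale k c p) (scale k c q)" using * c by (simp add: sig_Fract)
    have "T * io x * T' * E (scale k c q) = T * (io x * E q) * T'" by (simp add: TT mult.assoc)
    also have "\<dots> = E (scale k c p) * (T * T')"
      unfolding *(4) twists_E[OF T] by (simp add: mult.assoc)
    finally show "T * io x * T' * E (scale k c q) = E (scale k c p)" by (simp add: T' h_e)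
    show "T * io x * T' * e = T * io x * T'" by (simp add: T' mult.assoc)
    show "cinv (E (scale k c q)) (T * y * T')"
      unfolding cinv_def
    proof (intro conjI)
      show "e * (T * y * T') = T * y * T'" by (simp add: eT flip: mult.assoc)
      have "E (scale k c q) * (T * y * T') = T * (E q * y) * T'"
        by (simp add: twists_E[OF T] flip: mult.assoc)
      then show "E (scale k c q) * (T * y * T') = e" using * T' eT by (simp add: cinv_def)
      have "T * y * T' * E (scale k c q) = T * (y * E q) * T'" by (simp add: TT mult.assoc)
      then show "T * y * T' * E (scale k c q) = e" using * T' eT by (simp add: cinv_def)
    qed
  qed
  from io_eq[OF this] show "sig k c x \<in> dom" "T * io x = io (sig k c x) * T"
    using x by (simp_all add: mult.assoc T' eT io_e)
qed

end


section \<open>Sums of coefficients times shift operators, and termwise criteria for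
  relations\<close>

context torus
begin

text \<open>Weaker than \<open>twists\<close>: it also admits T = e with the identity map, so that
  Cartan elements count as terms without shift.\<close>

definition tw :: "'b \<Rightarrow> (L \<Rightarrow> L) \<Rightarrow> bool" where
  "tw T \<sigma> \<longleftrightarrow> e * T = T \<and> (\<forall>f\<in>dom. \<sigma> f \<in> dom \<and> T * io f = io (\<sigma> f) * T)"

lemma tw_e: "tw e (\<lambda>f. f)"
  by (simp add: tw_def e_e e_io io_e)

lemma tw_twists:
  assumes "twists T k c"
  shows "tw T (sig k c)"
proof -
  have "e * T = T" using assms by (simp add: twists_def)
  then show ?thesis unfolding tw_def using twists_io[OF assms] by blast
qed

lemma tw_dom: "tw T \<sigma> \<Longrightarrow> f \<in> dom \<Longrightarrow> \<sigma> f \<in> dom"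
  by (simp add: tw_def)

text \<open>The multiplication rule of a crossed product: T passes g at the cost of shifting
  it.\<close>

lemma term_mult:
  assumes "tw T \<sigma>" "f \<in> dom" "g \<in> dom"
  shows "io f * T * (io g * T') = io (f * \<sigma> g) * (T * T')"
proof -
  have "io f * T * (io g * T') = io f * (T * io g) * T'" by (simp add: mult.assoc)
  also have "T * io g = io (\<sigma> g) * T" using assms by (simp add: tw_def)
  also have "io f * (io (\<sigma> g) * T) * T' = io (f * \<sigma> g) * (T * T')"
    using assms by (simp add: io_mult tw_dom mult.assoc)
  finally show ?thesis .
qed

lemma sum_terms_mult:
  assumes "\<And>r. r \<in> I \<Longrightarrow> tw (T r) (\<sigma> r) \<and> f r \<in> dom" "\<And>s. s \<in> J \<Longrightarrow> g s \<in> dom"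
  shows "(\<Sum>r\<in>I. io (f r) * T r) * (\<Sum>s\<in>J. io (g s) * T' s) = (\<Sum>r\<in>I. \<Sum>s\<in>J. io (f r * \<sigma> r (g s)) * (T r * T' s))"
  unfolding sum_product
proof (intro sum.cong refl)
  fix r s assume "r \<in> I" "s \<in> J"
  with assms show "io (f r) * T r * (io (g s) * T' s) = io (f r * \<sigma> r (g s)) * (T r * T' s)"
    by (intro term_mult) auto
qed

lemma s_io: "f \<in> dom \<Longrightarrow> s c * io f = io (cst c * f)"
  by (simp add: io_mult cst_dom io_cst)

text \<open>Both products of currents are expanded over pairs (r, s) and brought to the common right
  factor \<open>T r * T' s\<close>, so that equality of coefficients in L suffices. The four scalars
  are those of \<open>linrel\<close>.\<close>

lemma exchange_of_coefficients:
  assumes tw: "\<And>r. r \<in> I \<Longrightarrow> tw (T r) (\<sigma> r)" "\<And>s. s \<in> J \<Longrightarrow> tw (T' s) (\<sigma>' s)"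
    and comm: "\<And>r s. r \<in> I \<Longrightarrow> s \<in> J \<Longrightarrow> T' s * T r = T r * T' s"
    and dom: "\<And>r k. r \<in> I \<Longrightarrow> X r k \<in> dom" "\<And>s k. s \<in> J \<Longrightarrow> Y s k \<in> dom"
    and rel: "\<And>r s. r \<in> I \<Longrightarrow> s \<in> J \<Longrightarrow>
       cst \<alpha> * (X r (k + 1) * \<sigma> r (Y s l)) + cst \<beta> * (X r k * \<sigma> r (Y s (l + 1)))
       = cst \<gamma> * (Y s l * \<sigma>' s (X r (k + 1))) + cst \<epsilon> * (Y s (l + 1) * \<sigma>' s (X r k))"
    and XX: "\<And>k. XX k = (\<Sum>r\<in>I. io (X r k) * T r)" and YY: "\<And>k. YY k = (\<Sum>s\<in>J. io (Y s k) * T' s)"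
  shows "s \<alpha> * (XX (k + 1) * YY l) + s \<beta> * (XX k * YY (l + 1))
       - (s \<gamma> * (YY l * XX (k + 1)) + s \<epsilon> * (YY (l + 1) * XX k)) = 0"
proof -
  have d: "X r k * \<sigma> r (Y s l) \<in> dom" "Y s l * \<sigma>' s (X r k) \<in> dom" if "r \<in> I" "s \<in> J" for r s k l
    using that dom tw_dom[OF tw(1)] tw_dom[OF tw(2)] by (simp_all add: dom_mult)
  have XY: "s a * (XX k * YY l) = (\<Sum>r\<in>I. \<Sum>s\<in>J. io (cst a * (X r k * \<sigma> r (Y s l))) * (T r * T' s))" for a k l
  proof -
    have "XX k * YY l = (\<Sum>r\<in>I. \<Sum>s\<in>J. io (X r k * \<sigma> r (Y s l)) * (T r * T' s))"
      unfolding XX YY using tw dom by (intro sum_terms_mult) auto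
    then show ?thesis using d by (simp add: sum_distrib_left s_io flip: mult.assoc)
  qed
  have YX: "s a * (YY l * XX k) = (\<Sum>r\<in>I. \<Sum>s\<in>J. io (cst a * (Y s l * \<sigma>' s (X r k))) * (T r * T' s))" for a k l
  proof -
    have "YY l * XX k = (\<Sum>s\<in>J. \<Sum>r\<in>I. io (Y s l * \<sigma>' s (X r k)) * (T' s * T r))"
      unfolding XX YY using tw dom by (intro sum_terms_mult) auto
    also have "\<dots> = (\<Sum>r\<in>I. \<Sum>s\<in>J. io (Y s l * \<sigma>' s (X r k)) * (T r * T' s))"
      using comm by (subst sum.swap) simp
    finally show ?thesis using d by (simp add: sum_distrib_left s_io flip: mult.assoc)
  qed
  have "io (cst \<alpha> * (X r (k + 1) * \<sigma> r (Y s l))) + io (cst \<beta> * (X r k * \<sigma> r (Y s (l + 1))))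
      - (io (cst \<gamma> * (Y s l * \<sigma>' s (X r (k + 1)))) + io (cst \<epsilon> * (Y s (l + 1) * \<sigma>' s (X r k)))) = 0"
    if "r \<in> I" "s \<in> J" for r s
    using rel[OF that] by (simp add: d[OF that] dom_mult cst_dom flip: io_add)
  then show ?thesis
    unfolding XY YX by (simp flip: sum.distrib sum_subtractf distrib_right left_diff_distrib)
qed

text \<open>The flag d marks the case of equal nodes i = j. There the two shifts cancel for r = s,
  \<open>T r * T' r = e\<close>, and leave a term without shift.\<close>

lemma commutator_of_coefficients:
  assumes tw: "\<And>r. r \<in> I \<Longrightarrow> tw (T r) (\<sigma> r)" "\<And>s. s \<in> J \<Longrightarrow> tw (T' s) (\<sigma>' s)"
    and comm: "\<And>r s. r \<in> I \<Longrightarrow> s \<in> J \<Longrightarrow> T' s * T r = T r * T' s"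
    and dom: "\<And>r. r \<in> I \<Longrightarrow> X r \<in> dom" "\<And>s. s \<in> J \<Longrightarrow> Y s \<in> dom"
    and rel: "\<And>r s. r \<in> I \<Longrightarrow> s \<in> J \<Longrightarrow> X r * \<sigma> r (Y s) - Y s * \<sigma>' s (X r) = (if d \<and> r = s then C r else 0)"
    and diag: "\<And>r. d \<Longrightarrow> r \<in> I \<Longrightarrow> T r * T' r = e" and fin: "d \<Longrightarrow> J = I" "finite I"
  shows "(\<Sum>r\<in>I. io (X r) * T r) * (\<Sum>s\<in>J. io (Y s) * T' s) - (\<Sum>s\<in>J. io (Y s) * T' s) * (\<Sum>r\<in>I. io (X r) * T r)
    = (if d then (\<Sum>r\<in>I. io (C r)) else 0)"
proof -
  have dd: "X r * \<sigma> r (Y s) \<in> dom" "Y s * \<sigma>' s (X r) \<in> dom" if "r \<in> I" "s \<in> J" for r s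
    using that dom tw_dom[OF tw(1)] tw_dom[OF tw(2)] by (simp_all add: dom_mult)
  have XY: "(\<Sum>r\<in>I. io (X r) * T r) * (\<Sum>s\<in>J. io (Y s) * T' s)
    = (\<Sum>r\<in>I. \<Sum>s\<in>J. io (X r * \<sigma> r (Y s)) * (T r * T' s))"
    using tw dom by (intro sum_terms_mult) auto
  have "(\<Sum>s\<in>J. io (Y s) * T' s) * (\<Sum>r\<in>I. io (X r) * T r)
    = (\<Sum>s\<in>J. \<Sum>r\<in>I. io (Y s * \<sigma>' s (X r)) * (T' s * T r))"
    using tw dom by (intro sum_terms_mult) auto
  also have "\<dots> = (\<Sum>r\<in>I. \<Sum>s\<in>J. io (Y s * \<sigma>' s (X r)) * (T r * T' s))"
    using comm by (subst sum.swap) simp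
  finally have "(\<Sum>r\<in>I. io (X r) * T r) * (\<Sum>s\<in>J. io (Y s) * T' s) - (\<Sum>s\<in>J. io (Y s) * T' s) * (\<Sum>r\<in>I. io (X r) * T r)
    = (\<Sum>r\<in>I. \<Sum>s\<in>J. io (X r * \<sigma> r (Y s) - Y s * \<sigma>' s (X r)) * (T r * T' s))"
    unfolding XY using dd by (simp add: io_diff left_diff_distrib flip: sum_subtractf)
  also have "\<dots> = (\<Sum>r\<in>I. \<Sum>s\<in>J. if d \<and> r = s then io (C r) else 0)"
  proof (intro sum.cong refl)
    fix r s assume rs: "r \<in> I" "s \<in> J"
    show "io (X r * \<sigma> r (Y s) - Y s * \<sigma>' s (X r)) * (T r * T' s) = (if d \<and> r = s then io (C r) else 0)"
    proof (cases "d \<and> r = s")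
      case True
      moreover have "C r \<in> dom" using rel[OF rs] dd[OF rs] True by (metis dom_diff)
      ultimately show ?thesis using rel[OF rs] diag rs by (auto simp: io_e)
    next
      case False
      then have "X r * \<sigma> r (Y s) - Y s * \<sigma>' s (X r) = 0" using rel[OF rs] by auto
      then show ?thesis using False by (auto simp: io_zero)
    qed
  qed
  also have "\<dots> = (if d then (\<Sum>r\<in>I. io (C r)) else 0)"
  proof (cases d)
    case True
    then show ?thesis using fin(2) by (simp add: fin(1)[OF True])
  qed simp
  finally show ?thesis .
qed

text \<open>All six orders are written over the same triples, with r attached to A and r' to B, so
  that they can be combined summand by summand.\<close>

lemma triple_product_sum:
  fixes A B C :: "nat \<Rightarrow> 'b"
  shows "(\<Sum>r\<in>I. A r) * ((\<Sum>r\<in>I. B r) * (\<Sum>s\<in>J. C s)) = (\<Sum>r\<in>I. \<Sum>r'\<in>I. \<Sum>s\<in>J. A r * (B r' * C s))"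
    and "(\<Sum>r\<in>I. B r) * ((\<Sum>r\<in>I. A r) * (\<Sum>s\<in>J. C s)) = (\<Sum>r\<in>I. \<Sum>r'\<in>I. \<Sum>s\<in>J. B r' * (A r * C s))"
    and "(\<Sum>r\<in>I. A r) * ((\<Sum>s\<in>J. C s) * (\<Sum>r\<in>I. B r)) = (\<Sum>r\<in>I. \<Sum>r'\<in>I. \<Sum>s\<in>J. A r * (C s * B r'))"
    and "(\<Sum>r\<in>I. B r) * ((\<Sum>s\<in>J. C s) * (\<Sum>r\<in>I. A r)) = (\<Sum>r\<in>I. \<Sum>r'\<in>I. \<Sum>s\<in>J. B r' * (C s * A r))"
    and "(\<Sum>s\<in>J. C s) * ((\<Sum>r\<in>I. A r) * (\<Sum>r\<in>I. B r)) = (\<Sum>r\<in>I. \<Sum>r'\<in>I. \<Sum>s\<in>J. C s * (A r * B r'))"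
    and "(\<Sum>s\<in>J. C s) * ((\<Sum>r\<in>I. B r) * (\<Sum>r\<in>I. A r)) = (\<Sum>r\<in>I. \<Sum>r'\<in>I. \<Sum>s\<in>J. C s * (B r' * A r))"
proof -
  have 1: "(\<Sum>r\<in>I. A r) * ((\<Sum>r\<in>I. B r) * (\<Sum>s\<in>J. C s)) = (\<Sum>r\<in>I. \<Sum>r'\<in>I. \<Sum>s\<in>J. A r * (B r' * C s))" for A B
    unfolding sum_product[of B] sum_product[of A] by (simp only: sum_distrib_left)
  have 2: "(\<Sum>r\<in>I. A r) * ((\<Sum>s\<in>J. C s) * (\<Sum>r\<in>I. B r)) = (\<Sum>r\<in>I. \<Sum>r'\<in>I. \<Sum>s\<in>J. A r * (C s * B r'))" for A B
    unfolding sum_product[of C] sum_product[of A]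
    by (simp only: sum_distrib_left sum.swap[where A = J and B = I])
  have 3: "(\<Sum>s\<in>J. C s) * ((\<Sum>r\<in>I. A r) * (\<Sum>r\<in>I. B r)) = (\<Sum>r\<in>I. \<Sum>r'\<in>I. \<Sum>s\<in>J. C s * (A r * B r'))" for A B
    unfolding sum_product[of A] sum_product[of C]
    by (simp only: sum_distrib_left sum.swap[where A = J and B = I])
  show "(\<Sum>r\<in>I. A r) * ((\<Sum>r\<in>I. B r) * (\<Sum>s\<in>J. C s)) = (\<Sum>r\<in>I. \<Sum>r'\<in>I. \<Sum>s\<in>J. A r * (B r' * C s))" by (rule 1)
  show "(\<Sum>r\<in>I. B r) * ((\<Sum>r\<in>I. A r) * (\<Sum>s\<in>J. C s)) = (\<Sum>r\<in>I. \<Sum>r'\<in>I. \<Sum>s\<in>J. B r' * (A r * C s))"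
    unfolding 1 by (rule sum.swap)
  show "(\<Sum>r\<in>I. A r) * ((\<Sum>s\<in>J. C s) * (\<Sum>r\<in>I. B r)) = (\<Sum>r\<in>I. \<Sum>r'\<in>I. \<Sum>s\<in>J. A r * (C s * B r'))" by (rule 2)
  show "(\<Sum>r\<in>I. B r) * ((\<Sum>s\<in>J. C s) * (\<Sum>r\<in>I. A r)) = (\<Sum>r\<in>I. \<Sum>r'\<in>I. \<Sum>s\<in>J. B r' * (C s * A r))"
    unfolding 2 by (rule sum.swap)
  show "(\<Sum>s\<in>J. C s) * ((\<Sum>r\<in>I. A r) * (\<Sum>r\<in>I. B r)) = (\<Sum>r\<in>I. \<Sum>r'\<in>I. \<Sum>s\<in>J. C s * (A r * B r'))" by (rule 3)
  show "(\<Sum>s\<in>J. C s) * ((\<Sum>r\<in>I. B r) * (\<Sum>r\<in>I. A r)) = (\<Sum>r\<in>I. \<Sum>r'\<in>I. \<Sum>s\<in>J. C s * (B r' * A r))"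
    unfolding 3 by (rule sum.swap)
qed

definition qcb :: "'b \<Rightarrow> 'b \<Rightarrow> K \<Rightarrow> 'b" where "qcb x y c = x * y - s c * (y * x)"

text \<open>Expanding the nested commutators leaves the four products with Y at an end with
  coefficient 1 and the two with Y in the middle with coefficient -(c + 1/c). All shifts commute, so
  each triple (r, r', s) gives a single condition in L, with r attached to X1 and r' to X2.\<close>

lemma serre_of_coefficients:
  fixes T T' :: "nat \<Rightarrow> 'b"
  assumes tw: "\<And>r. r \<in> I \<Longrightarrow> tw (T r) (\<sigma> r)" "\<And>s. s \<in> J \<Longrightarrow> tw (T' s) (\<tau> s)"
    and comm: "\<And>r s. r \<in> I \<Longrightarrow> s \<in> J \<Longrightarrow> T' s * T r = T r * T' s" 
      "\<And>r r'. r \<in> I \<Longrightarrow> r' \<in> I \<Longrightarrow> T r' * T r = T r * T r'"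
    and sT: "\<And>r c. r \<in> I \<Longrightarrow> s c * T r = T r * s c" "\<And>r c. r \<in> J \<Longrightarrow> s c * T' r = T' r * s c"
    and dom: "\<And>r. r \<in> I \<Longrightarrow> f1 r \<in> dom" "\<And>r. r \<in> I \<Longrightarrow> f2 r \<in> dom" "\<And>s. s \<in> J \<Longrightarrow> h s \<in> dom"
    and c0: "c \<noteq> 0"
    and rel: "\<And>r r' s. r \<in> I \<Longrightarrow> r' \<in> I \<Longrightarrow> s \<in> J \<Longrightarrow>
        f1 r * \<sigma> r (f2 r' * \<sigma> r' (h s)) + f2 r' * \<sigma> r' (f1 r * \<sigma> r (h s))
        + h s * \<tau> s (f1 r * \<sigma> r (f2 r')) + h s * \<tau> s (f2 r' * \<sigma> r' (f1 r))
        = (cst c + inverse (cst c)) * (f1 r * \<sigma> r (h s * \<tau> s (f2 r')) + f2 r' * \<sigma> r' (h s * \<tau> s (f1 r)))"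
    and X: "X1 = (\<Sum>r\<in>I. io (f1 r) * T r)" "X2 = (\<Sum>r\<in>I. io (f2 r) * T r)" "Y = (\<Sum>s\<in>J. io (h s) * T' s)"
  shows "qcb X1 (qcb X2 Y c) (inverse c) + qcb X2 (qcb X1 Y c) (inverse c) = 0"
proof -
  have e: "e * T r = T r" if "r \<in> I" for r using tw that by (simp add: tw_def)
  have e': "e * T' r = T' r" if "r \<in> J" for r using tw that by (simp add: tw_def)
  have m3: "(io f * t1) * ((io g * t2) * (io k * t3)) = io (f * \<sigma>1 (g * \<sigma>2 k)) * (t1 * (t2 * t3))"
    if "tw t1 \<sigma>1" "tw t2 \<sigma>2" "f \<in> dom" "g \<in> dom" "k \<in> dom" for f g k t1 t2 t3 \<sigma>1 \<sigma>2
    using that by (simp add: term_mult dom_mult tw_dom)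
  have sX: "s a * X1 = X1 * s a" "s a * X2 = X2 * s a" "s a * Y = Y * s a" for a
  proof -
    have *: "s a * (io f * t) = io f * t * s a" if "s a * t = t * s a" "f \<in> dom" for f t
    proof -
      have "s a * (io f * t) = io f * s a * t"
        using io_comm[OF cst_dom that(2), of a] by (simp add: io_cst flip: mult.assoc)
      then show ?thesis using that by (simp add: mult.assoc)
    qed
    show "s a * X1 = X1 * s a" "s a * X2 = X2 * s a" "s a * Y = Y * s a"
      unfolding X sum_distrib_left sum_distrib_right using sT dom * by (auto intro!: sum.cong)
  qed
  have ss: "s (inverse c) * s c = e" using c0 by (simp add: s_one flip: s_mult)
  have eX: "e * X1 = X1" "e * X2 = X2" "e * Y = Y"
    unfolding X sum_distrib_left using dom by (simp_all add: e_io flip: mult.assoc)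
  have qq: "qcb A (qcb B Y c) (inverse c) = A * (B * Y) - s c * (A * (Y * B)) - s (inverse c) * (B * (Y * A)) + Y * (B * A)"
    if "\<And>a. s a * A = A * s a" "e * Y = Y" for A B
  proof -
    have "A * (s c * (Y * B)) = s c * (A * (Y * B))" by (simp add: that flip: mult.assoc)
    moreover have "s (inverse c) * (s c * (Y * B) * A) = Y * (B * A)"
    proof -
      have "s (inverse c) * (s c * (Y * B) * A) = (s (inverse c) * s c) * Y * (B * A)" by (simp only: mult.assoc)
      then show ?thesis using ss that by simp
    qed
    ultimately show ?thesis by (simp add: qcb_def algebra_simps)
  qed
  let ?q = "s c + s (inverse c)"
  have "qcb X1 (qcb X2 Y c) (inverse c) + qcb X2 (qcb X1 Y c) (inverse c)
     = X1 * (X2 * Y) + X2 * (X1 * Y) + Y * (X1 * X2) + Y * (X2 * X1) - ?q * (X1 * (Y * X2) + X2 * (Y * X1))"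
    using sX eX by (simp add: qq algebra_simps)
  also have "\<dots> = (\<Sum>r\<in>I. \<Sum>r'\<in>I. \<Sum>t\<in>J.
       io (f1 r * \<sigma> r (f2 r' * \<sigma> r' (h t))) * (T r * (T r' * T' t))
     + io (f2 r' * \<sigma> r' (f1 r * \<sigma> r (h t))) * (T r * (T r' * T' t))
     + io (h t * \<tau> t (f1 r * \<sigma> r (f2 r'))) * (T r * (T r' * T' t))
     + io (h t * \<tau> t (f2 r' * \<sigma> r' (f1 r))) * (T r * (T r' * T' t))
     - ?q * (io (f1 r * \<sigma> r (h t * \<tau> t (f2 r'))) * (T r * (T r' * T' t))
           + io (f2 r' * \<sigma> r' (h t * \<tau> t (f1 r))) * (T r * (T r' * T' t))))"
  proof -
    have t2: "T r' * (T r * T' t) = T r * (T r' * T' t)" "T r * (T' t * T r') = T r * (T r' * T' t)"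
       "T r' * (T' t * T r) = T r * (T r' * T' t)" "T' t * (T r * T r') = T r * (T r' * T' t)"
       "T' t * (T r' * T r) = T r * (T r' * T' t)"
      if "r \<in> I" "r' \<in> I" "t \<in> J" for r r' t
    proof -
      have a: "T r' * T r = T r * T r'" "T' t * T r = T r * T' t" "T' t * T r' = T r' * T' t"
        using comm that by auto
      show 1: "T r' * (T r * T' t) = T r * (T r' * T' t)" by (simp add: a flip: mult.assoc)
      show "T r * (T' t * T r') = T r * (T r' * T' t)" by (simp add: a)
      show "T r' * (T' t * T r) = T r * (T r' * T' t)" by (simp add: a 1)
      have "T' t * (T r * T r') = T r * T' t * T r'" by (simp add: a flip: mult.assoc)
      then show 2: "T' t * (T r * T r') = T r * (T r' * T' t)" by (simp add: a mult.assoc)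
      then show "T' t * (T r' * T r) = T r * (T r' * T' t)" by (simp add: a)
    qed
    have P1: "X1 * (X2 * Y) = (\<Sum>r\<in>I. \<Sum>r'\<in>I. \<Sum>t\<in>J. io (f1 r * \<sigma> r (f2 r' * \<sigma> r' (h t))) * (T r * (T r' * T' t)))"
      unfolding X triple_product_sum(1)
    proof (intro sum.cong refl)
      fix r r' t assume r: "r \<in> I" "r' \<in> I" "t \<in> J"
      show "(io (f1 r) * T r) * ((io (f2 r') * T r') * (io (h t) * T' t)) = io (f1 r * \<sigma> r (f2 r' * \<sigma> r' (h t))) * (T r * (T r' * T' t))"
        using m3[OF tw(1)[OF r(1)] tw(1)[OF r(2)] dom(1)[OF r(1)] dom(2)[OF r(2)] dom(3)[OF r(3)]] t2[OF r] by simp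
    qed
    have P2: "X2 * (X1 * Y) = (\<Sum>r\<in>I. \<Sum>r'\<in>I. \<Sum>t\<in>J. io (f2 r' * \<sigma> r' (f1 r * \<sigma> r (h t))) * (T r * (T r' * T' t)))"
      unfolding X triple_product_sum(2)
    proof (intro sum.cong refl)
      fix r r' t assume r: "r \<in> I" "r' \<in> I" "t \<in> J"
      show "(io (f2 r') * T r') * ((io (f1 r) * T r) * (io (h t) * T' t)) = io (f2 r' * \<sigma> r' (f1 r * \<sigma> r (h t))) * (T r * (T r' * T' t))"
        using m3[OF tw(1)[OF r(2)] tw(1)[OF r(1)] dom(2)[OF r(2)] dom(1)[OF r(1)] dom(3)[OF r(3)]] t2[OF r] by simp
    qed
    have P3: "X1 * (Y * X2) = (\<Sum>r\<in>I. \<Sum>r'\<in>I. \<Sum>t\<in>J. io (f1 r * \<sigma> r (h t * \<tau> t (f2 r'))) * (T r * (T r' * T' t)))"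
      unfolding X triple_product_sum(3)
    proof (intro sum.cong refl)
      fix r r' t assume r: "r \<in> I" "r' \<in> I" "t \<in> J"
      show "(io (f1 r) * T r) * ((io (h t) * T' t) * (io (f2 r') * T r')) = io (f1 r * \<sigma> r (h t * \<tau> t (f2 r'))) * (T r * (T r' * T' t))"
        using m3[OF tw(1)[OF r(1)] tw(2)[OF r(3)] dom(1)[OF r(1)] dom(3)[OF r(3)] dom(2)[OF r(2)]] t2[OF r] by simp
    qed
    have P4: "X2 * (Y * X1) = (\<Sum>r\<in>I. \<Sum>r'\<in>I. \<Sum>t\<in>J. io (f2 r' * \<sigma> r' (h t * \<tau> t (f1 r))) * (T r * (T r' * T' t)))"
      unfolding X triple_product_sum(4)
    proof (intro sum.cong refl)
      fix r r' t assume r: "r \<in> I" "r' \<in> I" "t \<in> J"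
      show "(io (f2 r') * T r') * ((io (h t) * T' t) * (io (f1 r) * T r)) = io (f2 r' * \<sigma> r' (h t * \<tau> t (f1 r))) * (T r * (T r' * T' t))"
        using m3[OF tw(1)[OF r(2)] tw(2)[OF r(3)] dom(2)[OF r(2)] dom(3)[OF r(3)] dom(1)[OF r(1)]] t2[OF r] by simp
    qed
    have P5: "Y * (X1 * X2) = (\<Sum>r\<in>I. \<Sum>r'\<in>I. \<Sum>t\<in>J. io (h t * \<tau> t (f1 r * \<sigma> r (f2 r'))) * (T r * (T r' * T' t)))"
      unfolding X triple_product_sum(5)
    proof (intro sum.cong refl)
      fix r r' t assume r: "r \<in> I" "r' \<in> I" "t \<in> J"
      show "(io (h t) * T' t) * ((io (f1 r) * T r) * (io (f2 r') * T r')) = io (h t * \<tau> t (f1 r * \<sigma> r (f2 r'))) * (T r * (T r' * T' t))"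
        using m3[OF tw(2)[OF r(3)] tw(1)[OF r(1)] dom(3)[OF r(3)] dom(1)[OF r(1)] dom(2)[OF r(2)]] t2[OF r] by simp
    qed
    have P6: "Y * (X2 * X1) = (\<Sum>r\<in>I. \<Sum>r'\<in>I. \<Sum>t\<in>J. io (h t * \<tau> t (f2 r' * \<sigma> r' (f1 r))) * (T r * (T r' * T' t)))"
      unfolding X triple_product_sum(6)
    proof (intro sum.cong refl)
      fix r r' t assume r: "r \<in> I" "r' \<in> I" "t \<in> J"
      show "(io (h t) * T' t) * ((io (f2 r') * T r') * (io (f1 r) * T r)) = io (h t * \<tau> t (f2 r' * \<sigma> r' (f1 r))) * (T r * (T r' * T' t))"
        using m3[OF tw(2)[OF r(3)] tw(1)[OF r(2)] dom(3)[OF r(3)] dom(2)[OF r(2)] dom(1)[OF r(1)]] t2[OF r] by simp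
    qed
    show ?thesis
      unfolding P1 P2 P3 P4 P5 P6 by (simp only: sum_distrib_left sum.distrib sum_subtractf distrib_left)
  qed
  also have "\<dots> = 0"
  proof (intro sum.neutral ballI)
    fix r r' t assume r: "r \<in> I" "r' \<in> I" "t \<in> J"
    note dd = tw_dom[OF tw(1)[OF r(1)]] tw_dom[OF tw(1)[OF r(2)]] tw_dom[OF tw(2)[OF r(3)]] dom_mult dom(1)[OF r(1)] dom(2)[OF r(2)] dom(3)[OF r(3)]
      dom_add cst_dom
    have inv: "inverse (cst c) \<in> dom" using cst_dom[of "inverse c"] by (simp add: cst_inverse)
    have q: "s c + s (inverse c) = io (cst c + inverse (cst c))"
      using cst_dom[of c] cst_dom[of "inverse c"] by (simp add: io_add io_cst flip: cst_inverse)
    show "io (f1 r * \<sigma> r (f2 r' * \<sigma> r' (h t))) * (T r * (T r' * T' t))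
     + io (f2 r' * \<sigma> r' (f1 r * \<sigma> r (h t))) * (T r * (T r' * T' t))
     + io (h t * \<tau> t (f1 r * \<sigma> r (f2 r'))) * (T r * (T r' * T' t))
     + io (h t * \<tau> t (f2 r' * \<sigma> r' (f1 r))) * (T r * (T r' * T' t))
     - ?q * (io (f1 r * \<sigma> r (h t * \<tau> t (f2 r'))) * (T r * (T r' * T' t))
           + io (f2 r' * \<sigma> r' (h t * \<tau> t (f1 r))) * (T r * (T r' * T' t))) = 0"
      (is "?a * ?T + ?b * ?T + ?c * ?T + ?d * ?T - ?q * (?f * ?T + ?g * ?T) = 0")
    proof -
      have "?a * ?T + ?b * ?T + ?c * ?T + ?d * ?T - ?q * (?f * ?T + ?g * ?T) = (?a + ?b + ?c + ?d - ?q * (?f + ?g)) * ?T"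
        by (simp only: distrib_right left_diff_distrib mult.assoc)
      also have "?a + ?b + ?c + ?d = ?q * (?f + ?g)"
        unfolding q using rel[OF r] by (simp add: dd inv flip: io_add io_mult)
      finally show ?thesis by simp
    qed
  qed
  finally show ?thesis .
qed

end

unbundle fps_syntax

section \<open>Series with represented coefficients\<close>

text \<open>The bounds a and b may lie below the true orders, as the declared starts in
  \<open>smul\<close> may; the additional summands vanish.\<close>

lemma fls_mult_nth:
  fixes F G :: "'a::field fls"
  assumes "\<And>m. m < a \<Longrightarrow> F $$ m = 0" "\<And>m. m < b \<Longrightarrow> G $$ m = 0"
  shows "(F * G) $$ m = (\<Sum>j=a..m - b. F $$ j * G $$ (m - j))"
proof (cases "F = 0 \<or> G = 0")
  case False
  then have ab: "a \<le> fls_subdegree F" "b \<le> fls_subdegree G"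
    using assms nth_fls_subdegree_nonzero by (metis linorder_not_le)+
  show ?thesis
    unfolding fls_times_nth(2)
  proof (rule sum.mono_neutral_left)
    show "\<forall>i\<in>{a..m - b} - {fls_subdegree F..m - fls_subdegree G}. F $$ i * G $$ (m - i) = 0"
      by (auto simp: not_le intro: fls_eq0_below_subdegree)
  qed (use ab in auto)
qed auto

text \<open>R is a ring of coefficients mapped by g into the ring that contains the torus. Two
  instances occur: the target algebra with its embedding, and the free algebra with its
  evaluation.\<close>

locale rep = ghom R g e + torus e s U ks
  for R :: "('a, 'm) ring_scheme" (structure) and g :: "'a \<Rightarrow> 'b::ring" and e s U ks
begin

definition rp :: "'a \<Rightarrow> L \<Rightarrow> bool" where
  "rp x f \<longleftrightarrow> x \<in> carrier R \<and> f \<in> dom \<and> g x = io f"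

lemma rp_zero: "rp \<zero> 0" and rp_one: "rp \<one> 1"
  by (simp_all add: rp_def dom_zero dom_one io_zero io_one g_zero g_one)

lemma rp_add: "rp x f \<Longrightarrow> rp y h \<Longrightarrow> rp (x \<oplus> y) (f + h)"
  and rp_mult: "rp x f \<Longrightarrow> rp y h \<Longrightarrow> rp (x \<otimes> y) (f * h)"
  and rp_a_inv: "rp x f \<Longrightarrow> rp (\<ominus> x) (- f)"
  by (simp_all add: rp_def dom_add dom_mult dom_minus io_add io_mult io_minus g_add g_mult g_a_inv)

lemma rp_minus: "rp x f \<Longrightarrow> rp y h \<Longrightarrow> rp (x \<ominus> y) (f - h)"
  using rp_add[OF _ rp_a_inv, of x f y h] by (simp add: a_minus_def)

lemma rp_lsum: "(\<And>i. i \<in> set is \<Longrightarrow> rp (x i) (f i)) \<Longrightarrow> rp (lsum R (map x is)) (\<Sum>i\<leftarrow>is. f i)"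
  by (induction "is") (simp_all add: rp_zero rp_add)

lemma rp_lprod_list: "(\<And>i. i \<in> set is \<Longrightarrow> rp (x i) (f i)) \<Longrightarrow> rp (lprod R (map x is)) (\<Prod>i\<leftarrow>is. f i)"
  by (induction "is") (simp_all add: rp_one rp_mult)

lemma rp_lprod: "(\<And>i. i \<in> set is \<Longrightarrow> rp (x i) (f i)) \<Longrightarrow> distinct is \<Longrightarrow> rp (lprod R (map x is)) (\<Prod>i\<in>set is. f i)"
  using rp_lprod_list[of "is" x f] by (simp add: prod.distinct_set_conv_list)

lemma rp_pow: "rp x f \<Longrightarrow> rp (x [^] (k::nat)) (f ^ k)"
  by (induction k) (simp_all add: rp_one rp_mult power_Suc2 del: power_Suc)

definition srel :: "'a ser \<Rightarrow> L fls \<Rightarrow> bool" where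
  "srel S F \<longleftrightarrow> (\<forall>m. rp (scoef R S m) (F $$ m)) \<and> (\<forall>m < fst S. F $$ m = 0)"

lemma srel_smul:
  assumes S: "srel S F" and T: "srel T G"
  shows "srel (smul R S T) (F * G)"
proof -
  have nth: "(F * G) $$ m = (\<Sum>j=fst S..m - fst T. F $$ j * G $$ (m - j))" for m
    using S T by (intro fls_mult_nth) (auto simp: srel_def)
  have "rp (lsum R (map (\<lambda>j. scoef R S j \<otimes> scoef R T (m - j)) [fst S..m - fst T])) ((F * G) $$ m)" for m
    unfolding nth interv_sum_list_conv_sum_set_int[symmetric] set_upto[symmetric]
    using S T by (intro rp_lsum rp_mult) (auto simp: srel_def)
  then show ?thesis
    using rp_zero by (auto simp: srel_def scoef_def smul_def nth)
qed

lemma srel_sone: "srel (sone R) 1"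
  using rp_zero rp_one by (auto simp: srel_def sone_def scoef_def)

lemma srel_sconst: "rp c f \<Longrightarrow> srel (sconst R c) (fls_const f)"
  using rp_zero by (auto simp: srel_def sconst_def scoef_def)

lemma srel_sshift: "srel S F \<Longrightarrow> srel (sshift k S) (fls_shift (- k) F)"
proof -
  have "scoef R (sshift k S) m = scoef R S (m - k)" for m
    by (auto simp: scoef_def sshift_def)
  then show "srel S F \<Longrightarrow> srel (sshift k S) (fls_shift (- k) F)"
    by (auto simp: srel_def) (simp add: sshift_def)
qed

text \<open>A nonzero coefficient at the declared start makes that start the exact order of F. The
  recursion of \<open>sinvL\<close> is then the comparison of coefficients in F times its inverse =
  1.\<close>

lemma srel_sinvb:
  assumes S: "srel S F" and b: "rp b (inverse (F $$ fst S))" and nz: "F $$ fst S \<noteq> 0"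
  shows "srel (sinvb R S b) (inverse F)"
proof -
  define lo where "lo = fst S"
  define G where "G = inverse F"
  have "fls_subdegree F = lo"
    using S nz by (intro fls_subdegree_eqI) (auto simp: srel_def lo_def)
  then have G0: "G $$ m = 0" if "m < - lo" for m
    using that by (simp add: G_def)
  have F0: "F $$ m = 0" if "m < lo" for m using S that by (simp add: srel_def lo_def)
  have "F \<noteq> 0" using nz by auto
  then have FG: "F * G = 1" by (simp add: G_def)
  have nth: "(F * G) $$ m = (\<Sum>j=lo..m + lo. F $$ j * G $$ (m - j))" for m
    using fls_mult_nth[of lo F "- lo" G m] F0 G0 by simp
  have lead: "G $$ (- lo) = inverse (F $$ lo)"
  proof -
    have "F $$ lo * G $$ (- lo) = 1" using nth[of 0] FG by simp
    then show ?thesis by (rule inverse_unique[symmetric])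
  qed
  have rec: "G $$ (int (Suc k) - lo) = - (inverse (F $$ lo) * (\<Sum>j\<leftarrow>[0..<Suc k]. F $$ (lo + int j + 1) * G $$ (int (k - j) - lo)))" for k
  proof -
    \<comment> \<open>The summand at \<open>lo\<close> carries the coefficient to be solved for; the
      others are renumbered from 0 to match \<open>sinvL\<close>.\<close>
    have "{lo..int (Suc k) + lo} = insert lo ((\<lambda>j. lo + int j + 1) ` {0..<Suc k})"
    proof (intro equalityI subsetI)
      fix x assume x: "x \<in> {lo..int (Suc k) + lo}"
      show "x \<in> insert lo ((\<lambda>j. lo + int j + 1) ` {0..<Suc k})"
      proof (cases "x = lo")
        case False
        with x have "x = lo + int (nat (x - lo - 1)) + 1" "nat (x - lo - 1) \<in> {0..<Suc k}" by auto
        then show ?thesis by blast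
      qed simp
    qed auto
    moreover have "0 = (\<Sum>j=lo..int (Suc k) + lo. F $$ j * G $$ (int (Suc k) - j))"
      using nth[of "int (Suc k)"] FG by simp
    ultimately have "0 = F $$ lo * G $$ (int (Suc k) - lo) + (\<Sum>j\<in>{0..<Suc k}. F $$ (lo + int j + 1) * G $$ (int (Suc k) - (lo + int j + 1)))"
      by (simp add: sum.reindex inj_on_def image_iff)
    also have "(\<Sum>j\<in>{0..<Suc k}. F $$ (lo + int j + 1) * G $$ (int (Suc k) - (lo + int j + 1)))
       = (\<Sum>j\<in>{0..<Suc k}. F $$ (lo + int j + 1) * G $$ (int (k - j) - lo))"
      by (intro sum.cong refl arg_cong2[of _ _ _ _ "(*)"] arg_cong[of _ _ "($$) G"]) (auto simp: of_nat_diff)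
    also have "\<dots> = (\<Sum>j\<leftarrow>[0..<Suc k]. F $$ (lo + int j + 1) * G $$ (int (k - j) - lo))"
      by (simp add: interv_sum_list_conv_sum_set_nat del: upt_Suc)
    finally have "F $$ lo * G $$ (int (Suc k) - lo) = - (\<Sum>j\<leftarrow>[0..<Suc k]. F $$ (lo + int j + 1) * G $$ (int (k - j) - lo))"
      by (simp only: eq_neg_iff_add_eq_0)
    then show ?thesis using nz by (simp add: lo_def field_simps del: upt_Suc)
  qed
  have L: "length (sinvL R S b k) = Suc k \<and> (\<forall>j\<le>k. rp (sinvL R S b k ! j) (G $$ (int j - lo)))" for k
  proof (induction k)
    case 0
    then show ?case using b lead by (simp add: lo_def)
  next
    case (Suc k)
    let ?cs = "sinvL R S b k"
    have "rp (\<ominus> (b \<otimes> lsum R (map (\<lambda>j. scoef R S (fst S + int j + 1) \<otimes> ?cs ! (k - j)) [0..<Suc k]))) (G $$ (int (Suc k) - lo))"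
      unfolding rec using S b Suc
      by (intro rp_a_inv rp_mult rp_lsum) (auto simp: srel_def lo_def simp del: upt_Suc of_nat_diff)
    then show ?case using Suc by (auto simp: Let_def nth_append le_Suc_eq simp del: upt_Suc)
  qed
  have "rp (scoef R (sinvb R S b) m) (G $$ m)" for m
  proof (cases "m < - lo")
    case True
    then show ?thesis using rp_zero by (simp add: scoef_def sinvb_def G0 lo_def)
  next
    case False
    then have "int (nat (m + lo)) - lo = m" by simp
    then show ?thesis using L[of "nat (m + lo)"] False by (auto simp: scoef_def sinvb_def lo_def)
  qed
  then show ?thesis using G0 by (simp add: srel_def G_def sinvb_def lo_def)
qed

text \<open>Singles out the invertible series: the declared start is the exact order, and the
  leading coefficient has an invertible value. This class is closed under products and
  inverses.\<close>

definition srelU :: "'a ser \<Rightarrow> L fls \<Rightarrow> bool" where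
  "srelU S F \<longleftrightarrow> srel S F \<and> F $$ fst S \<noteq> 0 \<and> inverse (F $$ fst S) \<in> dom"

lemma srelU_smul:
  assumes "srelU S F" "srelU T G"
  shows "srelU (smul R S T) (F * G)"
proof -
  have "(F * G) $$ (fst S + fst T) = (\<Sum>j=fst S..fst S + fst T - fst T. F $$ j * G $$ (fst S + fst T - j))"
    using assms by (intro fls_mult_nth) (auto simp: srelU_def srel_def)
  then have "(F * G) $$ fst (smul R S T) = F $$ fst S * G $$ fst T"
    by (simp add: smul_def)
  then show ?thesis using assms srel_smul by (simp add: srelU_def dom_mult)
qed

lemma srelU_sone: "srelU (sone R) 1"
  using srel_sone dom_one by (simp add: srelU_def sone_def)

lemma srelU_sconst: "rp c f \<Longrightarrow> f \<noteq> 0 \<Longrightarrow> inverse f \<in> dom \<Longrightarrow> srelU (sconst R c) (fls_const f)"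
  using srel_sconst by (simp add: srelU_def sconst_def)

lemma srelU_sshift: "srelU S F \<Longrightarrow> srelU (sshift k S) (fls_shift (- k) F)"
  using srel_sshift by (simp add: srelU_def sshift_def)

lemma srelU_sprod_list:
  "(\<And>i. i \<in> set is \<Longrightarrow> srelU (x i) (f i)) \<Longrightarrow> srelU (sprod R (map x is)) (\<Prod>i\<leftarrow>is. f i)"
  by (induction "is") (simp_all add: sprod_def srelU_sone srelU_smul)

lemma srelU_sprod:
  "(\<And>i. i \<in> set is \<Longrightarrow> srelU (x i) (f i)) \<Longrightarrow> distinct is \<Longrightarrow> srelU (sprod R (map x is)) (\<Prod>i\<in>set is. f i)"
  using srelU_sprod_list[of "is" x f] by (simp add: prod.distinct_set_conv_list)

lemma srelU_Cons: "srelU S F \<Longrightarrow> srelU (sprod R Ss) G \<Longrightarrow> srelU (sprod R (S # Ss)) (F * G)"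
  by (simp add: sprod_def srelU_smul)

lemma srelU_sinvb:
  assumes "srelU S F" "rp b (inverse (F $$ fst S))"
  shows "srelU (sinvb R S b) (inverse F)"
proof -
  have "fls_subdegree F = fst S"
    using assms by (intro fls_subdegree_eqI) (auto simp: srel_def srelU_def)
  then have "inverse F $$ (- fst S) = inverse (F $$ fst S)"
    using fls_inverse_base[of F] assms by (cases "F = 0") (simp_all add: srelU_def)
  then show ?thesis using assms srel_sinvb[of S F b]
    by (simp add: srelU_def sinvb_def srel_def rp_def)
qed

end

text \<open>g identifies R with the whole corner of e, so that an inverse found in the ambient ring
  comes from an element of the carrier.\<close>

locale rep_emb = rep +
  assumes g_inj: "inj_on g (carrier R)" and g_surj: "e * b = b \<Longrightarrow> b * e = b \<Longrightarrow> b \<in> g ` carrier R"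
begin

lemma rp_m_inv:
  assumes x: "rp x f" and f: "f \<noteq> 0" "inverse f \<in> dom"
  shows "rp (m_inv R x) (inverse f)"
proof -
  obtain y where y: "y \<in> carrier R" "g y = io (inverse f)"
    using g_surj[OF e_io io_e, OF f(2) f(2)] by auto
  have c: "cinv (io f) (io (inverse f))" using x f by (simp add: rp_def io_inverse_cinv)
  have "g (x \<otimes> y) = g \<one>" "g (y \<otimes> x) = g \<one>"
    using x y c by (simp_all add: rp_def g_mult g_one cinv_def)
  then have "x \<otimes> y = \<one>" "y \<otimes> x = \<one>"
    using g_inj x y by (auto simp: rp_def inj_on_def)
  then have "m_inv R x = y" using x y by (intro inv_char) (auto simp: rp_def)
  then show ?thesis using y f by (simp add: rp_def)
qed

end


section \<open>Partial fractions and the two expansions of a rational function\<close>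

text \<open>Induction on the set of poles. The alternative I = {} is needed because the empty sum is
  0 while the empty product has inverse 1.\<close>

lemma partial_fractions:
  fixes c :: "'i \<Rightarrow> 'k::field"
  assumes "finite I" "inj_on c I" "\<And>p. p \<in> I \<Longrightarrow> c p \<noteq> 0" "\<And>p. p \<in> I \<Longrightarrow> 1 - c p * t \<noteq> 0"
  shows "(\<Sum>p\<in>I. inverse (\<Prod>p'\<in>I - {p}. 1 - c p' / c p) / (1 - c p * t)) = inverse (\<Prod>p\<in>I. 1 - c p * t) \<or> I = {}"
  using assms
proof (induction I arbitrary: t rule: finite_induct)
  case (insert d I)
  show ?case
  proof (cases "I = {}")
    case False
    define A where "A p = inverse (\<Prod>p'\<in>I - {p}. 1 - c p' / c p)" for p
    have ne: "c d \<noteq> c p" if "p \<in> I" for p using insert that by (auto simp: inj_on_def)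
    have nz: "c d \<noteq> 0" "1 - c d * t \<noteq> 0" "\<And>p. p \<in> I \<Longrightarrow> c p \<noteq> 0 \<and> 1 - c p * t \<noteq> 0"
      using insert by auto
    have IH: "(\<Sum>p\<in>I. A p / (1 - c p * t)) = inverse (\<Prod>p\<in>I. 1 - c p * t)"
      using insert.IH[of t] insert.prems False by (auto simp: A_def inj_on_def)
    \<comment> \<open>Evaluation at t = 1 / \<open>c d\<close>, the pole of the new factor,
      expresses the new residue through the old ones; this is why t is kept general in the
      induction.\<close>
    have IHd: "(\<Sum>p\<in>I. A p / (1 - c p * inverse (c d))) = inverse (\<Prod>p\<in>I. 1 - c p * inverse (c d))"
      using insert.IH[of "inverse (c d)"] insert.prems False ne nz
      by (auto simp: A_def inj_on_def field_simps)
    have A: "inverse (\<Prod>p'\<in>insert d I - {p}. 1 - c p' / c p) = A p / (1 - c d / c p)" if "p \<in> I" for p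
    proof -
      have "insert d I - {p} = insert d (I - {p})" using that insert by auto
      then show ?thesis using insert by (simp add: A_def divide_inverse)
    qed
    have "insert d I - {d} = I" using insert by auto
    then have Ad: "inverse (\<Prod>p'\<in>insert d I - {d}. 1 - c p' / c d) = (\<Sum>p\<in>I. A p / (1 - c p * inverse (c d)))"
      using IHd by (simp add: divide_inverse)
    have "(\<Sum>p\<in>insert d I. inverse (\<Prod>p'\<in>insert d I - {p}. 1 - c p' / c p) / (1 - c p * t))
      = (\<Sum>p\<in>I. A p / (1 - c p * inverse (c d))) / (1 - c d * t) + (\<Sum>p\<in>I. A p / (1 - c d / c p) / (1 - c p * t))"
      using insert.hyps A Ad by simp
    \<comment> \<open>What remains is, for each p, the decomposition of 1 / ((1 - c_p t) (1 - c_d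
      t)) into two fractions.\<close>
    also have "\<dots> = (\<Sum>p\<in>I. A p / (1 - c p * t)) / (1 - c d * t)"
      unfolding sum_divide_distrib sum.distrib[symmetric]
    proof (intro sum.cong refl)
      fix p assume p: "p \<in> I"
      have "1 / (1 - c p * inverse (c d)) / (1 - c d * t) + 1 / (1 - c d / c p) / (1 - c p * t)
         = 1 / (1 - c p * t) / (1 - c d * t)"
      proof -
        have "1 / (1 - c p * inverse (c d)) = c d / (c d - c p)" "1 / (1 - c d / c p) = c p / (c p - c d)"
          using ne[OF p] nz p by (auto simp: field_simps)
        moreover have "c p / (c p - c d) = - c p / (c d - c p)"
          by (metis minus_diff_eq minus_divide_divide minus_divide_left)
        moreover have "c d / (c d - c p) / (1 - c d * t) + - c p / (c d - c p) / (1 - c p * t)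
            = 1 / (1 - c p * t) / (1 - c d * t)"
        proof -
          have "c d - c p \<noteq> 0" using ne[OF p] by simp
          then show ?thesis using nz(2) nz(3)[OF p] by (simp add: divide_simps) (simp add: algebra_simps)
        qed
        ultimately show ?thesis by simp
      qed
      then have "A p * (1 / (1 - c p * inverse (c d)) / (1 - c d * t) + 1 / (1 - c d / c p) / (1 - c p * t))
         = A p * (1 / (1 - c p * t) / (1 - c d * t))" by simp
      then show "A p / (1 - c p * inverse (c d)) / (1 - c d * t) + A p / (1 - c d / c p) / (1 - c p * t)
          = A p / (1 - c p * t) / (1 - c d * t)"
        by (simp add: distrib_left)
    qed
    also have "\<dots> = inverse (\<Prod>p\<in>insert d I. 1 - c p * t)"
      unfolding IH using insert by (simp add: divide_inverse mult.commute)
    finally show ?thesis by blast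
  qed (simp add: divide_inverse)
qed simp

text \<open>\<open>fac eps c\<close> is 1 - c/z, and \<open>zc eps F m\<close> is the coefficient of \<open>z\<close> to the power -m, where
  the series variable is 1/z for eps = True and z for eps = False.\<close>

definition fac :: "bool \<Rightarrow> 'a::field \<Rightarrow> 'a fls" where
  "fac eps c = 1 - fls_const c * (if eps then fls_X else fls_X_inv)"

definition zc :: "bool \<Rightarrow> 'a::field fls \<Rightarrow> int \<Rightarrow> 'a" where
  "zc eps F m = F $$ (if eps then m else - m)"

text \<open>Multiplication by z to the power k, in either expansion.\<close>

definition zshift :: "bool \<Rightarrow> int \<Rightarrow> 'a::field fls \<Rightarrow> 'a fls" where
  "zshift eps k F = fls_shift (if eps then k else - k) F"

lemma zc_zshift [simp]: "zc eps (zshift eps k F) m = zc eps F (m + k)"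
  by (simp add: zc_def zshift_def)

lemma zshift_mult: "zshift eps j F * zshift eps k G = zshift eps (j + k) (F * G)"
  by (simp add: zshift_def fls_shifted_times_simps add.commute)

lemma zshift_inverse: "inverse (zshift eps k F) = zshift eps (- k) (inverse F)"
  by (simp add: zshift_def fls_inverse_shift)

lemma zc_const_mult: "zc eps (fls_const c * F) m = c * zc eps F m"
  by (simp add: zc_def)

lemma zc_fac: "zc eps (fac eps c * F) m = zc eps F m - c * zc eps F (m - 1)"
proof -
  have "fac eps c * F = F - fls_const c * ((if eps then fls_X else fls_X_inv) * F)"
    by (simp add: fac_def algebra_simps)
  then show ?thesis
    by (simp add: zc_def fls_X_times_conv_shift(1) fls_X_inv_times_conv_shift(1))
qed

lemma fac_nth: "fac True c $$ m = (if m = 0 then 1 else if m = 1 then - c else 0)"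
  "fac False c $$ m = (if m = 0 then 1 else if m = -1 then - c else 0)"
  by (simp_all add: fac_def)

lemma fac_neq_0: "fac eps c \<noteq> 0"
proof
  assume "fac eps c = 0"
  then have "fac eps c $$ 0 = 0" by simp
  then show False by (cases eps) (simp_all add: fac_nth)
qed

lemma fac_subdegree: "c \<noteq> 0 \<Longrightarrow> fls_subdegree (fac eps c) = (if eps then 0 else -1)"
  by (cases eps) (auto intro!: fls_subdegree_eqI simp: fac_nth)

text \<open>The difference of the two expansions is annihilated by 1 - c/z, hence geometric in m;
  its value at m = 0 identifies it with the coefficients of delta(c/z).\<close>

lemma inverse_fac_expansions:
  assumes "c \<noteq> (0::'a::field)"
  shows "zc True (inverse (fac True c)) m - zc False (inverse (fac False c)) m = c powi m"
proof -
  define d where "d m = zc True (inverse (fac True c)) m - zc False (inverse (fac False c)) m" for m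
  have z1: "zc eps 1 m = (if m = 0 then 1 else 0)" for eps and m :: int by (simp add: zc_def)
  have *: "zc eps (inverse (fac eps c)) m - c * zc eps (inverse (fac eps c)) (m - 1) = (if m = 0 then 1 else 0)" for eps m
    using zc_fac[of eps c "inverse (fac eps c)" m] fac_neq_0[of eps c] by (simp add: z1)
  have rec: "d m = c * d (m - 1)" for m
    using *[of True m] *[of False m] unfolding d_def by (simp add: algebra_simps)
  \<comment> \<open>Expanded in 1/z the inverse has no positive powers of z; expanded in z it starts
    with the first power. Both coefficients lie outside these supports.\<close>
  have "zc True (inverse (fac True c)) (- 1) = 0" "zc False (inverse (fac False c)) 0 = 0"
    using assms by (simp_all add: zc_def fac_subdegree)
  then have d0: "d 0 = 1" using *[of True 0] by (simp add: d_def)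
  have "d m = c powi m"
  proof (induction m rule: int_induct[where k = 0])
    case (step1 i)
    then show ?case using rec[of "i + 1"] assms by (simp add: power_int_add_1')
  next
    case (step2 i)
    then show ?case using rec[of i] assms by (simp add: power_int_diff eq_divide_eq mult.commute)
  qed (simp add: d0)
  then show ?thesis by (simp add: d_def)
qed

lemma zc_sum: "zc eps (sum F A) m = (\<Sum>x\<in>A. zc eps (F x) m)"
  by (induction A rule: infinite_finite_induct) (simp_all add: zc_def)

lemma fls_const_prod: "fls_const (prod f A :: 'a::field) = (\<Prod>x\<in>A. fls_const (f x))"
  by (induction A rule: infinite_finite_induct) (simp_all flip: fls_const_mult_const)

text \<open>Partial fractions in the field of Laurent series itself, at the point t = 1/z.\<close>

lemma inverse_prod_fac:
  fixes c :: "'i \<Rightarrow> 'a::field"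
  assumes "finite I" "inj_on c I" "\<And>p. p \<in> I \<Longrightarrow> c p \<noteq> 0"
  shows "inverse (\<Prod>p\<in>I. fac eps (c p)) = (\<Sum>p\<in>I. fls_const (inverse (\<Prod>p'\<in>I - {p}. 1 - c p' / c p)) * inverse (fac eps (c p))) \<or> I = {}"
proof -
  let ?t = "if eps then fls_X else fls_X_inv :: 'a fls"
  have f: "fac eps x = 1 - fls_const x * ?t" for x by (simp add: fac_def)
  have "(\<Sum>p\<in>I. inverse (\<Prod>p'\<in>I - {p}. 1 - fls_const (c p') / fls_const (c p)) / (1 - fls_const (c p) * ?t))
     = inverse (\<Prod>p\<in>I. 1 - fls_const (c p) * ?t) \<or> I = {}"
  proof (rule partial_fractions)
    have "x = y" if "fls_const x = fls_const y" for x y :: 'a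
      using that by (metis fls_const_nth)
    then show "inj_on (\<lambda>p. fls_const (c p)) I" using assms by (auto simp: inj_on_def)
    show "1 - fls_const (c p) * ?t \<noteq> 0" for p using fac_neq_0[of eps "c p"] by (simp only: f not_False_eq_True)
  qed (use assms in auto)
  moreover have "inverse (\<Prod>p'\<in>I - {p}. 1 - fls_const (c p') / fls_const (c p))
     = fls_const (inverse (\<Prod>p'\<in>I - {p}. 1 - c p' / c p))" for p
    by (simp add: fls_const_prod fls_inverse_const divide_inverse
        flip: fls_const_mult_const fls_minus_const fls_const_1)
       (simp add: fls_const_prod flip: fls_inverse_const fls_const_mult_const fls_minus_const)
  ultimately show ?thesis by (auto simp: f divide_inverse)
qed

text \<open>The delta-function expansion of a rational function with simple poles away from 0 and infinity.\<close>

lemma expansions_difference: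
  fixes c :: "'i \<Rightarrow> 'a::field" and b :: "'j \<Rightarrow> 'a" and a :: 'a
  assumes I: "finite I" "inj_on c I" "\<And>p. p \<in> I \<Longrightarrow> c p \<noteq> 0" and J: "finite J"
  defines "G \<equiv> \<lambda>eps. fls_const a * (\<Prod>j\<in>J. fac eps (b j)) * inverse (\<Prod>p\<in>I. fac eps (c p))"
  shows "zc True (G True) m - zc False (G False) m
    = (\<Sum>p\<in>I. c p powi m * (a * (\<Prod>j\<in>J. 1 - b j / c p) / (\<Prod>p'\<in>I - {p}. 1 - c p' / c p)))"
proof -
  define H where "H eps = inverse (\<Prod>p\<in>I. fac eps (c p))" for eps
  define A where "A p = inverse (\<Prod>p'\<in>I - {p}. 1 - c p' / c p)" for p
  have H: "zc True (H True) m - zc False (H False) m = (\<Sum>p\<in>I. c p powi m * A p)" for m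
  proof (cases "I = {}")
    case ne: False
    have "H eps = (\<Sum>p\<in>I. fls_const (A p) * inverse (fac eps (c p)))" for eps
      using inverse_prod_fac[of I c eps] I ne by (auto simp: H_def A_def)
    then show ?thesis
      using I(3) by (simp add: zc_sum zc_const_mult inverse_fac_expansions mult.commute
          flip: sum_subtractf right_diff_distrib)
  qed (simp add: H_def zc_def)
  \<comment> \<open>The numerator factors are added one at a time: on the delta supported at
    \<open>c p\<close>, multiplication by 1 - b/z acts as its value 1 - b / \<open>c p\<close>,
    since c^(m-1) = c^m / c.\<close>
  have "zc True ((\<Prod>j\<in>J. fac True (b j)) * H True) m - zc False ((\<Prod>j\<in>J. fac False (b j)) * H False) m
      = (\<Sum>p\<in>I. c p powi m * (A p * (\<Prod>j\<in>J. 1 - b j / c p)))" for m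
    using J
  proof (induction J arbitrary: m rule: finite_induct)
    case (insert j J)
    let ?P = "\<lambda>eps. (\<Prod>j\<in>J. fac eps (b j)) * H eps"
    have "zc True (fac True (b j) * ?P True) m - zc False (fac False (b j) * ?P False) m
       = (zc True (?P True) m - zc False (?P False) m) - b j * (zc True (?P True) (m - 1) - zc False (?P False) (m - 1))"
      unfolding zc_fac by (simp add: algebra_simps)
    also have "\<dots> = (\<Sum>p\<in>I. c p powi m * (A p * (\<Prod>j\<in>insert j J. 1 - b j / c p)))"
      unfolding insert.IH sum_distrib_left sum_subtractf[symmetric]
    proof (intro sum.cong refl)
      fix p assume "p \<in> I"
      then have "c p powi (m - 1) = c p powi m / c p" using I(3) by (simp add: power_int_diff)
      then show "c p powi m * (A p * (\<Prod>j\<in>J. 1 - b j / c p)) - b j * (c p powi (m - 1) * (A p * (\<Prod>j\<in>J. 1 - b j / c p)))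
         = c p powi m * (A p * (\<Prod>j\<in>insert j J. 1 - b j / c p))"
        using insert.hyps by (simp add: algebra_simps)
    qed
    finally show ?case using insert.hyps by (simp add: mult.assoc)
  qed (simp add: H)
  then show ?thesis
    by (simp add: G_def zc_const_mult mult.assoc flip: H_def right_diff_distrib)
      (simp add: sum_distrib_left A_def divide_inverse mult_ac)
qed

section \<open>Field endomorphisms acting coefficientwise on Laurent series\<close>

definition fls_map :: "('a::field \<Rightarrow> 'a) \<Rightarrow> 'a fls \<Rightarrow> 'a fls" where
  "fls_map h F = Abs_fls (\<lambda>m. h (F $$ m))"

context
  fixes h :: "'a::field \<Rightarrow> 'a"
  assumes h_add: "\<And>x y. h (x + y) = h x + h y" and h_mult: "\<And>x y. h (x * y) = h x * h y" and h_1: "h 1 = 1"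
begin

lemma h_0: "h 0 = 0"
  by (metis add.right_neutral add_left_cancel h_add)

lemma fls_map_nth [simp]: "fls_map h F $$ m = h (F $$ m)"
  unfolding fls_map_def
  by (rule nth_Abs_fls_lower_bound[of "fls_subdegree F"]) (simp add: h_0)

lemma fls_map_mult: "fls_map h (F * G) = fls_map h F * fls_map h G"
proof (rule fls_eqI)
  fix m
  have "(fls_map h F * fls_map h G) $$ m
     = (\<Sum>j=fls_subdegree F..m - fls_subdegree G. fls_map h F $$ j * fls_map h G $$ (m - j))"
    by (rule fls_mult_nth) (simp_all add: h_0)
  then show "fls_map h (F * G) $$ m = (fls_map h F * fls_map h G) $$ m"
    by (simp add: fls_times_nth(2) additive_sum[of h, OF h_add] h_mult)
qed

lemma fls_map_1: "fls_map h 1 = 1"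
  by (rule fls_eqI) (simp add: h_1 h_0)

lemma fls_map_const: "fls_map h (fls_const c) = fls_const (h c)"
  by (rule fls_eqI) (simp add: h_0)

lemma fls_map_inverse: "fls_map h (inverse F) = inverse (fls_map h F)"
proof (cases "F = 0")
  case True
  have "fls_map h 0 = 0" by (rule fls_eqI) (simp add: h_0)
  then show ?thesis by (simp add: True)
next
  case False
  then have "fls_map h F * fls_map h (inverse F) = 1" by (simp add: fls_map_1 flip: fls_map_mult)
  then show ?thesis by (rule inverse_unique[symmetric])
qed

lemma fls_map_prod: "fls_map h (prod F A) = (\<Prod>x\<in>A. fls_map h (F x))"
  by (induction A rule: infinite_finite_induct) (simp_all add: fls_map_1 fls_map_mult)

lemma fls_map_power_int: "fls_map h (F powi k) = fls_map h F powi k"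
proof -
  have "fls_map h (F ^ n) = fls_map h F ^ n" for F n
    by (induction n) (simp_all add: fls_map_1 fls_map_mult)
  then show ?thesis by (simp add: power_int_def fls_map_inverse)
qed

lemma fls_map_zshift: "fls_map h (zshift eps k F) = zshift eps k (fls_map h F)"
  by (rule fls_eqI) (simp add: zshift_def)

lemma fls_map_fac: "fls_map h (fac eps c) = fac eps (h c)"
proof -
  have "h (- c) = - h c" using h_add[of "- c" c] by (simp add: h_0 eq_neg_iff_add_eq_0)
  then show ?thesis by (cases eps) (auto intro!: fls_eqI simp: fac_nth h_0 h_1)
qed

end

text \<open>The last three hypotheses compare the coefficients of z, 1 and 1/z in (\<alpha> z +
  \<beta> x)(1 - b/z) = \<rho> (\<gamma> z + \<epsilon> x)(1 - b'/z), where x is the support point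
  of a delta function; S is the part of the Cartan series common to both sides.\<close>

lemma phi_rel:
  fixes S :: "L fls"
  assumes F: "F = zshift eps k0 (fac eps b * S)" and F': "F' = zshift eps k0 (fls_const \<rho> * (fac eps b' * S))"
    and "\<alpha> = \<rho> * \<gamma>" "\<beta> * x - \<alpha> * b = \<rho> * (\<epsilon> * x - \<gamma> * b')" "\<beta> * b = \<rho> * \<epsilon> * b'"
  shows "\<alpha> * zc eps F (k + 1) + \<beta> * x * zc eps F k = \<gamma> * zc eps F' (k + 1) + \<epsilon> * x * zc eps F' k"
proof -
  define s where "s j = zc eps S (k + k0 + j)" for j
  have s: "zc eps F (k + 1) = s 1 - b * s 0" "zc eps F k = s 0 - b * s (- 1)"
    "zc eps F' (k + 1) = \<rho> * (s 1 - b' * s 0)" "zc eps F' k = \<rho> * (s 0 - b' * s (- 1))"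
    unfolding F F' zc_zshift zc_const_mult zc_fac s_def by (simp_all add: algebra_simps)
  have "\<alpha> * (s 1 - b * s 0) + \<beta> * x * (s 0 - b * s (- 1))
     = \<alpha> * s 1 + (\<beta> * x - \<alpha> * b) * s 0 - (\<beta> * b) * x * s (- 1)" by (simp add: algebra_simps)
  also have "\<dots> = \<gamma> * (\<rho> * (s 1 - b' * s 0)) + \<epsilon> * x * (\<rho> * (s 0 - b' * s (- 1)))"
    unfolding assms(4,5) unfolding assms(3) by (simp add: algebra_simps)
  finally show ?thesis by (simp add: s)
qed


section \<open>The coefficients of the currents and their shifts\<close>

lemma vv_neq_0 [simp]: "vv \<noteq> 0"
  by (simp add: vv_def Zero_fract_def eq_fract)

lemma vv_sq_neq_1: "vv\<^sup>2 \<noteq> 1"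
proof
  assume "vv\<^sup>2 = 1"
  then have "Fract ([:0, 1:] * [:0, 1:]) 1 = Fract (1 :: complex poly) 1"
    unfolding power2_eq_square vv_def mult_fract One_fract_def mult_1_right .
  then have "[:0, 1:] * [:0, 1:] = (1 :: complex poly)"
    by (simp only: eq_fract one_neq_zero not_False_eq_True mult_1_right)
  then have "poly ([:0, 1:] * [:0, 1:]) 0 = poly (1 :: complex poly) 0" by simp
  then show False by simp
qed

text \<open>Serves to compute shifts, which change a single factor of a product over the indices at
  one node.\<close>

lemma prod_ratio:
  fixes f g :: "'i \<Rightarrow> 'k::field"
  assumes "finite S" "t \<in> S" "\<And>x. x \<in> S \<Longrightarrow> x \<noteq> t \<Longrightarrow> g x = f x" "f t \<noteq> 0"
  shows "prod g S = g t / f t * prod f S"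
proof -
  have "prod g (S - {t}) = prod f (S - {t})" using assms by (intro prod.cong) auto
  then show ?thesis using assms by (simp add: prod.remove[of S t])
qed

text \<open>Here the shifts do not move the support points x and y, so their powers factor out and a
  single identity between the ratios \<rho> and \<rho>' covers all modes k and l.\<close>

lemma exchange_off_diagonal:
  fixes X Y :: "int \<Rightarrow> 'k::field"
  assumes "\<And>k. X k = x powi (k + \<kappa>) * e" "\<And>l. Y l = y powi (l + \<kappa>') * f"
    "\<And>l. \<sigma> (Y l) = y powi (l + \<kappa>') * (\<rho> * f)" "\<And>k. \<sigma>' (X k) = x powi (k + \<kappa>) * (\<rho>' * e)"
    "x \<noteq> 0" "y \<noteq> 0" "(\<alpha> * x + \<beta> * y) * \<rho> = (\<gamma> * x + \<epsilon> * y) * \<rho>'"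
  shows "\<alpha> * (X (k + 1) * \<sigma> (Y l)) + \<beta> * (X k * \<sigma> (Y (l + 1)))
    = \<gamma> * (Y l * \<sigma>' (X (k + 1))) + \<epsilon> * (Y (l + 1) * \<sigma>' (X k))"
proof -
  have p: "x powi (k + 1 + \<kappa>) = x * x powi (k + \<kappa>)" "y powi (l + 1 + \<kappa>') = y * y powi (l + \<kappa>')"
    using assms(5,6) power_int_add_1'[of x "k + \<kappa>"] power_int_add_1'[of y "l + \<kappa>'"] by (simp_all add: ac_simps)
  let ?M = "x powi (k + \<kappa>) * y powi (l + \<kappa>') * e * f"
  have "\<alpha> * (X (k + 1) * \<sigma> (Y l)) + \<beta> * (X k * \<sigma> (Y (l + 1))) = ?M * ((\<alpha> * x + \<beta> * y) * \<rho>)"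
    unfolding assms(3,4) unfolding assms(1,2) p by (simp add: algebra_simps)
  also have "\<dots> = ?M * ((\<gamma> * x + \<epsilon> * y) * \<rho>')" by (simp only: assms(7))
  also have "\<dots> = \<gamma> * (Y l * \<sigma>' (X (k + 1))) + \<epsilon> * (Y (l + 1) * \<sigma>' (X k))"
    unfolding assms(3,4) unfolding assms(1,2) p by (simp add: algebra_simps)
  finally show ?thesis .
qed

text \<open>With equal indices the shift moves the support point itself, x to d x, and each side
  vanishes separately because its linear factor has a zero there.\<close>

lemma exchange_diagonal:
  fixes X Y :: "int \<Rightarrow> 'k::field"
  assumes "\<And>k. X k = x powi (k + \<kappa>) * e" 
    "\<And>l. \<sigma> (X l) = (d * x) powi (l + \<kappa>) * f"
    "x \<noteq> 0" "d \<noteq> 0" "\<alpha> + \<beta> * d = 0" "\<gamma> * d + \<epsilon> = 0"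
  shows "\<alpha> * (X (k + 1) * \<sigma> (X l)) + \<beta> * (X k * \<sigma> (X (l + 1)))
    = \<gamma> * (X l * \<sigma> (X (k + 1))) + \<epsilon> * (X (l + 1) * \<sigma> (X k))"
proof -
  have p: "z powi (k + 1 + \<kappa>) = z * z powi (k + \<kappa>)" "z powi (l + 1 + \<kappa>) = z * z powi (l + \<kappa>)" if "z \<noteq> 0" for z :: 'k
    using that power_int_add_1'[of z "k + \<kappa>"] power_int_add_1'[of z "l + \<kappa>"] by (simp_all add: ac_simps)
  have dx: "d * x \<noteq> 0" using assms by simp
  have "\<alpha> * (X (k + 1) * \<sigma> (X l)) + \<beta> * (X k * \<sigma> (X (l + 1)))
     = (\<alpha> + \<beta> * d) * (x * x powi (k + \<kappa>) * e * (d * x) powi (l + \<kappa>) * f)"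
    unfolding assms(2) unfolding assms(1) p[OF assms(3)] p[OF dx] by (simp add: algebra_simps)
  moreover have "\<gamma> * (X l * \<sigma> (X (k + 1))) + \<epsilon> * (X (l + 1) * \<sigma> (X k))
     = (\<gamma> * d + \<epsilon>) * (x * x powi (l + \<kappa>) * e * (d * x) powi (k + \<kappa>) * f)"
    unfolding assms(2) unfolding assms(1) p[OF assms(3)] p[OF dx] by (simp add: algebra_simps)
  ultimately show ?thesis using assms by simp
qed

text \<open>Every shift multiplies the other coefficients by a ratio that the shifts applied
  afterwards leave alone, so f1 f2 h factors out and an identity between the ratios remains.\<close>

lemma serre_off_diagonal:
  fixes f1 f2 h :: "'k::field"
  assumes m: "\<And>x y. \<sigma> (x * y) = \<sigma> x * \<sigma> y" "\<And>x y. \<sigma>' (x * y) = \<sigma>' x * \<sigma>' y" "\<And>x y. \<tau> (x * y) = \<tau> x * \<tau> y"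
    and "\<sigma> f2 = A' * f2" "\<sigma>' f1 = A * f1" "\<sigma> h = p * h" "\<sigma>' h = p' * h" "\<tau> f1 = Q * f1" "\<tau> f2 = Q' * f2"
    "\<sigma> p' = p'" "\<sigma>' p = p" "\<sigma> Q' = Q'" "\<sigma>' Q = Q" "\<tau> A = A" "\<tau> A' = A'"
    and "(A + A') * (p * p' + Q * Q') = c * (A' * p * Q' + A * p' * Q)"
  shows "f1 * \<sigma> (f2 * \<sigma>' h) + f2 * \<sigma>' (f1 * \<sigma> h) + h * \<tau> (f1 * \<sigma> f2) + h * \<tau> (f2 * \<sigma>' f1)
    = c * (f1 * \<sigma> (h * \<tau> f2) + f2 * \<sigma>' (h * \<tau> f1))"
proof -
  have "f1 * \<sigma> (f2 * \<sigma>' h) + f2 * \<sigma>' (f1 * \<sigma> h) + h * \<tau> (f1 * \<sigma> f2) + h * \<tau> (f2 * \<sigma>' f1)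
     = f1 * f2 * h * ((A + A') * (p * p' + Q * Q'))"
    by (simp add: m assms(4-15) algebra_simps)
  also have "\<dots> = f1 * f2 * h * (c * (A' * p * Q' + A * p' * Q))" by (simp only: assms(16))
  also have "\<dots> = c * (f1 * \<sigma> (h * \<tau> f2) + f2 * \<sigma>' (h * \<tau> f1))"
    by (simp add: m assms(4-15) algebra_simps)
  finally show ?thesis .
qed

text \<open>For r = r' the symmetric expression f1 \<sigma>(f2) + f2 \<sigma>(f1) factors out as a
  whole; p' and Q' are the ratios met by a second application of the same shift.\<close>

lemma serre_diagonal:
  fixes f1 f2 h :: "'k::field"
  assumes m: "\<And>x y. \<sigma> (x * y) = \<sigma> x * \<sigma> y" "\<And>x y. \<tau> (x * y) = \<tau> x * \<tau> y"
    and "\<sigma> h = p * h" "\<sigma> p = p'" "\<tau> f1 = Q * f1" "\<tau> f2 = Q * f2" "\<sigma> Q = Q'"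
    and "\<tau> (\<sigma> f1) = \<sigma> (\<tau> f1)" "\<tau> (\<sigma> f2) = \<sigma> (\<tau> f2)"
    and "p * p' + Q * Q' = c * (p * Q')"
  shows "f1 * \<sigma> (f2 * \<sigma> h) + f2 * \<sigma> (f1 * \<sigma> h) + h * \<tau> (f1 * \<sigma> f2) + h * \<tau> (f2 * \<sigma> f1)
    = c * (f1 * \<sigma> (h * \<tau> f2) + f2 * \<sigma> (h * \<tau> f1))"
proof -
  have "f1 * \<sigma> (f2 * \<sigma> h) + f2 * \<sigma> (f1 * \<sigma> h) + h * \<tau> (f1 * \<sigma> f2) + h * \<tau> (f2 * \<sigma> f1)
     = (f1 * \<sigma> f2 + f2 * \<sigma> f1) * h * (p * p' + Q * Q')"
    by (simp add: m assms(3-9) algebra_simps)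
  also have "\<dots> = (f1 * \<sigma> f2 + f2 * \<sigma> f1) * h * (c * (p * Q'))" by (simp only: assms(10))
  also have "\<dots> = c * (f1 * \<sigma> (h * \<tau> f2) + f2 * \<sigma> (h * \<tau> f1))"
    by (simp add: m assms(3-9) algebra_simps)
  finally show ?thesis .
qed

lemma scale_commute: "scale k c (scale l d p) = scale l d (scale k c p)"
  by (rule poly_mapping_eqI) (simp add: lookup_scale)

lemma sig_commute:
  assumes "c \<noteq> 0" "d \<noteq> 0"
  shows "sig k c (sig l d x) = sig l d (sig k c x)"
  by (cases x) (use assms in \<open>simp add: sig_Fract scale_eq_0 scale_commute\<close>)

text \<open>\<open>u i r\<close> stands for the square root of \<open>w i r\<close>; so
  \<open>sh i r c\<close> multiplies \<open>w i r\<close> by the square of c, and c = v is the shift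
  effected by D_{i,r}.\<close>

definition u :: "nat \<Rightarrow> nat \<Rightarrow> L" where "u i r = var (prod_encode (i, r))"
definition w :: "nat \<Rightarrow> nat \<Rightarrow> L" where "w i r = (u i r)\<^sup>2"
definition sh :: "nat \<Rightarrow> nat \<Rightarrow> K \<Rightarrow> L \<Rightarrow> L" where "sh i r = sig (prod_encode (i, r))"
abbreviation q :: L where "q \<equiv> cst vv"

lemma u_neq_0 [simp]: "u i r \<noteq> 0" and w_neq_0 [simp]: "w i r \<noteq> 0"
  by (simp_all add: u_def w_def)

lemma q_facts [simp]: "q \<noteq> 0" "q\<^sup>2 \<noteq> 1" "1 - q\<^sup>2 \<noteq> 0"
proof -
  show "q\<^sup>2 \<noteq> 1" using vv_sq_neq_1 cst_eq_iff[of "vv\<^sup>2" 1] by (simp add: cst_power)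
  then show "1 - q\<^sup>2 \<noteq> 0" by simp
qed simp

lemma sh_u: "c \<noteq> 0 \<Longrightarrow> sh i r c (u j t) = (if j = i \<and> t = r then cst c else 1) * u j t"
  by (auto simp: sh_def u_def sig_var)

lemma sh_w: "c \<noteq> 0 \<Longrightarrow> sh i r c (w j t) = (if j = i \<and> t = r then (cst c)\<^sup>2 else 1) * w j t"
  by (simp add: w_def sh_def[symmetric] sig_power[of c "prod_encode (i, r)", folded sh_def] sh_u power_mult_distrib)

lemmas sh_simps = sig_simps[of _ "prod_encode (i, r)" for i r, folded sh_def]

lemma w_neq: "(i, r) \<noteq> (j, t) \<Longrightarrow> c \<noteq> 0 \<Longrightarrow> cst c * w i r \<noteq> cst d * w j t"
  using var_sq_neq[of "prod_encode (i, r)" "prod_encode (j, t)"]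
  by (simp add: w_def u_def prod_encode_eq)

lemma w_eq_iff [simp]: "w i r = w j t \<longleftrightarrow> i = j \<and> r = t"
  using w_neq[of i r j t 1 1] by auto

lemma w_neq1: "(i, r) \<noteq> (j, t) \<Longrightarrow> 1 - cst c * w i r / w j t \<noteq> 0"
proof
  assume ne: "(i, r) \<noteq> (j, t)" and "1 - cst c * w i r / w j t = 0"
  then have "cst 1 * w j t = cst c * w i r" by (simp add: field_simps)
  with w_neq[of j t i r 1 c] ne show False by auto
qed

lemma sh_commute: "c \<noteq> 0 \<Longrightarrow> d \<noteq> 0 \<Longrightarrow> sh i r c (sh j t d x) = sh j t d (sh i r c x)"
  by (simp add: sh_def sig_commute)

section \<open>The coefficients of the images of E and F, and the effect of shifts on them\<close>

locale gklo =
  fixes n N :: nat and "is" :: "nat \<Rightarrow> nat" and xs :: "nat \<Rightarrow> complex" and gam :: "nat \<Rightarrow> int"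
    and mp mm :: "nat \<Rightarrow> int" and a :: "nat \<Rightarrow> nat"
  assumes n2: "2 \<le> n"
    and div: "\<forall>s\<in>{1..N}. is s \<le> n - 1 \<and> xs s \<noteq> 0
            \<and> (is s \<noteq> 0 \<longrightarrow> gam s = 1) \<and> (is s = 0 \<longrightarrow> gam s = 1 \<or> gam s = -1)"
    and bal: "\<forall>j\<in>{1..n}. lam N is gam j + mp j + mm j = (\<Sum>i=1..n-1. int (a i) * alpha i j)"
begin

definition rg :: "nat \<Rightarrow> nat set" where "rg i = {1..aa n a i}"

lemma finite_rg [simp]: "finite (rg i)"
  by (simp add: rg_def)

text \<open>\<open>xx i r\<close> and \<open>yy i r\<close> are the support points of the delta
  functions in the images of E_i and F_i; \<open>\<kappa> i\<close> is the exponent of z in the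
  prefactor of the image of E_i.\<close>

definition xx :: "nat \<Rightarrow> nat \<Rightarrow> L" where "xx i r = q ^ i * w i r"
definition yy :: "nat \<Rightarrow> nat \<Rightarrow> L" where "yy i r = q ^ (i + 2) * w i r"
definition \<kappa> :: "nat \<Rightarrow> int" where "\<kappa> i = mp (i + 1) - mp i"
definition Wp :: "nat \<Rightarrow> nat \<Rightarrow> L" where "Wp i r = (\<Prod>t\<in>rg i - {r}. 1 - w i t / w i r)"
text \<open>The exponents \<open>gam s\<close> are absent since they equal 1 for \<open>is s = i \<ge> 1\<close>.\<close>

definition Zp :: "nat \<Rightarrow> nat \<Rightarrow> L" where
  "Zp i r = (\<Prod>s\<in>{s\<in>{1..N}. is s = i}. 1 - cst (vv powi (- int i) * cK (xs s)) / w i r)"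
text \<open>With w = \<open>w i r\<close>, these are the values of W_{i-1} at w/v and of W_{i+1} at
  v w. Below, \<open>eC\<close> and \<open>fC\<close> are the coefficients of D^{-1} and D without
  delta function and power of z, and \<open>EE\<close>, \<open>FF\<close> include the mode
  k.\<close>

definition Wm :: "nat \<Rightarrow> nat \<Rightarrow> L" where "Wm i r = (\<Prod>t\<in>rg (i - 1). 1 - q * w (i - 1) t / w i r)"
definition Wq :: "nat \<Rightarrow> nat \<Rightarrow> L" where "Wq i r = (\<Prod>t\<in>rg (i + 1). 1 - w (i + 1) t / (q * w i r))"
definition eC :: "nat \<Rightarrow> nat \<Rightarrow> L" where
  "eC i r = (\<Prod>t\<in>rg i. w i t) * (\<Prod>t\<in>rg (i - 1). inverse (u (i - 1) t)) * Zp i r * inverse (Wp i r) * Wm i r"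
definition fC :: "nat \<Rightarrow> nat \<Rightarrow> L" where
  "fC i r = - (inverse q * (\<Prod>t\<in>rg (i + 1). inverse (u (i + 1) t)) * Wq i r * inverse (Wp i r))"
definition EE :: "nat \<Rightarrow> nat \<Rightarrow> int \<Rightarrow> L" where "EE i r k = xx i r powi (k + \<kappa> i) * eC i r"
definition FF :: "nat \<Rightarrow> nat \<Rightarrow> int \<Rightarrow> L" where "FF i r k = yy i r powi k * fC i r"

lemma xx_neq_0 [simp]: "xx i r \<noteq> 0" and yy_neq_0 [simp]: "yy i r \<noteq> 0"
  by (simp_all add: xx_def yy_def)

lemma w_neq1': "t \<noteq> r \<Longrightarrow> 1 - w i t / w i r \<noteq> 0"
  using w_neq1[of i t i r 1] by simp

lemma Wp_neq_0: "Wp i r \<noteq> 0"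
  by (auto simp: Wp_def)

context
  fixes c :: K
  assumes c: "c \<noteq> 0"
begin

lemmas shc = sh_simps[OF c] sh_u[OF c] sh_w[OF c]

text \<open>E_i depends on the coordinates at nodes i and i - 1, F_i on those at i and i + 1. In
  this group of lemmas the prefactors contribute powers of c, and the one factor of a W-product that
  contains the shifted coordinate contributes a ratio.\<close>

lemma eC_same:
  assumes t: "t \<in> rg i" "t \<noteq> r" and i: "1 \<le> i"
  shows "sh i t c (eC i r) = (cst c)\<^sup>2 * (1 - w i t / w i r) / (1 - (cst c)\<^sup>2 * w i t / w i r) * eC i r"
proof -
  have ne: "i - Suc 0 \<noteq> i" "i \<noteq> i - Suc 0" using i by auto
  have 1: "sh i t c (\<Prod>t\<in>rg i. w i t) = (cst c)\<^sup>2 * (\<Prod>t\<in>rg i. w i t)"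
    unfolding shc using t by (subst prod_ratio[of "rg i" t _ "\<lambda>t. w i t"]) auto
  have 2: "sh i t c (\<Prod>t\<in>rg (i - 1). inverse (u (i - 1) t)) = (\<Prod>t\<in>rg (i - 1). inverse (u (i - 1) t))"
    using i by (simp add: shc ne)
  have 3: "sh i t c (Zp i r) = Zp i r" "sh i t c (Wm i r) = Wm i r"
    using i t unfolding Zp_def Wm_def shc by (auto intro!: prod.cong)
  have 4: "sh i t c (Wp i r) = (1 - (cst c)\<^sup>2 * w i t / w i r) / (1 - w i t / w i r) * Wp i r"
    unfolding Wp_def shc using t w_neq1'[OF t(2)]
    by (subst prod_ratio[of "rg i - {r}" t _ "\<lambda>t. 1 - w i t / w i r"]) auto
  show ?thesis unfolding eC_def shc(2) shc(9) 1 2 3 4 by (simp add: divide_inverse)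
qed

lemma eC_left:
  assumes t: "t \<in> rg (i - 1)" and i: "1 \<le> i"
  shows "sh (i - 1) t c (eC i r)
    = inverse (cst c) * (1 - (cst c)\<^sup>2 * q * w (i - 1) t / w i r) / (1 - q * w (i - 1) t / w i r) * eC i r"
proof -
  have ne: "i - Suc 0 \<noteq> i" "i \<noteq> i - Suc 0" using i by auto
  have 1: "sh (i - 1) t c (\<Prod>t\<in>rg i. w i t) = (\<Prod>t\<in>rg i. w i t)"
    "sh (i - 1) t c (Zp i r) = Zp i r" "sh (i - 1) t c (Wp i r) = Wp i r"
    using i ne unfolding Zp_def Wp_def shc by (auto intro!: prod.cong)
  have 2: "sh (i - 1) t c (\<Prod>t\<in>rg (i - 1). inverse (u (i - 1) t)) = inverse (cst c) * (\<Prod>t\<in>rg (i - 1). inverse (u (i - 1) t))"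
    unfolding shc using t by (subst prod_ratio[of "rg (i - 1)" t _ "\<lambda>t. inverse (u (i - 1) t)"]) auto
  have nz: "1 - q * w (i - 1) t / w i r \<noteq> 0" using w_neq1[of "i - 1" t i r vv] ne by auto
  have 3: "sh (i - 1) t c (Wm i r) = (1 - (cst c)\<^sup>2 * q * w (i - 1) t / w i r) / (1 - q * w (i - 1) t / w i r) * Wm i r"
    unfolding Wm_def shc using t nz ne
    by (subst prod_ratio[of "rg (i - 1)" t _ "\<lambda>t. 1 - q * w (i - 1) t / w i r"]) (auto simp: mult_ac)
  show ?thesis unfolding eC_def shc(2) shc(9) 1 2 3 by (simp add: divide_inverse)
qed

lemma eC_other: "j \<noteq> i \<Longrightarrow> j \<noteq> i - 1 \<Longrightarrow> sh j t c (eC i r) = eC i r"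
  by (auto simp: eC_def Zp_def Wp_def Wm_def shc intro!: arg_cong2[of _ _ _ _ "(*)"] prod.cong)

lemma fC_same:
  assumes t: "t \<in> rg i" "t \<noteq> r"
  shows "sh i t c (fC i r) = (1 - w i t / w i r) / (1 - (cst c)\<^sup>2 * w i t / w i r) * fC i r"
proof -
  have 2: "sh i t c (\<Prod>t\<in>rg (i + 1). inverse (u (i + 1) t)) = (\<Prod>t\<in>rg (i + 1). inverse (u (i + 1) t))"
    by (simp add: shc)
  have 3: "sh i t c (Wq i r) = Wq i r"
    using t unfolding Wq_def shc by (auto intro!: prod.cong)
  have 4: "sh i t c (Wp i r) = (1 - (cst c)\<^sup>2 * w i t / w i r) / (1 - w i t / w i r) * Wp i r"
    unfolding Wp_def shc using t w_neq1'[OF t(2)]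
    by (subst prod_ratio[of "rg i - {r}" t _ "\<lambda>t. 1 - w i t / w i r"]) auto
  show ?thesis unfolding fC_def shc(2) shc(5) shc(7) shc(9) 2 3 4 by (simp add: divide_inverse)
qed

lemma fC_right:
  assumes t: "t \<in> rg (i + 1)"
  shows "sh (i + 1) t c (fC i r)
    = inverse (cst c) * (1 - (cst c)\<^sup>2 * w (i + 1) t / (q * w i r)) / (1 - w (i + 1) t / (q * w i r)) * fC i r"
proof -
  have 1: "sh (i + 1) t c (Wp i r) = Wp i r" unfolding Wp_def shc by (auto intro!: prod.cong)
  have 2: "sh (i + 1) t c (\<Prod>t\<in>rg (i + 1). inverse (u (i + 1) t)) = inverse (cst c) * (\<Prod>t\<in>rg (i + 1). inverse (u (i + 1) t))"
    unfolding shc using t by (subst prod_ratio[of "rg (i + 1)" t _ "\<lambda>t. inverse (u (i + 1) t)"]) auto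
  have nz: "1 - w (i + 1) t / (q * w i r) \<noteq> 0"
    using w_neq[of i r "i + 1" t vv 1] by (simp add: field_simps)
  have 3: "sh (i + 1) t c (Wq i r) = (1 - (cst c)\<^sup>2 * w (i + 1) t / (q * w i r)) / (1 - w (i + 1) t / (q * w i r)) * Wq i r"
    unfolding Wq_def shc using t nz
    by (subst prod_ratio[of "rg (i + 1)" t _ "\<lambda>t. 1 - w (i + 1) t / (q * w i r)"]) auto
  show ?thesis unfolding fC_def shc(2) shc(5) shc(7) shc(9) 1 2 3 by (simp add: divide_inverse)
qed

lemma fC_other: "j \<noteq> i \<Longrightarrow> j \<noteq> i + 1 \<Longrightarrow> sh j t c (fC i r) = fC i r"
  by (auto simp: fC_def Wp_def Wq_def shc intro!: arg_cong2[of _ _ _ _ "(*)"] prod.cong)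

lemma sh_xx: "sh j t c (xx i r) = (if i = j \<and> r = t then (cst c)\<^sup>2 else 1) * xx i r"
  and sh_yy: "sh j t c (yy i r) = (if i = j \<and> r = t then (cst c)\<^sup>2 else 1) * yy i r"
  unfolding xx_def yy_def shc by auto

lemma sh_EE: "sh j t c (EE i r k) = ((if i = j \<and> r = t then (cst c)\<^sup>2 else 1) * xx i r) powi (k + \<kappa> i) * sh j t c (eC i r)"
  and sh_FF: "sh j t c (FF i r k) = ((if i = j \<and> r = t then (cst c)\<^sup>2 else 1) * yy i r) powi k * sh j t c (fC i r)"
  unfolding EE_def FF_def shc(2) shc(12) sh_xx sh_yy by (rule refl)+

end

end


lemma cst_iv: "cst (inverse vv) = inverse q"
  by (rule cst_inverse)

lemma iv_neq_0: "inverse vv \<noteq> 0"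
  by simp

text \<open>The shift ratios for c = 1/v and c = v with inner fractions cleared, in the shape in
  which they cancel against the structure constants of the relations.\<close>

lemma exchange_ratios:
  fixes A B v :: "'k::field"
  assumes "v \<noteq> 0" "B \<noteq> 0"
  shows "(inverse v)\<^sup>2 * (1 - A / B) / (1 - (inverse v)\<^sup>2 * A / B) = (B - A) / (v\<^sup>2 * B - A)"
    and "v\<^sup>2 * (1 - A / B) / (1 - v\<^sup>2 * A / B) = v\<^sup>2 * (B - A) / (B - v\<^sup>2 * A)"
    and "(1 - A / B) / (1 - (inverse v)\<^sup>2 * A / B) = v\<^sup>2 * (B - A) / (v\<^sup>2 * B - A)"
    and "(1 - A / B) / (1 - v\<^sup>2 * A / B) = (B - A) / (B - v\<^sup>2 * A)"
    and "inverse (inverse v) * (1 - (inverse v)\<^sup>2 * v * A / B) / (1 - v * A / B) = (v * B - A) / (B - v * A)"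
    and "inverse v * (1 - v\<^sup>2 * v * A / B) / (1 - v * A / B) = (B - v ^ 3 * A) / (v * B - v\<^sup>2 * A)"
    and "inverse (inverse v) * (1 - (inverse v)\<^sup>2 * A / (v * B)) / (1 - A / (v * B)) = (v ^ 3 * B - A) / (v\<^sup>2 * B - v * A)"
    and "inverse v * (1 - v\<^sup>2 * A / (v * B)) / (1 - A / (v * B)) = (B - v * A) / (v * B - A)"
proof -
  have i: "1 - A / B = (B - A) / B" "1 - (inverse v)\<^sup>2 * A / B = (v\<^sup>2 * B - A) / (v\<^sup>2 * B)"
    "1 - v\<^sup>2 * A / B = (B - v\<^sup>2 * A) / B" "1 - v * A / B = (B - v * A) / B"
    "1 - (inverse v)\<^sup>2 * v * A / B = (v * B - A) / (v * B)" "1 - v\<^sup>2 * v * A / B = (B - v ^ 3 * A) / B"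
    "1 - A / (v * B) = (v * B - A) / (v * B)" "1 - (inverse v)\<^sup>2 * A / (v * B) = (v ^ 3 * B - A) / (v ^ 3 * B)"
    "1 - v\<^sup>2 * A / (v * B) = (B - v * A) / B"
    using assms by (simp_all add: field_simps power2_eq_square power3_eq_cube)
  have d: "v * B - v\<^sup>2 * A = v * (B - v * A)" "v\<^sup>2 * B - v * A = v * (v * B - A)"
    by (simp_all add: algebra_simps power2_eq_square)
  show "(inverse v)\<^sup>2 * (1 - A / B) / (1 - (inverse v)\<^sup>2 * A / B) = (B - A) / (v\<^sup>2 * B - A)"
    "v\<^sup>2 * (1 - A / B) / (1 - v\<^sup>2 * A / B) = v\<^sup>2 * (B - A) / (B - v\<^sup>2 * A)"
    "(1 - A / B) / (1 - (inverse v)\<^sup>2 * A / B) = v\<^sup>2 * (B - A) / (v\<^sup>2 * B - A)"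
    "(1 - A / B) / (1 - v\<^sup>2 * A / B) = (B - A) / (B - v\<^sup>2 * A)"
    "inverse (inverse v) * (1 - (inverse v)\<^sup>2 * v * A / B) / (1 - v * A / B) = (v * B - A) / (B - v * A)"
    "inverse v * (1 - v\<^sup>2 * v * A / B) / (1 - v * A / B) = (B - v ^ 3 * A) / (v * B - v\<^sup>2 * A)"
    "inverse (inverse v) * (1 - (inverse v)\<^sup>2 * A / (v * B)) / (1 - A / (v * B)) = (v ^ 3 * B - A) / (v\<^sup>2 * B - v * A)"
    "inverse v * (1 - v\<^sup>2 * A / (v * B)) / (1 - A / (v * B)) = (B - v * A) / (v * B - A)"
    unfolding i d using assms by (simp_all add: divide_inverse power_inverse power2_eq_square power3_eq_cube)
      (simp_all add: field_simps)
qed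

lemma nz_ratio:
  assumes "(i, r) \<noteq> (j, t)" "d \<noteq> 0"
  shows "cst d * w i r - cst c * w j t \<noteq> 0"
  using w_neq[OF assms, of c] by simp

context gklo
begin

lemma eC_same':
  assumes "t \<in> rg i" "t \<noteq> r" "1 \<le> i"
  shows "sh i t (inverse vv) (eC i r) = (w i r - w i t) / (q\<^sup>2 * w i r - w i t) * eC i r"
    and "sh i t vv (eC i r) = q\<^sup>2 * (w i r - w i t) / (w i r - q\<^sup>2 * w i t) * eC i r"
  using eC_same[OF iv_neq_0 assms, unfolded cst_iv] eC_same[OF vv_neq_0 assms]
  by (simp_all only: exchange_ratios[OF q_facts(1) w_neq_0])

lemma fC_same':
  assumes "t \<in> rg i" "t \<noteq> r"
  shows "sh i t (inverse vv) (fC i r) = q\<^sup>2 * (w i r - w i t) / (q\<^sup>2 * w i r - w i t) * fC i r"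
    and "sh i t vv (fC i r) = (w i r - w i t) / (w i r - q\<^sup>2 * w i t) * fC i r"
  using fC_same[OF iv_neq_0 assms, unfolded cst_iv] fC_same[OF vv_neq_0 assms]
  by (simp_all only: exchange_ratios[OF q_facts(1) w_neq_0])

lemma eC_left':
  assumes "t \<in> rg i"
  shows "sh i t (inverse vv) (eC (i + 1) r) = (q * w (i + 1) r - w i t) / (w (i + 1) r - q * w i t) * eC (i + 1) r"
    and "sh i t vv (eC (i + 1) r) = (w (i + 1) r - q ^ 3 * w i t) / (q * w (i + 1) r - q\<^sup>2 * w i t) * eC (i + 1) r"
  using eC_left[OF iv_neq_0, of t "i + 1" r, unfolded cst_iv] eC_left[OF vv_neq_0, of t "i + 1" r] assms
  by (simp_all only: exchange_ratios[OF q_facts(1) w_neq_0] add_diff_cancel_right' le_add2)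

lemma fC_right':
  assumes "t \<in> rg (i + 1)"
  shows "sh (i + 1) t (inverse vv) (fC i r) = (q ^ 3 * w i r - w (i + 1) t) / (q\<^sup>2 * w i r - q * w (i + 1) t) * fC i r"
    and "sh (i + 1) t vv (fC i r) = (w i r - q * w (i + 1) t) / (q * w i r - w (i + 1) t) * fC i r"
  using fC_right[OF iv_neq_0 assms, unfolded cst_iv] fC_right[OF vv_neq_0 assms]
  by (simp_all only: exchange_ratios[OF q_facts(1) w_neq_0])

lemma EE_other: "c \<noteq> 0 \<Longrightarrow> j \<noteq> i \<Longrightarrow> j \<noteq> i - 1 \<Longrightarrow> sh j t c (EE i r k) = EE i r k"
  using sh_EE[of c j t i r k] eC_other[of c j i t r] by (simp add: EE_def)

lemma FF_other: "c \<noteq> 0 \<Longrightarrow> j \<noteq> i \<Longrightarrow> j \<noteq> i + 1 \<Longrightarrow> sh j t c (FF i r k) = FF i r k"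
  using sh_FF[of c j t i r k] fC_other[of c j i t r] by (simp add: FF_def)

lemma exchange_denominators_neq_0:
  shows "t \<noteq> r \<Longrightarrow> q\<^sup>2 * w i r - w i t \<noteq> 0" "t \<noteq> r \<Longrightarrow> w i r - q\<^sup>2 * w i t \<noteq> 0" "t \<noteq> r \<Longrightarrow> w i r - w i t \<noteq> 0"
    "w (i + 1) r - q * w i t \<noteq> 0" "q * w (i + 1) r - q\<^sup>2 * w i t \<noteq> 0" 
    "q\<^sup>2 * w i r - q * w (i + 1) t \<noteq> 0" "q * w i r - w (i + 1) t \<noteq> 0"
  using nz_ratio[of i r i t "vv\<^sup>2" 1] nz_ratio[of i r i t 1 "vv\<^sup>2"]
    nz_ratio[of "i + 1" r i t 1 vv] nz_ratio[of "i + 1" r i t vv "vv\<^sup>2"]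
    nz_ratio[of i r "i + 1" t "vv\<^sup>2" vv] nz_ratio[of i r "i + 1" t vv 1]
  by (simp_all add: cst_power)

text \<open>For neighbouring nodes only the shift at the lower node changes the other coefficient.
  At the same node with different indices both shifts act; with equal indices each side vanishes by
  itself.\<close>

lemma E_rel:
  assumes i: "1 \<le> i" "1 \<le> j" and r: "r \<in> rg i" "t \<in> rg j" and cf: "cU4 i j = (\<alpha>, \<beta>, \<gamma>, \<epsilon>)"
  defines "\<sigma> \<equiv> \<lambda>i r. sh i r (inverse vv)"
  shows "cst \<alpha> * (EE i r (k + 1) * \<sigma> i r (EE j t l)) + cst \<beta> * (EE i r k * \<sigma> i r (EE j t (l + 1)))
    = cst \<gamma> * (EE j t l * \<sigma> j t (EE i r (k + 1))) + cst \<epsilon> * (EE j t (l + 1) * \<sigma> j t (EE i r k))"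
proof -
  have v: "inverse vv \<noteq> 0" by simp
  consider (d) "i = j" "r = t" | (s) "i = j" "r \<noteq> t" | (p) "j = i + 1" | (m) "i = j + 1"
    | (o) "i \<noteq> j" "j \<noteq> i + 1" "i \<noteq> j + 1" by blast
  then show ?thesis
  proof cases
    case d
    from cf d have cf': "\<alpha> = inverse vv" "\<beta> = - vv" "\<gamma> = vv" "\<epsilon> = - inverse vv"
      by (auto simp: cU4_def)
    have "cst \<alpha> * (EE i r (k + 1) * \<sigma> i r (EE i r l)) + cst \<beta> * (EE i r k * \<sigma> i r (EE i r (l + 1)))
      = cst \<gamma> * (EE i r l * \<sigma> i r (EE i r (k + 1))) + cst \<epsilon> * (EE i r (l + 1) * \<sigma> i r (EE i r k))"
    \<comment> \<open>D^{-1} multiplies w^{1/2} by 1/v, hence the support point by the square of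
      1/v.\<close>
    proof (rule exchange_diagonal[where d = "(cst (inverse vv))\<^sup>2"])
      show "EE i r k = xx i r powi (k + \<kappa> i) * eC i r" for k by (simp add: EE_def)
      show "\<sigma> i r (EE i r l) = ((cst (inverse vv))\<^sup>2 * xx i r) powi (l + \<kappa> i) * \<sigma> i r (eC i r)" for l
        by (simp add: \<sigma>_def sh_EE[OF v])
      show "cst \<alpha> + cst \<beta> * (cst (inverse vv))\<^sup>2 = 0" "cst \<gamma> * (cst (inverse vv))\<^sup>2 + cst \<epsilon> = 0"
        unfolding cf' cst_minus cst_iv by (simp_all add: field_simps power2_eq_square)
    qed (simp_all add: cst_iv)
    then show ?thesis using d by simp
  next
    case s
    from cf s have cf': "\<alpha> = inverse vv" "\<beta> = - vv" "\<gamma> = vv" "\<epsilon> = - inverse vv"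
      by (auto simp: cU4_def)
    show ?thesis
    proof (rule exchange_off_diagonal)
      show "EE i r k = xx i r powi (k + \<kappa> i) * eC i r" for k by (simp add: EE_def)
      show "EE j t k = xx j t powi (k + \<kappa> j) * eC j t" for k by (simp add: EE_def)
      show "\<sigma> i r (EE j t l) = xx j t powi (l + \<kappa> j) * ((w i t - w i r) / (q\<^sup>2 * w i t - w i r) * eC j t)" for l
        using s r i by (simp add: \<sigma>_def sh_EE[OF v] eC_same'(1))
      show "\<sigma> j t (EE i r k) = xx i r powi (k + \<kappa> i) * ((w i r - w i t) / (q\<^sup>2 * w i r - w i t) * eC i r)" for k
        using s r i by (simp add: \<sigma>_def sh_EE[OF v] eC_same'(1))
      show "(cst \<alpha> * xx i r + cst \<beta> * xx j t) * ((w i t - w i r) / (q\<^sup>2 * w i t - w i r))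
        = (cst \<gamma> * xx i r + cst \<epsilon> * xx j t) * ((w i r - w i t) / (q\<^sup>2 * w i r - w i t))"
        using s exchange_denominators_neq_0(1)[of r t i] exchange_denominators_neq_0(1)[of t r i]
        unfolding cf' xx_def cst_minus cst_iv by (simp add: divide_simps) (simp add: algebra_simps power2_eq_square)
    qed simp_all
  next
    case p
    from cf p have cf': "\<alpha> = vv" "\<beta> = - inverse vv" "\<gamma> = 1" "\<epsilon> = -1"
      by (auto simp: cU4_def)
    show ?thesis
    proof (rule exchange_off_diagonal)
      show "EE i r k = xx i r powi (k + \<kappa> i) * eC i r" for k by (simp add: EE_def)
      show "EE j t k = xx j t powi (k + \<kappa> j) * eC j t" for k by (simp add: EE_def)
      show "\<sigma> i r (EE j t l) = xx j t powi (l + \<kappa> j) * ((q * w (i + 1) t - w i r) / (w (i + 1) t - q * w i r) * eC j t)" for l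
        using p r i eC_left'(1)[of r i t] by (simp add: \<sigma>_def sh_EE[OF v])
      show "\<sigma> j t (EE i r k) = xx i r powi (k + \<kappa> i) * (1 * eC i r)" for k
        using p by (simp add: \<sigma>_def sh_EE[OF v] eC_other[OF v])
      show "(cst \<alpha> * xx i r + cst \<beta> * xx j t) * ((q * w (i + 1) t - w i r) / (w (i + 1) t - q * w i r))
        = (cst \<gamma> * xx i r + cst \<epsilon> * xx j t) * 1"
        using p exchange_denominators_neq_0(4)[of i t r]
        unfolding cf' xx_def cst_minus cst_iv by (simp add: divide_simps) (simp add: algebra_simps power2_eq_square)
    qed simp_all
  next
    case m
    from cf m have cf': "\<alpha> = 1" "\<beta> = -1" "\<gamma> = inverse vv" "\<epsilon> = - vv"
      by (auto simp: cU4_def)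
    show ?thesis
    proof (rule exchange_off_diagonal)
      show "EE i r k = xx i r powi (k + \<kappa> i) * eC i r" for k by (simp add: EE_def)
      show "EE j t k = xx j t powi (k + \<kappa> j) * eC j t" for k by (simp add: EE_def)
      show "\<sigma> i r (EE j t l) = xx j t powi (l + \<kappa> j) * (1 * eC j t)" for l
        using m by (simp add: \<sigma>_def sh_EE[OF v] eC_other[OF v])
      show "\<sigma> j t (EE i r k) = xx i r powi (k + \<kappa> i) * ((q * w (j + 1) r - w j t) / (w (j + 1) r - q * w j t) * eC i r)" for k
        using m r i eC_left'(1)[of t j r] by (simp add: \<sigma>_def sh_EE[OF v])
      show "(cst \<alpha> * xx i r + cst \<beta> * xx j t) * 1
        = (cst \<gamma> * xx i r + cst \<epsilon> * xx j t) * ((q * w (j + 1) r - w j t) / (w (j + 1) r - q * w j t))"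
        using m exchange_denominators_neq_0(4)[of j r t]
        unfolding cf' xx_def cst_minus cst_iv by (simp add: divide_simps) (simp add: algebra_simps power2_eq_square)
    qed simp_all
  next
    case o
    from cf o have cf': "\<alpha> = 1" "\<beta> = 0" "\<gamma> = 1" "\<epsilon> = 0"
      by (auto simp: cU4_def)
    have "j \<noteq> i - 1" "i \<noteq> j - 1" using o i by auto
    then show ?thesis
      using o by (simp add: cf' \<sigma>_def EE_other)
  qed
qed

text \<open>Same case distinction as for E, except that between neighbours it is the shift at the
  higher node that acts.\<close>

lemma F_rel:
  assumes r: "r \<in> rg i" "t \<in> rg j" and cf: "cU5 i j = (\<alpha>, \<beta>, \<gamma>, \<epsilon>)"
  defines "\<sigma> \<equiv> \<lambda>i r. sh i r vv"
  shows "cst \<alpha> * (FF i r (k + 1) * \<sigma> i r (FF j t l)) + cst \<beta> * (FF i r k * \<sigma> i r (FF j t (l + 1)))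
    = cst \<gamma> * (FF j t l * \<sigma> j t (FF i r (k + 1))) + cst \<epsilon> * (FF j t (l + 1) * \<sigma> j t (FF i r k))"
proof -
  note v = vv_neq_0
  have F: "FF i r k = yy i r powi (k + 0) * fC i r" for i r k by (simp add: FF_def)
  consider (d) "i = j" "r = t" | (s) "i = j" "r \<noteq> t" | (p) "j = i + 1" | (m) "i = j + 1"
    | (o) "i \<noteq> j" "j \<noteq> i + 1" "i \<noteq> j + 1" by blast
  then show ?thesis
  proof cases
    case d
    from cf d have cf': "\<alpha> = vv" "\<beta> = - inverse vv" "\<gamma> = inverse vv" "\<epsilon> = - vv"
      by (auto simp: cU5_def)
    have "cst \<alpha> * (FF i r (k + 1) * \<sigma> i r (FF i r l)) + cst \<beta> * (FF i r k * \<sigma> i r (FF i r (l + 1)))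
      = cst \<gamma> * (FF i r l * \<sigma> i r (FF i r (k + 1))) + cst \<epsilon> * (FF i r (l + 1) * \<sigma> i r (FF i r k))"
    proof (rule exchange_diagonal[where d = "q\<^sup>2", OF F])
      show "\<sigma> i r (FF i r l) = (q\<^sup>2 * yy i r) powi (l + 0) * \<sigma> i r (fC i r)" for l
        by (simp add: \<sigma>_def sh_FF[OF v])
      show "cst \<alpha> + cst \<beta> * q\<^sup>2 = 0" "cst \<gamma> * q\<^sup>2 + cst \<epsilon> = 0"
        unfolding cf' cst_minus cst_iv by (simp_all add: field_simps power2_eq_square)
    qed (simp_all add: cst_iv)
    then show ?thesis using d by simp
  next
    case s
    from cf s have cf': "\<alpha> = vv" "\<beta> = - inverse vv" "\<gamma> = inverse vv" "\<epsilon> = - vv"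
      by (auto simp: cU5_def)
    show ?thesis
    proof (rule exchange_off_diagonal[OF F F])
      show "\<sigma> i r (FF j t l) = yy j t powi (l + 0) * ((w i t - w i r) / (w i t - q\<^sup>2 * w i r) * fC j t)" for l
        using s r by (simp add: \<sigma>_def sh_FF[OF v] fC_same'(2))
      show "\<sigma> j t (FF i r k) = yy i r powi (k + 0) * ((w i r - w i t) / (w i r - q\<^sup>2 * w i t) * fC i r)" for k
        using s r by (simp add: \<sigma>_def sh_FF[OF v] fC_same'(2))
      show "(cst \<alpha> * yy i r + cst \<beta> * yy j t) * ((w i t - w i r) / (w i t - q\<^sup>2 * w i r))
        = (cst \<gamma> * yy i r + cst \<epsilon> * yy j t) * ((w i r - w i t) / (w i r - q\<^sup>2 * w i t))"
        using s exchange_denominators_neq_0(2)[of r t i] exchange_denominators_neq_0(2)[of t r i]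
        unfolding cf' yy_def cst_minus cst_iv by (simp add: divide_simps) (simp add: algebra_simps power2_eq_square)
    qed simp_all
  next
    case p
    from cf p have cf': "\<alpha> = 1" "\<beta> = -1" "\<gamma> = vv" "\<epsilon> = - inverse vv"
      by (auto simp: cU5_def)
    show ?thesis
    proof (rule exchange_off_diagonal[OF F F])
      show "\<sigma> i r (FF j t l) = yy j t powi (l + 0) * (1 * fC j t)" for l
        using p by (simp add: \<sigma>_def sh_FF[OF v] fC_other[OF v])
      show "\<sigma> j t (FF i r k) = yy i r powi (k + 0) * ((w i r - q * w (i + 1) t) / (q * w i r - w (i + 1) t) * fC i r)" for k
        using p r fC_right'(2)[of t i r] by (simp add: \<sigma>_def sh_FF[OF v])
      show "(cst \<alpha> * yy i r + cst \<beta> * yy j t) * 1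
        = (cst \<gamma> * yy i r + cst \<epsilon> * yy j t) * ((w i r - q * w (i + 1) t) / (q * w i r - w (i + 1) t))"
        using p exchange_denominators_neq_0(7)[of i r t]
        unfolding cf' yy_def cst_minus cst_iv by (simp add: divide_simps) (simp add: algebra_simps power2_eq_square)
    qed simp_all
  next
    case m
    from cf m have cf': "\<alpha> = inverse vv" "\<beta> = - vv" "\<gamma> = 1" "\<epsilon> = -1"
      by (auto simp: cU5_def)
    show ?thesis
    proof (rule exchange_off_diagonal[OF F F])
      show "\<sigma> i r (FF j t l) = yy j t powi (l + 0) * ((w j t - q * w (j + 1) r) / (q * w j t - w (j + 1) r) * fC j t)" for l
        using m r fC_right'(2)[of r j t] by (simp add: \<sigma>_def sh_FF[OF v])
      show "\<sigma> j t (FF i r k) = yy i r powi (k + 0) * (1 * fC i r)" for k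
        using m by (simp add: \<sigma>_def sh_FF[OF v] fC_other[OF v])
      show "(cst \<alpha> * yy i r + cst \<beta> * yy j t) * ((w j t - q * w (j + 1) r) / (q * w j t - w (j + 1) r))
        = (cst \<gamma> * yy i r + cst \<epsilon> * yy j t) * 1"
        using m exchange_denominators_neq_0(7)[of j t r]
        unfolding cf' yy_def cst_minus cst_iv by (simp add: divide_simps) (simp add: algebra_simps power2_eq_square)
    qed simp_all
  next
    case o
    from cf o have cf': "\<alpha> = 1" "\<beta> = 0" "\<gamma> = 1" "\<epsilon> = 0"
      by (auto simp: cU5_def)
    then show ?thesis
      using o by (simp add: cf' \<sigma>_def FF_other)
  qed
qed

text \<open>What the commutator leaves at r after D^{-1} and D have cancelled. In E F the shift
  moves the support point of F from \<open>yy\<close> to \<open>xx\<close>; in F E it moves that of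
  E from \<open>xx\<close> to \<open>yy\<close>. So each product carries a single delta
  function.\<close>

definition CC :: "nat \<Rightarrow> nat \<Rightarrow> int \<Rightarrow> L" where
  "CC i r m = xx i r powi (m + \<kappa> i) * (eC i r * sh i r (inverse vv) (fC i r))
    - yy i r powi (m + \<kappa> i) * (fC i r * sh i r vv (eC i r))"

lemma EF_comm0:
  assumes "F' = yy j t powi l * (\<rho> * fC j t)" "E' = xx i r powi (k + \<kappa> i) * (\<rho>' * eC i r)" "\<rho> = \<rho>'"
  shows "EE i r k * F' - FF j t l * E' = 0"
  unfolding assms EE_def FF_def by (simp add: mult_ac)

text \<open>The shift in E_i acts on F_j, and the shift in F_j on E_i, only for i = j or i = j + 1.
  Off the diagonal the two ratios coincide after changing the sign of numerator and denominator, so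
  the products cancel.\<close>

lemma EF_rel:
  assumes i: "1 \<le> i" "1 \<le> j" and r: "r \<in> rg i" "t \<in> rg j"
  shows "EE i r k * sh i r (inverse vv) (FF j t l) - FF j t l * sh j t vv (EE i r k)
    = (if i = j \<and> r = t then CC i r (k + l) else 0)"
proof -
  note v = vv_neq_0
  have v': "inverse vv \<noteq> 0" by simp
  consider (d) "i = j" "r = t" | (s) "i = j" "r \<noteq> t" | (m) "i = j + 1" | (o) "i \<noteq> j" "i \<noteq> j + 1" by blast
  then show ?thesis
  proof cases
    case d
    have "(cst (inverse vv))\<^sup>2 * yy i r = xx i r" "q\<^sup>2 * xx i r = yy i r"
      by (simp_all add: cst_iv xx_def yy_def power2_eq_square) (simp_all add: field_simps)
    then have "sh i r (inverse vv) (FF i r l) = xx i r powi l * sh i r (inverse vv) (fC i r)"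
      "sh i r vv (EE i r k) = yy i r powi (k + \<kappa> i) * sh i r vv (eC i r)"
      using d by (simp_all add: sh_FF[OF v'] sh_EE[OF v])
    then have "EE i r k * sh i r (inverse vv) (FF i r l) - FF i r l * sh i r vv (EE i r k) = CC i r (k + l)"
      by (simp add: CC_def EE_def FF_def power_int_add algebra_simps)
    then show ?thesis using d by simp
  next
    case s
    have a: "sh i r (inverse vv) (FF j t l) = yy j t powi l * (q\<^sup>2 * (w i t - w i r) / (q\<^sup>2 * w i t - w i r) * fC j t)"
      "sh j t vv (EE i r k) = xx i r powi (k + \<kappa> i) * (q\<^sup>2 * (w i r - w i t) / (w i r - q\<^sup>2 * w i t) * eC i r)"
      using s r i by (simp_all add: sh_FF[OF v'] sh_EE[OF v] fC_same'(1) eC_same'(2))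
    have b: "q\<^sup>2 * (w i t - w i r) / (q\<^sup>2 * w i t - w i r) = q\<^sup>2 * (w i r - w i t) / (w i r - q\<^sup>2 * w i t)"
      by (subst minus_divide_divide[symmetric]) (simp only: minus_diff_eq mult_minus_right[symmetric])
    show ?thesis using s EF_comm0[OF a b] by simp
  next
    case m
    let ?\<rho> = "(q ^ 3 * w j t - w (j + 1) r) / (q\<^sup>2 * w j t - q * w (j + 1) r)"
    have a: "sh i r (inverse vv) (FF j t l) = yy j t powi l * (?\<rho> * fC j t)"
      using m r fC_right'(1)[of r j t] by (simp add: sh_FF[OF v'])
    have c: "sh j t vv (EE i r k)
       = xx i r powi (k + \<kappa> i) * ((w (j + 1) r - q ^ 3 * w j t) / (q * w (j + 1) r - q\<^sup>2 * w j t) * eC i r)"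
      using m r eC_left'(2)[of t j r] by (simp add: sh_EE[OF v])
    have b: "?\<rho> = (w (j + 1) r - q ^ 3 * w j t) / (q * w (j + 1) r - q\<^sup>2 * w j t)"
      by (subst minus_divide_divide[symmetric]) (simp only: minus_diff_eq)
    show ?thesis using m EF_comm0[OF a c b] by simp
  next
    case o
    then have "j \<noteq> i - 1" using i by auto
    then show ?thesis using o by (simp add: EE_other FF_other)
  qed
qed

lemma sh_mult: "c \<noteq> 0 \<Longrightarrow> sh i r c (x * y) = sh i r c x * sh i r c y"
  by (rule shc(2))

text \<open>For distinct r and r' the ratios reduce the claim to a rational identity in w_{i,r},
  w_{i,r'} and w_{j,t}. For r = r' the second shift meets an already shifted coordinate, which gives
  a different identity.\<close>

lemma E_serre:
  assumes i: "1 \<le> i" "1 \<le> j" and ij: "i = j + 1 \<or> j = i + 1" and r: "r \<in> rg i" "r' \<in> rg i" "t \<in> rg j"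
  defines "\<sigma> \<equiv> \<lambda>i r. sh i r (inverse vv)"
  shows "EE i r k1 * \<sigma> i r (EE i r' k2 * \<sigma> i r' (EE j t l)) + EE i r' k2 * \<sigma> i r' (EE i r k1 * \<sigma> i r (EE j t l))
     + EE j t l * \<sigma> j t (EE i r k1 * \<sigma> i r (EE i r' k2)) + EE j t l * \<sigma> j t (EE i r' k2 * \<sigma> i r' (EE i r k1))
    = (q + inverse q) * (EE i r k1 * \<sigma> i r (EE j t l * \<sigma> j t (EE i r' k2)) + EE i r' k2 * \<sigma> i r' (EE j t l * \<sigma> j t (EE i r k1)))"
proof -
  have v: "inverse vv \<noteq> 0" by simp
  note sm = sh_mult[OF v] and shv = sh_simps[OF v] sh_w[OF v]
  have ii: "i \<noteq> i + 1" "i \<noteq> j" using ij by auto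
  \<comment> \<open>Only one of p and Q is nontrivial, because E_i feels shifts at node i - 1 but
    not at node i + 1.\<close>
  define p where "p r = (if j = i + 1 then (q * w j t - w i r) / (w j t - q * w i r) else 1)" for r
  define Q where "Q r = (if j = i + 1 then 1 else (q * w i r - w j t) / (w i r - q * w j t))" for r
  have p: "\<sigma> i r (EE j t l) = p r * EE j t l" if "r \<in> rg i" for r l
    using that ij i eC_left'(1)[of r i t] ii
    by (auto simp: p_def \<sigma>_def sh_EE[OF v, unfolded EE_def] EE_def eC_other[OF v])
  have Q: "\<sigma> j t (EE i r k) = Q r * EE i r k" for r k
    using ij i r eC_left'(1)[of t j r] ii
    by (auto simp: Q_def \<sigma>_def sh_EE[OF v, unfolded EE_def] EE_def eC_other[OF v])
  show ?thesis
  proof (cases "r = r'")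
    case False
    define A where "A r r' = (w i r - w i r') / (q\<^sup>2 * w i r - w i r')" for r r'
    have A: "\<sigma> i r' (EE i r k) = A r r' * EE i r k" if "r \<in> rg i" "r' \<in> rg i" "r \<noteq> r'" for r r' k
      using that i by (simp add: A_def \<sigma>_def sh_EE[OF v, unfolded EE_def] EE_def eC_same'(1))
    note d = exchange_denominators_neq_0(1)[of r r' i] exchange_denominators_neq_0(1)[of r' r i]
    show ?thesis
    proof (rule serre_off_diagonal[where A = "A r r'" and A' = "A r' r" and p = "p r" and p' = "p r'" and Q = "Q r" and Q' = "Q r'"])
      show "(A r r' + A r' r) * (p r * p r' + Q r * Q r') = (q + inverse q) * (A r' r * p r * Q r' + A r r' * p r' * Q r)"
      proof (cases "j = i + 1")
        case True
        then show ?thesis using False d exchange_denominators_neq_0(4)[of i t r] exchange_denominators_neq_0(4)[of i t r'] ii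
          by (simp add: A_def p_def Q_def divide_simps) (simp add: algebra_simps power2_eq_square)
      next
        case j: False
        then have "i = j + 1" using ij by auto
        with j show ?thesis using False d exchange_denominators_neq_0(4)[of j r t] exchange_denominators_neq_0(4)[of j r' t] ii
          by (simp add: A_def p_def Q_def divide_simps) (simp add: algebra_simps power2_eq_square)
      qed
    qed (use A p Q False r ii in \<open>auto simp: \<sigma>_def sm shv A_def p_def Q_def\<close>)
  next
    case True
    \<comment> \<open>The ratios met by the second of two shifts at the same index.\<close>
    define p' where "p' = \<sigma> i r (p r)"
    define Q' where "Q' = \<sigma> i r (Q r)"
    have "p r * p' + Q r * Q' = (q + inverse q) * (p r * Q')"
    proof (cases "j = i + 1")
      case True
      have pq: "p' = (q * w j t - inverse (q\<^sup>2) * w i r) / (w j t - inverse q * w i r)" "Q' = 1"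
        using True by (simp_all add: p'_def Q'_def \<sigma>_def p_def Q_def shv cst_iv power2_eq_square)
      have nz: "w j t - inverse q * w i r \<noteq> 0"
        using nz_ratio[of j t i r 1 "inverse vv"] ii by (auto simp: cst_iv)
      show ?thesis unfolding pq using True nz exchange_denominators_neq_0(4)[of i t r]
        by (simp add: p_def Q_def divide_simps) (simp add: algebra_simps power2_eq_square)
    next
      case False
      then have j: "i = j + 1" using ij by auto
      have pq: "Q' = (inverse q * w i r - w j t) / (inverse (q\<^sup>2) * w i r - q * w j t)" "p' = 1"
        using j by (simp_all add: p'_def Q'_def \<sigma>_def p_def Q_def shv cst_iv power2_eq_square)
      have nz: "inverse (q\<^sup>2) * w i r - q * w j t \<noteq> 0"
        using nz_ratio[of i r j t "inverse (vv\<^sup>2)" vv] ii by (auto simp: cst_inverse cst_power)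
      show ?thesis unfolding pq using j nz exchange_denominators_neq_0(4)[of j r t]
        by (simp add: p_def Q_def divide_simps) (simp add: algebra_simps power2_eq_square)
    qed
    with True show ?thesis
      unfolding True[symmetric]
      by (intro serre_diagonal[where p = "p r" and p' = p' and Q = "Q r" and Q' = Q'])
        (use p Q r in \<open>simp_all add: \<sigma>_def sm p'_def Q'_def sh_commute[OF v v]\<close>)
  qed
qed

lemma F_serre:
  assumes i: "1 \<le> i" "1 \<le> j" and ij: "i = j + 1 \<or> j = i + 1" and r: "r \<in> rg i" "r' \<in> rg i" "t \<in> rg j"
  defines "\<sigma> \<equiv> \<lambda>i r. sh i r vv"
  shows "FF i r k1 * \<sigma> i r (FF i r' k2 * \<sigma> i r' (FF j t l)) + FF i r' k2 * \<sigma> i r' (FF i r k1 * \<sigma> i r (FF j t l))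
     + FF j t l * \<sigma> j t (FF i r k1 * \<sigma> i r (FF i r' k2)) + FF j t l * \<sigma> j t (FF i r' k2 * \<sigma> i r' (FF i r k1))
    = (q + inverse q) * (FF i r k1 * \<sigma> i r (FF j t l * \<sigma> j t (FF i r' k2)) + FF i r' k2 * \<sigma> i r' (FF j t l * \<sigma> j t (FF i r k1)))"
proof -
  note v = vv_neq_0
  note sm = sh_mult[OF v] and shv = sh_simps[OF v] sh_w[OF v]
  have ii: "i \<noteq> i + 1" "i \<noteq> j" using ij by auto
  \<comment> \<open>The roles are exchanged: F_i feels shifts at node i + 1 but not at node i -
    1.\<close>
  define p where "p r = (if j = i + 1 then 1 else (w j t - q * w i r) / (q * w j t - w i r))" for r
  define Q where "Q r = (if j = i + 1 then (w i r - q * w j t) / (q * w i r - w j t) else 1)" for r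
  have p: "\<sigma> i r (FF j t l) = p r * FF j t l" if "r \<in> rg i" for r l
    using that ij i fC_right'(2)[of r j t] ii
    by (auto simp: p_def \<sigma>_def sh_FF[OF v, unfolded FF_def] FF_def fC_other[OF v])
  have Q: "\<sigma> j t (FF i r k) = Q r * FF i r k" for r k
    using ij i r fC_right'(2)[of t i r] ii
    by (auto simp: Q_def \<sigma>_def sh_FF[OF v, unfolded FF_def] FF_def fC_other[OF v])
  show ?thesis
  proof (cases "r = r'")
    case False
    define A where "A r r' = (w i r - w i r') / (w i r - q\<^sup>2 * w i r')" for r r'
    have A: "\<sigma> i r' (FF i r k) = A r r' * FF i r k" if "r \<in> rg i" "r' \<in> rg i" "r \<noteq> r'" for r r' k
      using that i by (simp add: A_def \<sigma>_def sh_FF[OF v, unfolded FF_def] FF_def fC_same'(2))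
    note d = exchange_denominators_neq_0(2)[of r r' i] exchange_denominators_neq_0(2)[of r' r i]
    show ?thesis
    proof (rule serre_off_diagonal[where A = "A r r'" and A' = "A r' r" and p = "p r" and p' = "p r'" and Q = "Q r" and Q' = "Q r'"])
      show "(A r r' + A r' r) * (p r * p r' + Q r * Q r') = (q + inverse q) * (A r' r * p r * Q r' + A r r' * p r' * Q r)"
      proof (cases "j = i + 1")
        case True
        then show ?thesis using False d exchange_denominators_neq_0(7)[of i r t] exchange_denominators_neq_0(7)[of i r' t] ii
          by (simp add: A_def p_def Q_def divide_simps) (simp add: algebra_simps power2_eq_square)
      next
        case j: False
        then have "i = j + 1" using ij by auto
        with j show ?thesis using False d exchange_denominators_neq_0(7)[of j t r] exchange_denominators_neq_0(7)[of j t r'] ii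
          by (simp add: A_def p_def Q_def divide_simps) (simp add: algebra_simps power2_eq_square)
      qed
    qed (use A p Q False r ii in \<open>auto simp: \<sigma>_def sm shv A_def p_def Q_def\<close>)
  next
    case True
    define p' where "p' = \<sigma> i r (p r)"
    define Q' where "Q' = \<sigma> i r (Q r)"
    have "p r * p' + Q r * Q' = (q + inverse q) * (p r * Q')"
    proof (cases "j = i + 1")
      case True
      have pq: "Q' = (q\<^sup>2 * w i r - q * w j t) / (q ^ 3 * w i r - w j t)" "p' = 1"
        using True by (simp_all add: p'_def Q'_def \<sigma>_def p_def Q_def shv power2_eq_square power3_eq_cube)
      have nz: "q ^ 3 * w i r - w j t \<noteq> 0"
        using nz_ratio[of i r j t "vv ^ 3" 1] ii by (auto simp: cst_power)
      show ?thesis unfolding pq using True nz exchange_denominators_neq_0(7)[of i r t]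
        by (simp add: p_def Q_def divide_simps) (simp add: algebra_simps power2_eq_square power3_eq_cube)
    next
      case False
      then have j: "i = j + 1" using ij by auto
      have pq: "p' = (w j t - q ^ 3 * w i r) / (q * w j t - q\<^sup>2 * w i r)" "Q' = 1"
        using j by (simp_all add: p'_def Q'_def \<sigma>_def p_def Q_def shv power2_eq_square power3_eq_cube)
      have nz: "q * w j t - q\<^sup>2 * w i r \<noteq> 0"
        using nz_ratio[of j t i r vv "vv\<^sup>2"] ii by (auto simp: cst_power)
      show ?thesis unfolding pq using j nz exchange_denominators_neq_0(7)[of j t r]
        by (simp add: p_def Q_def divide_simps) (simp add: algebra_simps power2_eq_square power3_eq_cube)
    qed
    with True show ?thesis
      unfolding True[symmetric]
      by (intro serre_diagonal[where p = "p r" and p' = p' and Q = "Q r" and Q' = Q'])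
        (use p Q r in \<open>simp_all add: \<sigma>_def sm p'_def Q'_def sh_commute[OF v v]\<close>)
  qed
qed

end


section \<open>The images of the Cartan series\<close>

text \<open>Variant of \<open>prod_ratio\<close> that exhibits the common cofactor instead of
  dividing by the changed factor.\<close>

lemma prod_ratio_fls:
  fixes f g :: "'i \<Rightarrow> 'k::field"
  assumes "finite S" "t \<in> S" "\<And>x. x \<in> S \<Longrightarrow> x \<noteq> t \<Longrightarrow> g x = f x"
  shows "prod f S = f t * prod f (S - {t})" "prod g S = g t * prod f (S - {t})"
proof -
  have "prod g (S - {t}) = prod f (S - {t})" using assms by (intro prod.cong) auto
  then show "prod f S = f t * prod f (S - {t})" "prod g S = g t * prod f (S - {t})"
    using assms by (simp_all add: prod.remove[of S t])
qed

context gklo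
begin

definition pre :: "nat \<Rightarrow> L" where
  "pre i = (\<Prod>t\<in>rg i. inverse (u i t)) * (\<Prod>t\<in>rg (i - 1). u (i - 1) t)"
definition XS :: "complex set" where "XS = xs ` {1..N}"
definition PX :: "bool \<Rightarrow> nat \<Rightarrow> L fls" where
  "PX eps i = (\<Prod>x\<in>XS. fac eps (cst (cK x)) powi (- lamx N is xs gam x i))"
text \<open>The expansion of W_i(z / v^m).\<close>

definition PW :: "bool \<Rightarrow> nat \<Rightarrow> nat \<Rightarrow> L fls" where
  "PW eps i m = (\<Prod>t\<in>rg i. fac eps (q ^ m * w i t))"
definition Phi :: "bool \<Rightarrow> nat \<Rightarrow> L fls" where
  "Phi eps i = zshift eps (mp i) (fls_const (pre i) * PW eps i i * inverse (PW eps (i - 1) (i + 1)) * PX eps i)"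

lemma pre_neq_0 [simp]: "pre i \<noteq> 0"
  by (simp add: pre_def)

context
  fixes c :: K
  assumes c: "c \<noteq> 0"
begin

lemma shM: "fls_map (sh j t c) (F * G) = fls_map (sh j t c) F * fls_map (sh j t c) G"
  "fls_map (sh j t c) (fls_const x) = fls_const (sh j t c x)"
  "fls_map (sh j t c) (inverse F) = inverse (fls_map (sh j t c) F)"
  "fls_map (sh j t c) (prod H A) = (\<Prod>x\<in>A. fls_map (sh j t c) (H x))"
  "fls_map (sh j t c) (F powi k) = fls_map (sh j t c) F powi k"
  "fls_map (sh j t c) (zshift eps k F) = zshift eps k (fls_map (sh j t c) F)"
  "fls_map (sh j t c) (fac eps x) = fac eps (sh j t c x)"
  "zc eps (fls_map (sh j t c) F) m = sh j t c (zc eps F m)"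
  unfolding zc_def
  by (rule fls_map_mult fls_map_const fls_map_inverse fls_map_prod fls_map_power_int fls_map_zshift
      fls_map_fac fls_map_nth; rule shc(1)[OF c] shc(2)[OF c] shc(4)[OF c])+

lemma shM_PX: "fls_map (sh j t c) (PX eps i) = PX eps i"
  by (simp add: PX_def shM shc[OF c])

lemma shM_PW_other: "i \<noteq> j \<Longrightarrow> fls_map (sh j t c) (PW eps i m) = PW eps i m"
  by (simp add: PW_def shM shc[OF c])

lemma shM_PW_same:
  assumes "t \<in> rg i"
  obtains S where "PW eps i m = fac eps (q ^ m * w i t) * S" "S \<noteq> 0"
    "fls_map (sh i t c) (PW eps i m) = fac eps ((cst c)\<^sup>2 * (q ^ m * w i t)) * S"
proof -
  have "fls_map (sh i t c) (PW eps i m) = (\<Prod>s\<in>rg i. fac eps ((if s = t then (cst c)\<^sup>2 else 1) * (q ^ m * w i s)))"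
    by (simp add: PW_def shM shc[OF c] mult_ac)
  with prod_ratio_fls[of "rg i" t "\<lambda>s. fac eps ((if s = t then (cst c)\<^sup>2 else 1) * (q ^ m * w i s))"
      "\<lambda>s. fac eps (q ^ m * w i s)"] assms
  show ?thesis
    by (intro that[of "\<Prod>s\<in>rg i - {t}. fac eps (q ^ m * w i s)"]) (auto simp: PW_def fac_neq_0)
qed

lemma sh_pre_same: "t \<in> rg i \<Longrightarrow> 1 \<le> i \<Longrightarrow> sh i t c (pre i) = inverse (cst c) * pre i"
proof -
  assume t: "t \<in> rg i" and i: "1 \<le> i"
  have "sh i t c (\<Prod>t\<in>rg i. inverse (u i t)) = inverse (cst c) * (\<Prod>t\<in>rg i. inverse (u i t))"
    unfolding shc[OF c] using t by (subst prod_ratio[of "rg i" t _ "\<lambda>t. inverse (u i t)"]) auto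
  moreover have "sh i t c (\<Prod>t\<in>rg (i - 1). u (i - 1) t) = (\<Prod>t\<in>rg (i - 1). u (i - 1) t)"
    unfolding shc[OF c] using i by (intro prod.cong) auto
  ultimately show ?thesis by (simp add: pre_def shc(2)[OF c])
qed

lemma sh_pre_left: "t \<in> rg i \<Longrightarrow> sh i t c (pre (i + 1)) = cst c * pre (i + 1)"
proof -
  assume t: "t \<in> rg i"
  have "sh i t c (\<Prod>t\<in>rg i. u i t) = cst c * (\<Prod>t\<in>rg i. u i t)"
    unfolding shc[OF c] using t by (subst prod_ratio[of "rg i" t _ "\<lambda>t. u i t"]) auto
  moreover have "sh i t c (\<Prod>t\<in>rg (i + 1). inverse (u (i + 1) t)) = (\<Prod>t\<in>rg (i + 1). inverse (u (i + 1) t))"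
    unfolding shc[OF c] by (intro prod.cong) auto
  ultimately show ?thesis by (simp add: pre_def shc(2)[OF c])
qed

text \<open>Isolates the single factor 1 - v^i w/z of the numerator W_i that the shift moves, and
  the scalar 1/c produced by w^{-1/2}, in the form that \<open>phi_rel\<close> takes.\<close>

lemma Phi_same:
  assumes t: "t \<in> rg i" and i: "1 \<le> i"
  obtains S where "Phi eps i = zshift eps (mp i) (fac eps (xx i t) * S)"
    "fls_map (sh i t c) (Phi eps i) = zshift eps (mp i) (fls_const (inverse (cst c)) * (fac eps ((cst c)\<^sup>2 * xx i t) * S))"
proof -
  have ne: "i - 1 \<noteq> i" using i by simp
  from shM_PW_same[OF t] obtain S where S: "PW eps i i = fac eps (q ^ i * w i t) * S"
    "fls_map (sh i t c) (PW eps i i) = fac eps ((cst c)\<^sup>2 * (q ^ i * w i t)) * S" by metis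
  show ?thesis
  proof (rule that[of "fls_const (pre i) * S * inverse (PW eps (i - 1) (i + 1)) * PX eps i"])
    show "Phi eps i = zshift eps (mp i) (fac eps (xx i t) * (fls_const (pre i) * S * inverse (PW eps (i - 1) (i + 1)) * PX eps i))"
      by (simp add: Phi_def S xx_def mult_ac)
    have "fls_map (sh i t c) (Phi eps i) = zshift eps (mp i) (fls_const (inverse (cst c) * pre i) * (fac eps ((cst c)\<^sup>2 * (q ^ i * w i t)) * S)
         * inverse (PW eps (i - 1) (i + 1)) * PX eps i)"
      unfolding Phi_def shM S(2) shM_PX shM_PW_other[OF ne] sh_pre_same[OF t i] ..
    then show "fls_map (sh i t c) (Phi eps i) = zshift eps (mp i) (fls_const (inverse (cst c)) *
        (fac eps ((cst c)\<^sup>2 * xx i t) * (fls_const (pre i) * S * inverse (PW eps (i - 1) (i + 1)) * PX eps i)))"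
      by (simp add: xx_def mult_ac flip: fls_const_mult_const)
  qed
qed

text \<open>At the next node the moved factor belongs to the denominator of the Cartan
  series.\<close>

lemma Phi_left:
  assumes t: "t \<in> rg i"
  obtains S where "Phi eps (i + 1) = zshift eps (mp (i + 1)) (fac eps ((cst c)\<^sup>2 * yy i t) * S)"
    "fls_map (sh i t c) (Phi eps (i + 1)) = zshift eps (mp (i + 1)) (fls_const (cst c) * (fac eps (yy i t) * S))"
proof -
  have ne: "i + 1 \<noteq> i" by simp
  from shM_PW_same[OF t] obtain S where S: "PW eps i (i + 2) = fac eps (q ^ (i + 2) * w i t) * S" "S \<noteq> 0"
    "fls_map (sh i t c) (PW eps i (i + 2)) = fac eps ((cst c)\<^sup>2 * (q ^ (i + 2) * w i t)) * S" by metis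
  define R where "R = PW eps (i + 1) (i + 1) * PX eps (i + 1)"
  \<comment> \<open>The inverses of both the old and the new factor go into the common part, so that
    moving the denominator factor appears as replacing the numerator 1 - c^2 y/z by 1 - y/z.\<close>
  let ?S = "fls_const (pre (i + 1)) * R * inverse (fac eps (yy i t)) * inverse (fac eps ((cst c)\<^sup>2 * yy i t)) * inverse S"
  have P: "Phi eps (i + 1) = zshift eps (mp (i + 1)) (fls_const (pre (i + 1)) * R * inverse (PW eps i (i + 2)))"
    by (simp add: Phi_def R_def mult_ac)
  have aux: "k * p * R * inverse (B * S) = k * (Y * (p * R * inverse Y * inverse B * inverse S))"
    if "Y \<noteq> 0" for k p R B S Y :: "L fls"
    using that by simp
  show ?thesis
  proof (rule that[of ?S])
    show "Phi eps (i + 1) = zshift eps (mp (i + 1)) (fac eps ((cst c)\<^sup>2 * yy i t) * ?S)"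
      unfolding P S(1) yy_def by (simp add: fac_neq_0 mult_ac)
    have "fls_map (sh i t c) (Phi eps (i + 1)) = zshift eps (mp (i + 1)) (fls_const (cst c * pre (i + 1)) * R
        * inverse (fac eps ((cst c)\<^sup>2 * (q ^ (i + 2) * w i t)) * S))"
      unfolding P R_def shM S(3) shM_PX shM_PW_other[OF ne] sh_pre_left[OF t] ..
    then show "fls_map (sh i t c) (Phi eps (i + 1)) = zshift eps (mp (i + 1)) (fls_const (cst c) * (fac eps (yy i t) * ?S))"
      unfolding yy_def by (simp only: fls_const_mult_const[symmetric] aux[OF fac_neq_0, symmetric])
  qed
qed

lemma Phi_other:
  assumes "j \<noteq> i" "j \<noteq> i - 1"
  shows "fls_map (sh j t c) (Phi eps i) = Phi eps i"
proof -
  have "sh j t c (pre i) = pre i"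
    using assms unfolding pre_def shc[OF c] by (intro arg_cong2[of _ _ _ _ "(*)"] prod.cong) auto
  with assms show ?thesis by (simp add: Phi_def shM shM_PX shM_PW_other)
qed

end

lemma EE_Suc: "EE i r (l + 1) = xx i r * EE i r l" and FF_Suc: "FF i r (l + 1) = yy i r * FF i r l"
  using power_int_add_1'[of "xx i r" "l + \<kappa> i"] power_int_add_1'[of "yy i r" l]
  by (simp_all add: EE_def FF_def ac_simps)

text \<open>The Cartan element carries no shift, and raising the mode of E by one multiplies its
  coefficient by \<open>xx j t\<close>. Once that coefficient is factored out, the claim is
  \<open>phi_rel\<close> at the point \<open>xx j t\<close>.\<close>

lemma phiE_rel:
  fixes eps :: bool
  assumes i: "1 \<le> i" "1 \<le> j" and t: "t \<in> rg j" and cf: "cU2 i j = (\<alpha>, \<beta>, \<gamma>, \<epsilon>)"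
  defines "P \<equiv> \<lambda>k. zc eps (Phi eps i) k"
  shows "cst \<alpha> * (P (k + 1) * EE j t l) + cst \<beta> * (P k * EE j t (l + 1))
    = cst \<gamma> * (EE j t l * sh j t (inverse vv) (P (k + 1))) + cst \<epsilon> * (EE j t (l + 1) * sh j t (inverse vv) (P k))"
proof -
  note v = iv_neq_0
  define F' where "F' = fls_map (sh j t (inverse vv)) (Phi eps i)"
  have P': "sh j t (inverse vv) (P k) = zc eps F' k" for k by (simp add: P_def F'_def shM[OF v])
  have "cst \<alpha> * P (k + 1) + cst \<beta> * xx j t * P k = cst \<gamma> * zc eps F' (k + 1) + cst \<epsilon> * xx j t * zc eps F' k"
  proof -
    consider (s) "i = j" | (p) "i = j + 1" | (o) "i \<noteq> j" "i \<noteq> j + 1" by blast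
    then show ?thesis
    proof cases
      case s
      from Phi_same[OF v t i(2)] obtain S where S: "Phi eps i = zshift eps (mp i) (fac eps (xx j t) * S)"
        "F' = zshift eps (mp i) (fls_const q * (fac eps ((inverse q)\<^sup>2 * xx j t) * S))"
        unfolding F'_def s cst_iv inverse_inverse_eq by metis
      from cf s have cf': "\<alpha> = vv" "\<beta> = - inverse vv" "\<gamma> = 1" "\<epsilon> = -1" by (auto simp: cU2_def)
      show ?thesis unfolding P_def cf' cst_minus cst_iv
        by (intro phi_rel[OF S]) (simp_all add: xx_def yy_def power2_eq_square field_simps)
    next
      case p
      from Phi_left[OF v t] obtain S where S: "Phi eps i = zshift eps (mp i) (fac eps ((inverse q)\<^sup>2 * yy j t) * S)"
        "F' = zshift eps (mp i) (fls_const (inverse q) * (fac eps (yy j t) * S))"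
        unfolding F'_def p cst_iv by metis
      from cf p have cf': "\<alpha> = inverse vv" "\<beta> = - vv" "\<gamma> = 1" "\<epsilon> = -1" by (auto simp: cU2_def)
      show ?thesis unfolding P_def cf' cst_minus cst_iv
        by (intro phi_rel[OF S]) (simp_all add: xx_def yy_def power2_eq_square field_simps)
    next
      case o
      then have "F' = Phi eps i" using i unfolding F'_def by (intro Phi_other[OF v]) auto
      moreover from cf o have "\<alpha> = 1" "\<beta> = 0" "\<gamma> = 1" "\<epsilon> = 0" by (auto simp: cU2_def)
      ultimately show ?thesis by (simp add: P_def)
    qed
  qed
  then have "EE j t l * (cst \<alpha> * P (k + 1) + cst \<beta> * xx j t * P k) = EE j t l * (cst \<gamma> * zc eps F' (k + 1) + cst \<epsilon> * xx j t * zc eps F' k)"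
    by simp
  then show ?thesis unfolding P' EE_Suc by (simp add: algebra_simps)
qed

lemma phiF_rel:
  fixes eps :: bool
  assumes i: "1 \<le> i" "1 \<le> j" and t: "t \<in> rg j" and cf: "cU3 i j = (\<alpha>, \<beta>, \<gamma>, \<epsilon>)"
  defines "P \<equiv> \<lambda>k. zc eps (Phi eps i) k"
  shows "cst \<alpha> * (P (k + 1) * FF j t l) + cst \<beta> * (P k * FF j t (l + 1))
    = cst \<gamma> * (FF j t l * sh j t vv (P (k + 1))) + cst \<epsilon> * (FF j t (l + 1) * sh j t vv (P k))"
proof -
  note v = vv_neq_0
  define F' where "F' = fls_map (sh j t vv) (Phi eps i)"
  have P': "sh j t vv (P k) = zc eps F' k" for k by (simp add: P_def F'_def shM[OF v])
  have "cst \<alpha> * P (k + 1) + cst \<beta> * yy j t * P k = cst \<gamma> * zc eps F' (k + 1) + cst \<epsilon> * yy j t * zc eps F' k"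
  proof -
    consider (s) "i = j" | (p) "i = j + 1" | (o) "i \<noteq> j" "i \<noteq> j + 1" by blast
    then show ?thesis
    proof cases
      case s
      from Phi_same[OF v t i(2)] obtain S where S: "Phi eps i = zshift eps (mp i) (fac eps (xx j t) * S)"
        "F' = zshift eps (mp i) (fls_const (inverse q) * (fac eps (q\<^sup>2 * xx j t) * S))"
        unfolding F'_def s by metis
      from cf s have cf': "\<alpha> = 1" "\<beta> = -1" "\<gamma> = vv" "\<epsilon> = - inverse vv" by (auto simp: cU3_def)
      show ?thesis unfolding P_def cf' cst_minus cst_iv
        by (intro phi_rel[OF S]) (simp_all add: xx_def yy_def power2_eq_square field_simps)
    next
      case p
      from Phi_left[OF v t] obtain S where S: "Phi eps i = zshift eps (mp i) (fac eps (q\<^sup>2 * yy j t) * S)"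
        "F' = zshift eps (mp i) (fls_const q * (fac eps (yy j t) * S))"
        unfolding F'_def p by metis
      from cf p have cf': "\<alpha> = 1" "\<beta> = -1" "\<gamma> = inverse vv" "\<epsilon> = - vv" by (auto simp: cU3_def)
      show ?thesis unfolding P_def cf' cst_minus cst_iv
        by (intro phi_rel[OF S]) (simp_all add: xx_def yy_def power2_eq_square field_simps)
    next
      case o
      then have "F' = Phi eps i" using i unfolding F'_def by (intro Phi_other[OF v]) auto
      moreover from cf o have "\<alpha> = 1" "\<beta> = 0" "\<gamma> = 1" "\<epsilon> = 0" by (auto simp: cU3_def)
      ultimately show ?thesis by (simp add: P_def)
    qed
  qed
  then have "FF j t l * (cst \<alpha> * P (k + 1) + cst \<beta> * yy j t * P k) = FF j t l * (cst \<gamma> * zc eps F' (k + 1) + cst \<epsilon> * yy j t * zc eps F' k)"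
    by simp
  then show ?thesis unfolding P' FF_Suc by (simp add: algebra_simps)
qed

section \<open>The Cartan quotient and its residues\<close>

definition Zs :: "nat \<Rightarrow> nat set" where "Zs i = {s\<in>{1..N}. is s = i}"

lemma Zp_Zs: "Zp i r = (\<Prod>s\<in>Zs i. 1 - cst (vv powi (- int i) * cK (xs s)) / w i r)"
  by (simp only: Zp_def Zs_def)

lemma PX_neq_0 [simp]: "PX eps i \<noteq> 0"
  by (simp add: PX_def XS_def fac_neq_0)

text \<open>For i \<ge> 1 the coroot alpha_i^vee takes the value 1 on varpi_{i_s} if i_s = i and 0
  otherwise. So the points with i_s = 0, the only ones that may have negative sign, cancel from the
  quotient.\<close>

lemma PX_quotient:
  assumes "1 \<le> i"
  shows "inverse (PX eps i) * PX eps (i + 1) = (\<Prod>s\<in>Zs i. fac eps (cst (cK (xs s))))"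
proof -
  have "lamx N is xs gam x i - lamx N is xs gam x (i + 1) = int (card {s\<in>Zs i. xs s = x})" for x
  proof -
    have "lamx N is xs gam x i - lamx N is xs gam x (i + 1)
        = (\<Sum>s\<in>{s\<in>{1..N}. xs s = x}. if is s = i then 1 else 0)"
      unfolding lamx_def sum_subtractf[symmetric] using div assms
      by (intro sum.cong) (auto simp: varpi_def)
    also have "\<dots> = int (card ({s\<in>{1..N}. xs s = x} \<inter> {s. is s = i}))" by (simp add: sum.If_cases)
    also have "{s\<in>{1..N}. xs s = x} \<inter> {s. is s = i} = {s\<in>Zs i. xs s = x}" by (auto simp: Zs_def)
    finally show ?thesis .
  qed
  then have *: "- lamx N is xs gam x (i + 1) = - lamx N is xs gam x i + int (card {s\<in>Zs i. xs s = x})" for x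
    by (metis add.commute diff_add_cancel diff_minus_eq_add minus_diff_eq uminus_add_conv_diff)
  have "PX eps (i + 1) = PX eps i * (\<Prod>x\<in>XS. fac eps (cst (cK x)) ^ card {s\<in>Zs i. xs s = x})"
    unfolding PX_def prod.distrib[symmetric] *
    by (intro prod.cong refl) (subst power_int_add, simp_all add: fac_neq_0)
  also have "(\<Prod>x\<in>XS. fac eps (cst (cK x)) ^ card {s\<in>Zs i. xs s = x})
     = (\<Prod>x\<in>XS. \<Prod>s\<in>{s\<in>Zs i. xs s = x}. fac eps (cst (cK (xs s))))"
    by (intro prod.cong refl) simp
  also have "\<dots> = (\<Prod>s\<in>Zs i. fac eps (cst (cK (xs s))))"
    by (rule prod.group) (auto simp: Zs_def XS_def)
  finally show ?thesis by simp
qed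

definition GG :: "bool \<Rightarrow> nat \<Rightarrow> L fls" where "GG eps i = inverse (Phi eps i) * Phi eps (i + 1)"

text \<open>Displays the Cartan quotient as a power of z times a rational function with simple zeros
  and poles listed by disjoint sums; the poles are the support points \<open>xx\<close> of E_i and
  \<open>yy\<close> of F_i. The factors need not be in lowest terms.\<close>

lemma GG_eq:
  fixes eps :: bool
  assumes i: "1 \<le> i"
  defines "b \<equiv> case_sum (\<lambda>t. q ^ (i + 1) * w (i - 1) t) (case_sum (\<lambda>t. q ^ (i + 1) * w (i + 1) t) (\<lambda>s. cst (cK (xs s))))"
    and "c \<equiv> case_sum (xx i) (yy i)"
  shows "GG eps i = zshift eps (\<kappa> i) (fls_const (inverse (pre i) * pre (i + 1))
     * (\<Prod>j\<in>rg (i - 1) <+> (rg (i + 1) <+> Zs i). fac eps (b j)) * inverse (\<Prod>p\<in>rg i <+> rg i. fac eps (c p)))"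
proof -
  have f: "finite (Zs i)" by (simp add: Zs_def)
  have J: "(\<Prod>j\<in>rg (i - 1) <+> (rg (i + 1) <+> Zs i). fac eps (b j))
     = PW eps (i - 1) (i + 1) * (PW eps (i + 1) (i + 1) * (inverse (PX eps i) * PX eps (i + 1)))"
    unfolding PX_quotient[OF i] using f by (simp add: prod.Plus b_def PW_def)
  have I: "(\<Prod>p\<in>rg i <+> rg i. fac eps (c p)) = PW eps i i * PW eps i (i + 2)"
    by (simp add: prod.Plus c_def PW_def xx_def yy_def)
  have "GG eps i = zshift eps (- mp i + mp (i + 1)) (inverse (fls_const (pre i) * PW eps i i * inverse (PW eps (i - 1) (i + 1)) * PX eps i)
      * (fls_const (pre (i + 1)) * PW eps (i + 1) (i + 1) * inverse (PW eps i (i + 2)) * PX eps (i + 1)))"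
    by (simp add: GG_def Phi_def zshift_inverse zshift_mult)
  also have "inverse (fls_const (pre i) * PW eps i i * inverse (PW eps (i - 1) (i + 1)) * PX eps i)
      * (fls_const (pre (i + 1)) * PW eps (i + 1) (i + 1) * inverse (PW eps i (i + 2)) * PX eps (i + 1))
     = (inverse (fls_const (pre i)) * fls_const (pre (i + 1))) * (\<Prod>j\<in>rg (i - 1) <+> (rg (i + 1) <+> Zs i). fac eps (b j))
        * inverse (\<Prod>p\<in>rg i <+> rg i. fac eps (c p))"
    unfolding I J by (simp add: mult_ac)
  finally show ?thesis by (simp add: \<kappa>_def fls_inverse_const flip: fls_const_mult_const)
qed

text \<open>The difference of the two expansions is the sum of the deltas at the poles, weighted by
  residues. The residues at \<open>xx i r\<close> reproduce the summands of E F, those at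
  \<open>yy i r\<close> the summands of F E.\<close>

lemma U1_residues:
  assumes i: "1 \<le> i"
  shows "cst (vv - inverse vv) * (zc True (GG True i) m - zc False (GG False i) m) = (\<Sum>r\<in>rg i. CC i r m)"
proof -
  define b where "b = case_sum (\<lambda>t. q ^ (i + 1) * w (i - 1) t) (case_sum (\<lambda>t. q ^ (i + 1) * w (i + 1) t) (\<lambda>s. cst (cK (xs s))))"
  define c where "c = case_sum (xx i) (yy i)"
  define A where "A = inverse (pre i) * pre (i + 1)"
  let ?J = "rg (i - 1) <+> (rg (i + 1) <+> Zs i)" and ?I = "rg i <+> rg i"
  define R where "R p = A * (\<Prod>j\<in>?J. 1 - b j / c p) / (\<Prod>p'\<in>?I - {p}. 1 - c p' / c p)" for p
  have f: "finite (Zs i)" by (simp add: Zs_def)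
  \<comment> \<open>The two families of poles meet only if w_{i,r} = v^2 w_{i,t}; this is excluded
    by independence of the variables for r \<noteq> t and by v^2 \<noteq> 1 for r = t.\<close>
  have xy: "xx i r \<noteq> yy i t" for r t
  proof
    assume "xx i r = yy i t"
    then have e: "w i r = q\<^sup>2 * w i t" by (simp add: xx_def yy_def power2_eq_square)
    then show False using exchange_denominators_neq_0(2)[of t r i] by (cases "r = t") auto
  qed
  have inj: "inj_on c ?I" using xy xy[symmetric]
    by (auto simp: inj_on_def c_def) (simp_all add: xx_def yy_def)
  have c0: "c p \<noteq> 0" for p by (cases p) (simp_all add: c_def)
  have "zc True (GG True i) m - zc False (GG False i) m = (\<Sum>p\<in>?I. c p powi (m + \<kappa> i) * R p)"
    unfolding GG_eq[OF i] zc_zshift R_def A_def[symmetric] b_def[symmetric] c_def[symmetric]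
    by (rule expansions_difference) (use inj c0 f in auto)
  also have "\<dots> = (\<Sum>r\<in>rg i. xx i r powi (m + \<kappa> i) * R (Inl r)) + (\<Sum>r\<in>rg i. yy i r powi (m + \<kappa> i) * R (Inr r))"
    by (simp add: sum.Plus c_def)
  finally have 1: "cst (vv - inverse vv) * (zc True (GG True i) m - zc False (GG False i) m)
     = (\<Sum>r\<in>rg i. xx i r powi (m + \<kappa> i) * ((q - inverse q) * R (Inl r)) + yy i r powi (m + \<kappa> i) * ((q - inverse q) * R (Inr r)))"
    by (simp add: cst_diff cst_iv sum.distrib distrib_left sum_distrib_left mult_ac)
  have uw: "(\<Prod>t\<in>rg i. u i t) * (\<Prod>t\<in>rg i. u i t) = (\<Prod>t\<in>rg i. w i t)"
    by (simp add: w_def power2_eq_square prod.distrib)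
  have A: "A = (\<Prod>t\<in>rg i. w i t) * (\<Prod>t\<in>rg (i - 1). inverse (u (i - 1) t)) * (\<Prod>t\<in>rg (i + 1). inverse (u (i + 1) t))"
    unfolding A_def pre_def uw[symmetric] by (simp add: prod_inversef[symmetric] mult_ac)
  \<comment> \<open>The factor v^i of the pole turns x into v^{-i} x, as in Z_i.\<close>
  have vZ: "cst (cK x) / (q ^ i * z) = cst (vv powi (- int i) * cK x) / z" for x z
    by (simp add: cst_mult cst_power_int power_int_minus divide_inverse cst_inverse cst_power)
  have R1: "(q - inverse q) * R (Inl r) = eC i r * sh i r (inverse vv) (fC i r)" if r: "r \<in> rg i" for r
  proof -
    have N: "(\<Prod>j\<in>?J. 1 - b j / c (Inl r)) = Wm i r * ((\<Prod>t\<in>rg (i + 1). 1 - q * w (i + 1) t / w i r) * Zp i r)"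
      using f by (simp add: prod.Plus b_def c_def Wm_def xx_def Zp_Zs vZ)
    have "?I - {Inl r} = (rg i - {r}) <+> rg i" by auto
    then have D: "(\<Prod>p'\<in>?I - {Inl r}. 1 - c p' / c (Inl r)) = Wp i r * (\<Prod>t\<in>rg i. 1 - q\<^sup>2 * w i t / w i r)"
      by (simp add: prod.Plus c_def Wp_def xx_def yy_def power2_eq_square mult.assoc)
    \<comment> \<open>The factor with t = r comes from the companion pole \<open>yy i r\<close>; it
      is constant and is not part of the shifted \<open>Wp\<close>.\<close>
    have D2: "(\<Prod>t\<in>rg i. 1 - q\<^sup>2 * w i t / w i r) = (1 - q\<^sup>2) * (\<Prod>t\<in>rg i - {r}. 1 - q\<^sup>2 * w i t / w i r)"
      using r by (simp add: prod.remove[of "rg i" r])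
    have s: "sh i r (inverse vv) (Wp i r) = (\<Prod>t\<in>rg i - {r}. 1 - q\<^sup>2 * w i t / w i r)"
      unfolding Wp_def shc[OF iv_neq_0] cst_iv by (intro prod.cong) (auto simp: power_inverse field_simps)
    have s': "sh i r (inverse vv) (Wq i r) = (\<Prod>t\<in>rg (i + 1). 1 - q * w (i + 1) t / w i r)"
      unfolding Wq_def shc[OF iv_neq_0] cst_iv by (intro prod.cong) (auto simp: power2_eq_square field_simps)
    have s'': "sh i r (inverse vv) (\<Prod>t\<in>rg (i + 1). inverse (u (i + 1) t)) = (\<Prod>t\<in>rg (i + 1). inverse (u (i + 1) t))"
      unfolding shc[OF iv_neq_0] by (intro prod.cong) auto
    \<comment> \<open>That constant, combined with v - 1/v from (U1), yields the scalar -1/v in the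
      image of F_i.\<close>
    have q: "(q - inverse q) * inverse (1 - q\<^sup>2) = - inverse q"
      using q_facts by (simp add: field_simps power2_eq_square)
    have "(q - inverse q) * R (Inl r) = ((q - inverse q) * inverse (1 - q\<^sup>2)) * A * Wm i r
        * (\<Prod>t\<in>rg (i + 1). 1 - q * w (i + 1) t / w i r) * Zp i r * inverse (Wp i r)
        * inverse (\<Prod>t\<in>rg i - {r}. 1 - q\<^sup>2 * w i t / w i r)"
      unfolding R_def N D D2 by (simp add: divide_inverse mult_ac)
    also have "\<dots> = eC i r * sh i r (inverse vv) (fC i r)"
      unfolding q eC_def fC_def A shc(5)[OF iv_neq_0] shc(2)[OF iv_neq_0] shc(7)[OF iv_neq_0] shc(9)[OF iv_neq_0] s s' s''
      by (simp add: mult_ac)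
    finally show ?thesis .
  qed
  have R2: "(q - inverse q) * R (Inr r) = - (fC i r * sh i r vv (eC i r))" if r: "r \<in> rg i" for r
  proof -
    have z: "cst (cK x) / yy i r = cst (vv powi (- int i) * cK x) / (q\<^sup>2 * w i r)"
      "q ^ (i + 1) * z / yy i r = z / (q * w i r)" for x z
      using vZ[of x "q\<^sup>2 * w i r"] by (simp_all add: yy_def power2_eq_square mult_ac)
    have N: "(\<Prod>j\<in>?J. 1 - b j / c (Inr r)) = (\<Prod>t\<in>rg (i - 1). 1 - w (i - 1) t / (q * w i r)) * (Wq i r
         * (\<Prod>s\<in>Zs i. 1 - cst (vv powi (- int i) * cK (xs s)) / (q\<^sup>2 * w i r)))"
      using f by (simp only: prod.Plus finite_rg finite_Plus b_def c_def sum.case z Wq_def o_def)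
    have "?I - {Inr r} = rg i <+> (rg i - {r})" by auto
    then have D: "(\<Prod>p'\<in>?I - {Inr r}. 1 - c p' / c (Inr r)) = (\<Prod>t\<in>rg i. 1 - w i t / (q\<^sup>2 * w i r)) * Wp i r"
      by (simp add: prod.Plus c_def Wp_def xx_def yy_def power2_eq_square mult.assoc)
    have D2: "(\<Prod>t\<in>rg i. 1 - w i t / (q\<^sup>2 * w i r)) = (1 - inverse (q\<^sup>2)) * (\<Prod>t\<in>rg i - {r}. 1 - w i t / (q\<^sup>2 * w i r))"
      using r by (simp add: prod.remove[of "rg i" r] divide_inverse)
    have s: "sh i r vv (Wp i r) = (\<Prod>t\<in>rg i - {r}. 1 - w i t / (q\<^sup>2 * w i r))"
      unfolding Wp_def shc[OF vv_neq_0] by (intro prod.cong) auto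
    have s': "sh i r vv (Wm i r) = (\<Prod>t\<in>rg (i - 1). 1 - w (i - 1) t / (q * w i r))"
      unfolding Wm_def shc[OF vv_neq_0] using i by (intro prod.cong) (auto simp: power2_eq_square)
    have s'': "sh i r vv (\<Prod>t\<in>rg (i - 1). inverse (u (i - 1) t)) = (\<Prod>t\<in>rg (i - 1). inverse (u (i - 1) t))"
      unfolding shc[OF vv_neq_0] using i by (intro prod.cong) auto
    have s3: "sh i r vv (Zp i r) = (\<Prod>s\<in>Zs i. 1 - cst (vv powi (- int i) * cK (xs s)) / (q\<^sup>2 * w i r))"
      unfolding Zp_Zs shc[OF vv_neq_0] by (intro prod.cong) auto
    have s4: "sh i r vv (\<Prod>t\<in>rg i. w i t) = q\<^sup>2 * (\<Prod>t\<in>rg i. w i t)"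
      unfolding shc[OF vv_neq_0] using r by (subst prod_ratio[of "rg i" r _ "\<lambda>t. w i t"]) auto
    have nz: "1 - inverse (q\<^sup>2) \<noteq> 0"
    proof
      assume "1 - inverse (q\<^sup>2) = 0"
      then have "inverse (q\<^sup>2) = 1" by simp
      then show False using q_facts(2) by (simp only: inverse_eq_1_iff)
    qed
    \<comment> \<open>Here the combined constant is 1/v, the scalar of F_i up to sign, times the v^2
      by which D_{i,r} scales the product of the w_{i,t}.\<close>
    then have q: "(q - inverse q) * inverse (1 - inverse (q\<^sup>2)) = inverse q * q\<^sup>2"
      by (simp add: field_simps power2_eq_square)
    have "(q - inverse q) * R (Inr r) = ((q - inverse q) * inverse (1 - inverse (q\<^sup>2))) * A
        * (\<Prod>t\<in>rg (i - 1). 1 - w (i - 1) t / (q * w i r)) * Wq i r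
         * (\<Prod>s\<in>Zs i. 1 - cst (vv powi (- int i) * cK (xs s)) / (q\<^sup>2 * w i r)) * inverse (Wp i r)
        * inverse (\<Prod>t\<in>rg i - {r}. 1 - w i t / (q\<^sup>2 * w i r))"
      unfolding R_def N D D2 by (simp add: divide_inverse mult_ac)
    also have "\<dots> = - (fC i r * sh i r vv (eC i r))"
      unfolding q eC_def fC_def A shc(2)[OF vv_neq_0] shc(9)[OF vv_neq_0] s s' s'' s3 s4
      by (simp add: mult_ac)
    finally show ?thesis .
  qed
  show ?thesis unfolding 1 by (intro sum.cong refl) (simp add: R1 R2 CC_def)
qed

end


section \<open>The target algebra\<close>

text \<open>The unit of R is embedded with zero in every other component, so e b = b forces b to
  vanish in those components.\<close>

lemma emb_surj:
  assumes "ring R" "emb R (one R) * b = b"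
  shows "b \<in> emb R ` carrier R"
proof -
  have c: "component R b \<in> carrier R"
    using assms(1) Rep_ringprod[of b] by (auto simp: component_def split: if_splits)
  have "Rep_ringprod b S = (if S = R then component R b else if ring S then zero S else undefined)" for S
  proof (cases "S = R \<or> \<not> ring S")
    case True
    then show ?thesis using Rep_ringprod[of b] assms(1) by (auto simp: component_def)
  next
    case False
    have "Rep_ringprod b S = Rep_ringprod (emb R (one R) * b) S" using assms(2) by simp
    also have "\<dots> = zero S \<otimes>\<^bsub>S\<^esub> Rep_ringprod b S"
      using False assms(1) by (simp add: times_ringprod.rep_eq Rep_emb ring.ring_simprules(6))
    also have "\<dots> = zero S"
      using False Rep_ringprod[of b] by (auto simp: ring.ring_simprules(24))
    finally show ?thesis using False by simp
  qed
  then have "b = emb R (component R b)"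
    using assms(1) c by (simp add: Rep_ringprod_inject[symmetric] Rep_emb fun_eq_iff)
  then show ?thesis using c by blast
qed

lemma fscal_conv: "fscal c f = fmul (sc c) f"
  by (simp add: fmul_sc_left)

lemma sc_add: "sc (c + d) = fadd (sc c) (sc d)" and sc_mult: "sc (c * d) = fmul (sc c) (sc d)"
  unfolding fmul_sc_left by (auto simp: sc_def fadd_def fscal_def)

lemma wsq_FA: "AW i r \<in> G \<Longrightarrow> wsq i r \<in> carrier (FA G)"
  by (simp add: wsq_def fmul_FA)

lemma AR_FA: "AR n a \<subseteq> carrier (FA (AG n a))"
  unfolding AR_def
  by (intro Un_least; auto intro!: fsub_FA fmul_FA fscal_FA wsq_FA simp: AG_def)

lemma AR_mem:
  shows "(i, r) \<in> AI n a \<Longrightarrow> (j, t) \<in> AI n a \<Longrightarrow> fsub (fmul (gen (AD i r)) (gen (AW j t)))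
      (fscal (if i = j \<and> r = t then vv else 1) (fmul (gen (AW j t)) (gen (AD i r)))) \<in> AR n a"
    and "(i, r) \<in> AI n a \<Longrightarrow> (j, t) \<in> AI n a \<Longrightarrow>
      fsub (fmul (gen (AD i r)) (gen (AD j t))) (fmul (gen (AD j t)) (gen (AD i r))) \<in> AR n a"
    and "(i, r) \<in> AI n a \<Longrightarrow> (j, t) \<in> AI n a \<Longrightarrow>
      fsub (fmul (gen (AW i r)) (gen (AW j t))) (fmul (gen (AW j t)) (gen (AW i r))) \<in> AR n a"
    and "(i, r) \<in> AI n a \<Longrightarrow> fsub (fmul (gen (AD i r)) (gen (ADi i r))) fone \<in> AR n a"
    and "(i, r) \<in> AI n a \<Longrightarrow> fsub (fmul (gen (ADi i r)) (gen (AD i r))) fone \<in> AR n a"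
    and "(i, r) \<in> AI n a \<Longrightarrow> fsub (fmul (gen (AW i r)) (gen (AWi i r))) fone \<in> AR n a"
    and "(i, r) \<in> AI n a \<Longrightarrow> fsub (fmul (gen (AWi i r)) (gen (AW i r))) fone \<in> AR n a"
    and "(i, r) \<in> AI n a \<Longrightarrow> (i, t) \<in> AI n a \<Longrightarrow> r \<noteq> t \<Longrightarrow>
      fsub (fmul (fsub (wsq i r) (fscal (vv powi m) (wsq i t))) (gen (AInvD i r t m))) fone \<in> AR n a"
    and "(i, r) \<in> AI n a \<Longrightarrow> (i, t) \<in> AI n a \<Longrightarrow> r \<noteq> t \<Longrightarrow>
      fsub (fmul (gen (AInvD i r t m)) (fsub (wsq i r) (fscal (vv powi m) (wsq i t)))) fone \<in> AR n a"
  \<comment> \<open>The union is nested to the left, so the number of \<open>UnI1\<close> steps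
    selects the family of relations.\<close>
  by - (unfold AR_def,
    (rule UnI1, rule UnI1, rule UnI1, rule UnI1, rule UnI1, rule UnI1, rule UnI1, rule UnI1, rule UnI1, rule UnI1, rule CollectI, (rule exI)+, rule conjI, rule refl, simp),
    (rule UnI1, rule UnI1, rule UnI1, rule UnI1, rule UnI1, rule UnI1, rule UnI1, rule UnI1, rule UnI1, rule UnI2, rule CollectI, (rule exI)+, rule conjI, rule refl, simp),
    (rule UnI1, rule UnI1, rule UnI1, rule UnI1, rule UnI1, rule UnI1, rule UnI1, rule UnI1, rule UnI2, rule CollectI, (rule exI)+, rule conjI, rule refl, simp),
    (rule UnI1, rule UnI1, rule UnI1, rule UnI1, rule UnI1, rule UnI1, rule UnI1, rule UnI2, rule CollectI, (rule exI)+, rule conjI, rule refl, simp),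
    (rule UnI1, rule UnI1, rule UnI1, rule UnI1, rule UnI1, rule UnI1, rule UnI2, rule CollectI, (rule exI)+, rule conjI, rule refl, simp),
    (rule UnI1, rule UnI1, rule UnI1, rule UnI1, rule UnI1, rule UnI2, rule CollectI, (rule exI)+, rule conjI, rule refl, simp),
    (rule UnI1, rule UnI1, rule UnI1, rule UnI1, rule UnI2, rule CollectI, (rule exI)+, rule conjI, rule refl, simp),
    (rule UnI1, rule UnI1, rule UnI1, rule UnI2, rule CollectI, (rule exI)+, rule conjI, rule refl, simp),
    (rule UnI1, rule UnI1, rule UnI2, rule CollectI, (rule exI)+, rule conjI, rule refl, simp))

lemma ring_Aalg: "ring (Aalg n a)"
  unfolding Aalg_def by (rule ring_Pres[OF AR_FA])

context gklo
begin

abbreviation A :: "Agen fa set ring" where "A \<equiv> Aalg n a"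
definition J :: "Agen fa set \<Rightarrow> Agen fa set ringprod" where "J = emb A"
definition e1 :: "Agen fa set ringprod" where "e1 = J (one A)"
definition jj :: "Agen fa \<Rightarrow> Agen fa set ringprod" where "jj f = J (cls (AG n a) (AR n a) f)"
definition s1 :: "K \<Rightarrow> Agen fa set ringprod" where "s1 c = jj (sc c)"
definition U1 :: "nat \<Rightarrow> Agen fa set ringprod" where
  "U1 k = (case prod_decode k of (i, r) \<Rightarrow> jj (gen (AW i r)))"
definition ks1 :: "nat list" where "ks1 = sorted_list_of_set (prod_encode ` AI n a)"

lemma AI_rg: "(i, r) \<in> AI n a \<longleftrightarrow> r \<in> rg i"
  by (auto simp: AI_def rg_def aa_def)

lemma finite_AI: "finite (AI n a)"
proof (rule finite_subset)
  show "AI n a \<subseteq> (SIGMA i:{..<n}. rg i)" by (auto simp: AI_rg[symmetric]) (auto simp: AI_def)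
qed auto

lemma set_ks1: "set ks1 = prod_encode ` AI n a"
  by (simp add: ks1_def finite_AI)

lemma cls_closed: "f \<in> carrier (FA (AG n a)) \<Longrightarrow> cls (AG n a) (AR n a) f \<in> carrier A"
  using ring_hom_closed[OF cls_hom[OF AR_FA]] by (simp add: Aalg_def)

lemma gA_closed: "g \<in> AG n a \<Longrightarrow> gA n a g \<in> carrier A"
  by (simp add: gA_def cls_closed)

lemma sA_closed: "sA n a c \<in> carrier A"
  by (simp add: sA_def cls_closed)

lemma ghom_J: "ghom A J e1"
  unfolding J_def e1_def by (rule ghom_emb[OF ring_Aalg])

lemma jj_fmul: "f \<in> carrier (FA (AG n a)) \<Longrightarrow> g \<in> carrier (FA (AG n a)) \<Longrightarrow> jj (fmul f g) = jj f * jj g"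
  and jj_fadd: "f \<in> carrier (FA (AG n a)) \<Longrightarrow> g \<in> carrier (FA (AG n a)) \<Longrightarrow> jj (fadd f g) = jj f + jj g"
  and jj_fone: "jj fone = e1"
  using ring_hom_mult[OF cls_hom[OF AR_FA]] ring_hom_add[OF cls_hom[OF AR_FA]] ring_hom_one[OF cls_hom[OF AR_FA]]
  by (simp_all add: jj_def J_def e1_def emb_mult emb_add ring_Aalg cls_closed flip: Aalg_def)

lemma jj_fscal: "f \<in> carrier (FA (AG n a)) \<Longrightarrow> jj (fscal c f) = s1 c * jj f"
  by (simp add: fscal_conv jj_fmul s1_def)

lemma jj_fsub:
  assumes "f \<in> carrier (FA (AG n a))" "g \<in> carrier (FA (AG n a))"
  shows "jj (fsub f g) = jj f - jj g"
proof -
  have "fadd (fsub f g) g = f" by (auto simp: fadd_def fsub_def)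
  then have "jj (fsub f g) + jj g = jj f" using jj_fadd[of "fsub f g" g] assms by (simp add: fsub_FA)
  then show ?thesis by (simp add: eq_diff_eq)
qed

lemma jj_rel:
  assumes "fsub f g \<in> AR n a" "f \<in> carrier (FA (AG n a))" "g \<in> carrier (FA (AG n a))"
  shows "jj f = jj g"
proof -
  have "jj (fsub f g) = J (zero A)" using cls_rel[OF AR_FA assms(1)] by (simp add: jj_def Aalg_def)
  also have "\<dots> = 0" by (rule ghom.g_zero[OF ghom_J])
  finally show ?thesis using assms by (simp add: jj_fsub)
qed

lemma AG_mem: "r \<in> rg i \<Longrightarrow> AD i r \<in> AG n a" "r \<in> rg i \<Longrightarrow> ADi i r \<in> AG n a" "r \<in> rg i \<Longrightarrow> AW i r \<in> AG n a"
  "r \<in> rg i \<Longrightarrow> AWi i r \<in> AG n a" "r \<in> rg i \<Longrightarrow> t \<in> rg i \<Longrightarrow> r \<noteq> t \<Longrightarrow> AInvD i r t m \<in> AG n a"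
  by (auto simp: AG_def AI_rg)

lemma e1_jj: "f \<in> carrier (FA (AG n a)) \<Longrightarrow> e1 * jj f = jj f"
  using jj_fmul[of fone f] by (simp add: jj_fone fmul_fone_left)

lemma jj_e1: "f \<in> carrier (FA (AG n a)) \<Longrightarrow> jj f * e1 = jj f"
  using jj_fmul[of f fone] by (simp add: jj_fone fmul_fone_right)

lemma s1_jj: "f \<in> carrier (FA (AG n a)) \<Longrightarrow> s1 c * jj f = jj f * s1 c"
  using jj_fmul[of "sc c" f] jj_fmul[of f "sc c"] by (simp add: s1_def fmul_sc_left fmul_sc_right)

lemma U1_encode [simp]: "U1 (prod_encode (i, r)) = jj (gen (AW i r))"
  by (simp add: U1_def)

lemma ks1_cases:
  assumes "k \<in> set ks1"
  obtains i r where "k = prod_encode (i, r)" "r \<in> rg i"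
  using assms unfolding set_ks1 by (auto simp: AI_rg)

text \<open>From here \<open>Q.io\<close> is the partial homomorphism from L to the target algebra,
  seen inside its embedding by \<open>J\<close>.\<close>

sublocale Q: rep_emb A J e1 s1 U1 ks1
proof -
  interpret G: ghom A J e1 by (rule ghom_J)
  have "scalars e1 s1"
    by unfold_locales (simp_all add: s1_def sc_add sc_mult jj_fadd jj_fmul jj_fone flip: fone_def)
  moreover have "torus_axioms e1 s1 U1 ks1"
  proof
    fix k l c assume k: "k \<in> set ks1"
    then obtain i r where kk: "k = prod_encode (i, r)" "r \<in> rg i" by (rule ks1_cases)
    show "e1 * U1 k = U1 k" "s1 c * U1 k = U1 k * s1 c" using kk by (simp_all add: e1_jj s1_jj AG_mem)
    assume "l \<in> set ks1"
    then obtain j t where l: "l = prod_encode (j, t)" "t \<in> rg j" by (rule ks1_cases)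
    have "jj (fmul (gen (AW i r)) (gen (AW j t))) = jj (fmul (gen (AW j t)) (gen (AW i r)))"
      using kk l by (intro jj_rel AR_mem) (simp_all add: AI_rg AG_mem fmul_FA)
    then show "U1 k * U1 l = U1 l * U1 k" using kk l by (simp add: jj_fmul AG_mem)
  next
    show "distinct ks1" by (simp add: ks1_def)
  qed
  ultimately have "torus e1 s1 U1 ks1" by (simp add: torus_def)
  moreover have "rep_emb_axioms A J e1"
  proof
    show "inj_on J (carrier A)" unfolding J_def
      by (rule inj_on_inverseI[of _ "component A"]) (rule component_emb[OF ring_Aalg])
    show "b \<in> J ` carrier A" if "e1 * b = b" for b
      using that unfolding J_def e1_def by (rule emb_surj[OF ring_Aalg])
  qed
  ultimately show "rep_emb A J e1 s1 U1 ks1"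
    by (simp add: rep_emb_def rep_def ghom_J)
qed

lemma u_dom: "u i r \<in> Q.dom"
  by (simp add: u_def Q.var_dom)

lemma w_dom: "w i r \<in> Q.dom"
  by (simp add: w_def power2_eq_square Q.dom_mult u_dom)

lemma io_u: "r \<in> rg i \<Longrightarrow> Q.io (u i r) = jj (gen (AW i r))"
  using Q.io_var[of "prod_encode (i, r)"] by (simp add: u_def set_ks1 AI_rg image_iff) 

lemma u_inv:
  assumes r: "r \<in> rg i"
  shows "inverse (u i r) \<in> Q.dom" "Q.io (inverse (u i r)) = jj (gen (AWi i r))"
proof -
  have "jj (fmul (gen (AW i r)) (gen (AWi i r))) = jj fone" "jj (fmul (gen (AWi i r)) (gen (AW i r))) = jj fone"
    using r by (intro jj_rel AR_mem; simp add: AI_rg AG_mem fmul_FA)+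
  then have "Q.cinv (Q.io (u i r)) (jj (gen (AWi i r)))"
    using r by (simp add: Q.cinv_def io_u e1_jj AG_mem jj_fmul jj_fone)
  then show "inverse (u i r) \<in> Q.dom" "Q.io (inverse (u i r)) = jj (gen (AWi i r))"
    using Q.dom_inverse[OF u_dom] Q.io_inverse[OF u_dom] by simp_all
qed

lemma dom_prod: "(\<And>x. x \<in> S \<Longrightarrow> f x \<in> Q.dom) \<Longrightarrow> prod f S \<in> Q.dom"
  by (induction S rule: infinite_finite_induct) (simp_all add: Q.dom_one Q.dom_mult)

lemma w_inv_dom: "r \<in> rg i \<Longrightarrow> inverse (w i r) \<in> Q.dom"
  by (simp add: w_def power2_eq_square Q.dom_mult u_inv)

lemma jj_wsq: "r \<in> rg i \<Longrightarrow> jj (wsq i r) = Q.io (w i r)"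
  by (simp add: wsq_def jj_fmul AG_mem w_def power2_eq_square Q.io_mult u_dom io_u)

text \<open>The localising generator with m = 0 inverts exactly this difference, which makes 1 /
  W_{i,r}(w_{i,r}) representable.\<close>

lemma wdiff_inv_dom:
  assumes r: "r \<in> rg i" "t \<in> rg i" "r \<noteq> t"
  shows "inverse (w i r - w i t) \<in> Q.dom"
proof -
  let ?d = "fsub (wsq i r) (fscal (vv powi 0) (wsq i t))"
  have m: "?d \<in> carrier (FA (AG n a))" "wsq i r \<in> carrier (FA (AG n a))" "wsq i t \<in> carrier (FA (AG n a))"
    using r by (simp_all add: fsub_FA fscal_FA wsq_FA AG_mem)
  have "fsub (fmul ?d (gen (AInvD i r t 0))) fone \<in> AR n a" "fsub (fmul (gen (AInvD i r t 0)) ?d) fone \<in> AR n a"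
    using r by (intro AR_mem; simp add: AI_rg)+
  then have "jj (fmul ?d (gen (AInvD i r t 0))) = jj fone" "jj (fmul (gen (AInvD i r t 0)) ?d) = jj fone"
    using r m by (intro jj_rel; simp add: AG_mem fmul_FA)+
  moreover have "jj ?d = Q.io (w i r - w i t)"
    using r m(2,3) by (simp add: jj_fsub jj_fscal fscal_FA jj_wsq Q.e_io w_dom Q.io_diff Q.s_one)
  ultimately have "Q.cinv (Q.io (w i r - w i t)) (jj (gen (AInvD i r t 0)))"
    using r m by (simp add: Q.cinv_def jj_fmul AG_mem jj_fone e1_jj)
  moreover have "w i r - w i t \<noteq> 0" using r by simp
  ultimately show ?thesis using Q.dom_inverse[OF Q.dom_diff[OF w_dom w_dom]] by blast
qed

section \<open>The shift operators of the target\<close>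

definition Dp :: "nat \<Rightarrow> nat \<Rightarrow> Agen fa set ringprod" where "Dp i r = jj (gen (AD i r))"
definition Dm :: "nat \<Rightarrow> nat \<Rightarrow> Agen fa set ringprod" where "Dm i r = jj (gen (ADi i r))"

lemma D_inv:
  assumes "r \<in> rg i"
  shows "Dp i r * Dm i r = e1" "Dm i r * Dp i r = e1"
    "e1 * Dp i r = Dp i r" "e1 * Dm i r = Dm i r" "Dp i r * e1 = Dp i r" "Dm i r * e1 = Dm i r"
proof -
  have "jj (fmul (gen (AD i r)) (gen (ADi i r))) = jj fone" "jj (fmul (gen (ADi i r)) (gen (AD i r))) = jj fone"
    using assms by (intro jj_rel AR_mem; simp add: AI_rg AG_mem fmul_FA)+
  then show "Dp i r * Dm i r = e1" "Dm i r * Dp i r = e1"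
    using assms by (simp_all add: Dp_def Dm_def jj_fmul AG_mem jj_fone)
qed (use assms in \<open>simp_all add: Dp_def Dm_def e1_jj jj_e1 AG_mem\<close>)

lemma s1_D: "r \<in> rg i \<Longrightarrow> s1 c * Dp i r = Dp i r * s1 c" "r \<in> rg i \<Longrightarrow> s1 c * Dm i r = Dm i r * s1 c"
  by (simp_all add: Dp_def Dm_def s1_jj AG_mem)

lemma D_U:
  assumes "r \<in> rg i" "t \<in> rg j"
  shows "Dp i r * jj (gen (AW j t)) = s1 (if i = j \<and> r = t then vv else 1) * jj (gen (AW j t)) * Dp i r"
proof -
  have "jj (fmul (gen (AD i r)) (gen (AW j t))) = jj (fscal (if i = j \<and> r = t then vv else 1) (fmul (gen (AW j t)) (gen (AD i r))))"
    using assms by (intro jj_rel AR_mem) (simp_all add: AI_rg AG_mem fmul_FA fscal_FA)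
  then show ?thesis using assms by (simp add: Dp_def jj_fmul jj_fscal AG_mem fmul_FA mult.assoc)
qed

text \<open>The presentation states commutation relations only for D; multiplying by the inverse on
  both sides transfers them to D^{-1}.\<close>

lemma conj_inv:
  assumes D: "Dp i r * x = y * Dp i r" and r: "r \<in> rg i" and "e1 * x = x" "y * e1 = y"
  shows "Dm i r * y = x * Dm i r"
proof -
  have "Dm i r * y = Dm i r * (y * (Dp i r * Dm i r))" using assms by (simp add: D_inv)
  also have "\<dots> = Dm i r * (y * Dp i r) * Dm i r" by (simp add: mult.assoc)
  also have "\<dots> = Dm i r * Dp i r * x * Dm i r" by (simp add: D[symmetric] mult.assoc)
  finally show ?thesis using assms by (simp add: D_inv)
qed

lemma D_comm:
  assumes "r \<in> rg i" "t \<in> rg j"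
  shows "Dp j t * Dp i r = Dp i r * Dp j t" "Dm j t * Dp i r = Dp i r * Dm j t"
    "Dp j t * Dm i r = Dm i r * Dp j t" "Dm j t * Dm i r = Dm i r * Dm j t"
proof -
  have pp: "Dp j t * Dp i r = Dp i r * Dp j t" if "r \<in> rg i" "t \<in> rg j" for i r j t
  proof -
    have "jj (fmul (gen (AD j t)) (gen (AD i r))) = jj (fmul (gen (AD i r)) (gen (AD j t)))"
      using that by (intro jj_rel AR_mem) (simp_all add: AI_rg AG_mem fmul_FA)
    then show ?thesis using that by (simp add: Dp_def jj_fmul AG_mem)
  qed
  have mp: "Dm j t * Dp i r = Dp i r * Dm j t" if "r \<in> rg i" "t \<in> rg j" for i r j t
    using conj_inv[OF pp[OF that] that(2)] that by (simp add: D_inv)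
  show "Dp j t * Dp i r = Dp i r * Dp j t" "Dm j t * Dp i r = Dp i r * Dm j t" "Dp j t * Dm i r = Dm i r * Dp j t"
    using pp mp mp[symmetric] assms by auto
  show "Dm j t * Dm i r = Dm i r * Dm j t"
    using conj_inv[OF mp[OF assms(2,1), symmetric] assms(2)] assms by (simp add: D_inv)
qed

lemma tw_Dp:
  assumes r: "r \<in> rg i"
  shows "Q.tw (Dp i r) (sh i r vv)"
  unfolding sh_def
proof (rule Q.tw_twists, unfold Q.twists_def, intro conjI ballI allI)
  show "prod_encode (i, r) \<in> set ks1" using r by (simp add: set_ks1 AI_rg image_iff)
  show "\<exists>T'. e1 * T' = T' \<and> T' * e1 = T' \<and> Dp i r * T' = e1 \<and> T' * Dp i r = e1"
    using D_inv[OF r] by blast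
  fix l assume "l \<in> set ks1"
  then obtain j t where l: "l = prod_encode (j, t)" "t \<in> rg j" by (rule ks1_cases)
  show "Dp i r * U1 l = s1 (if l = prod_encode (i, r) then vv else 1) * U1 l * Dp i r"
    using D_U[OF r l(2)] l(1) by (auto simp: prod_encode_eq)
qed (use D_inv[OF r] s1_D[OF r] in auto)

text \<open>Transferring the relation of D with w^{1/2} leaves the scalar on the wrong side;
  multiplication by its inverse turns c = v into c = 1/v.\<close>

lemma tw_Dm:
  assumes r: "r \<in> rg i"
  shows "Q.tw (Dm i r) (sh i r (inverse vv))"
  unfolding sh_def
proof (rule Q.tw_twists, unfold Q.twists_def, intro conjI ballI allI)
  show "prod_encode (i, r) \<in> set ks1" using r by (simp add: set_ks1 AI_rg image_iff)
  show "\<exists>T'. e1 * T' = T' \<and> T' * e1 = T' \<and> Dm i r * T' = e1 \<and> T' * Dm i r = e1"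
    using D_inv[OF r] by blast
  fix l assume "l \<in> set ks1"
  then obtain j t where l: "l = prod_encode (j, t)" "t \<in> rg j" by (rule ks1_cases)
  define c where "c = (if l = prod_encode (i, r) then vv else 1)"
  have m: "gen (AW j t) \<in> carrier (FA (AG n a))" using l by (simp add: AG_mem)
  have ec: "s1 (inverse c) * s1 c = e1" by (simp add: c_def Q.s_one flip: Q.s_mult)
  have "Dp i r * U1 l = s1 c * U1 l * Dp i r"
    using D_U[OF r l(2)] l(1) by (auto simp: prod_encode_eq c_def)
  then have "Dm i r * (s1 c * U1 l) = U1 l * Dm i r"
    by (rule conj_inv[OF _ r]) (use l m in \<open>simp_all add: e1_jj jj_e1 mult.assoc\<close>)
  then have "s1 (inverse c) * (Dm i r * (s1 c * U1 l)) = s1 (inverse c) * U1 l * Dm i r"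
    by (simp add: mult.assoc)
  also have "s1 (inverse c) * (Dm i r * (s1 c * U1 l)) = Dm i r * ((s1 (inverse c) * s1 c) * U1 l)"
    by (simp add: s1_D[OF r] flip: mult.assoc)
  also have "\<dots> = Dm i r * U1 l" unfolding ec using l m by (simp add: e1_jj)
  finally show "Dm i r * U1 l = s1 (if l = prod_encode (i, r) then inverse vv else 1) * U1 l * Dm i r"
    by (simp add: c_def split: if_splits)
qed (use D_inv[OF r] s1_D[OF r] in auto)

section \<open>Representing the images of the generators\<close>

lemma rp_sA: "Q.rp (sA n a c) (cst c)"
  by (simp add: Q.rp_def sA_closed Q.cst_dom Q.io_cst) (simp add: s1_def jj_def sA_def)

lemma rp_AW: "r \<in> rg i \<Longrightarrow> Q.rp (gA n a (AW i r)) (u i r)"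
  by (simp add: Q.rp_def gA_closed AG_mem u_dom io_u) (simp add: jj_def gA_def)

lemma rp_AWi: "r \<in> rg i \<Longrightarrow> Q.rp (gA n a (AWi i r)) (inverse (u i r))"
  by (simp add: Q.rp_def gA_closed AG_mem u_inv) (simp add: jj_def gA_def)

lemma rp_wA: "r \<in> rg i \<Longrightarrow> Q.rp (wA n a i r) (w i r)"
  unfolding wA_def w_def power2_eq_square by (intro Q.rp_mult rp_AW)

lemma rp_wpowA: "r \<in> rg i \<Longrightarrow> Q.rp (wpowA n a i r p) (w i r powi p)"
proof -
  assume r: "r \<in> rg i"
  have "Q.rp (gA n a (AWi i r) \<otimes>\<^bsub>A\<^esub> gA n a (AWi i r)) (inverse (w i r))"
    using Q.rp_mult[OF rp_AWi rp_AWi] r by (simp add: w_def power2_eq_square)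
  then have "Q.rp (wpowA n a i r p) (inverse (w i r) ^ nat (- p))" if "\<not> 0 \<le> p"
    using that unfolding wpowA_def by (simp only: if_False) (rule Q.rp_pow)
  moreover have "Q.rp (wpowA n a i r p) (w i r ^ nat p)" if "0 \<le> p"
    using that Q.rp_pow[OF rp_wA[OF r]] by (simp only: wpowA_def if_True)
  ultimately show ?thesis by (auto simp: power_int_def)
qed

lemma rp_minv_wA: "r \<in> rg i \<Longrightarrow> Q.rp (m_inv A (wA n a i r)) (inverse (w i r))"
  by (intro Q.rp_m_inv rp_wA) (simp_all add: w_inv_dom)

lemma set_upt_rg: "set [1..<aa n a i + 1] = rg i"
  by (auto simp: rg_def)

lemma rp_WexA: "r \<in> rg i \<Longrightarrow> Q.rp (WexA n a i r (wA n a i r)) (Wp i r)"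
proof -
  assume r: "r \<in> rg i"
  have "set (filter (\<lambda>s. s \<noteq> r) [1..<aa n a i + 1]) = rg i - {r}" by (auto simp: rg_def)
  moreover have "Q.rp (WexA n a i r (wA n a i r)) (\<Prod>t\<in>set (filter (\<lambda>s. s \<noteq> r) [1..<aa n a i + 1]). 1 - w i t * inverse (w i r))"
    unfolding WexA_def using r
    by (intro Q.rp_lprod Q.rp_minus Q.rp_mult Q.rp_one rp_wA rp_minv_wA) (auto simp: rg_def simp del: upt_Suc)
  ultimately show ?thesis by (simp add: Wp_def divide_inverse)
qed

lemma Wp_inv_dom: "r \<in> rg i \<Longrightarrow> inverse (Wp i r) \<in> Q.dom"
proof -
  assume r: "r \<in> rg i"
  have "inverse (Wp i r) = (\<Prod>t\<in>rg i - {r}. w i r * inverse (w i r - w i t))"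
    unfolding Wp_def prod_inversef[symmetric]
    by (intro prod.cong refl) (auto simp: field_simps)
  then show ?thesis using r by (auto intro!: dom_prod Q.dom_mult w_dom wdiff_inv_dom)
qed

lemma rp_WexA_inv: "r \<in> rg i \<Longrightarrow> Q.rp (m_inv A (WexA n a i r (wA n a i r))) (inverse (Wp i r))"
  by (intro Q.rp_m_inv rp_WexA) (simp_all add: Wp_inv_dom Wp_neq_0)

lemma rp_WA:
  assumes x: "Q.rp x f" "f \<noteq> 0" "inverse f \<in> Q.dom"
  shows "Q.rp (WA n a j x) (\<Prod>t\<in>rg j. 1 - w j t / f)"
proof -
  have "Q.rp (WA n a j x) (\<Prod>t\<in>set [1..<aa n a j + 1]. 1 - w j t * inverse f)"
    unfolding WA_def using x
    by (intro Q.rp_lprod Q.rp_minus Q.rp_mult Q.rp_one rp_wA Q.rp_m_inv) (auto simp: rg_def)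
  then show ?thesis unfolding set_upt_rg by (simp add: divide_inverse)
qed

lemma cst_inv_dom: "inverse (cst c) \<in> Q.dom"
  by (simp add: Q.cst_dom flip: cst_inverse)

lemma rp_Wm: "r \<in> rg i \<Longrightarrow> Q.rp (WA n a (i - 1) (sA n a (inverse vv) \<otimes>\<^bsub>A\<^esub> wA n a i r)) (Wm i r)"
  using rp_WA[OF Q.rp_mult[OF rp_sA rp_wA], of r i "inverse vv" "i - 1"]
  by (simp add: Q.dom_mult Q.cst_dom w_inv_dom cst_iv Wm_def divide_inverse mult_ac)

lemma rp_Wq: "r \<in> rg i \<Longrightarrow> Q.rp (WA n a (i + 1) (sA n a vv \<otimes>\<^bsub>A\<^esub> wA n a i r)) (Wq i r)"
  using rp_WA[OF Q.rp_mult[OF rp_sA rp_wA], of r i vv "i + 1"]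
  by (simp add: Q.dom_mult cst_inv_dom w_inv_dom Wq_def)

lemma rp_ZA:
  assumes r: "r \<in> rg i" and i: "1 \<le> i"
  shows "Q.rp (ZA n a N is xs gam i (wA n a i r)) (Zp i r)"
proof -
  let ?l = "filter (\<lambda>s. is s = i) [1..<N + 1]"
  have s: "set ?l = Zs i" by (auto simp: Zs_def)
  have "Q.rp (ZA n a N is xs gam i (wA n a i r)) (\<Prod>s\<in>set ?l. 1 - cst (vv powi (- int i) * cK (xs s)) * inverse (w i r))"
    unfolding ZA_def Let_def
  proof (intro Q.rp_lprod)
    fix s assume "s \<in> set ?l"
    then have "gam s = 1" using div i by auto
    then show "Q.rp (if gam s = 1 then \<one>\<^bsub>A\<^esub> \<ominus>\<^bsub>A\<^esub> sA n a (vv powi - int i * cK (xs s)) \<otimes>\<^bsub>A\<^esub> inv\<^bsub>A\<^esub> wA n a i r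
        else inv\<^bsub>A\<^esub> (\<one>\<^bsub>A\<^esub> \<ominus>\<^bsub>A\<^esub> sA n a (vv powi - int i * cK (xs s)) \<otimes>\<^bsub>A\<^esub> inv\<^bsub>A\<^esub> wA n a i r))
       (1 - cst (vv powi (- int i) * cK (xs s)) * inverse (w i r))"
      using r by (auto intro!: Q.rp_minus Q.rp_one Q.rp_mult rp_sA rp_minv_wA)
  qed simp
  then show ?thesis unfolding s Zp_Zs by (simp add: divide_inverse)
qed

lemma lprod_append: "set zs \<subseteq> carrier A \<Longrightarrow> y \<in> carrier A \<Longrightarrow> lprod A (zs @ [y]) = lprod A zs \<otimes>\<^bsub>A\<^esub> y"
  by (induction zs) (auto simp: Q.lprod_closed Q.m_assoc)

lemma rp_lprod_append:
  "Q.rp (lprod A zs) f \<Longrightarrow> Q.rp (lprod A ys) h \<Longrightarrow> set zs \<subseteq> carrier A \<Longrightarrow> set ys \<subseteq> carrier A \<Longrightarrow> Q.rp (lprod A (zs @ ys)) (f * h)"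
proof -
  assume *: "Q.rp (lprod A zs) f" "Q.rp (lprod A ys) h" "set zs \<subseteq> carrier A" "set ys \<subseteq> carrier A"
  have "lprod A (zs @ ys) = lprod A zs \<otimes>\<^bsub>A\<^esub> lprod A ys"
    using *(3,4) by (induction zs) (auto simp: Q.lprod_closed Q.m_assoc)
  then show ?thesis using * by (simp add: Q.rp_mult)
qed

lemma rp_closed: "Q.rp x f \<Longrightarrow> x \<in> carrier A"
  by (simp add: Q.rp_def)

text \<open>Common shape of the images of the E and F modes: a prefactor from the commutative part
  times a sum over r of such factors followed by one shift operator.\<close>

lemma J_current:
  assumes P: "Q.rp (lprod A ps) p" "set ps \<subseteq> carrier A"
    and c: "\<And>r. r \<in> rg i \<Longrightarrow> Q.rp (lprod A (cs r)) (f r)" "\<And>r. r \<in> rg i \<Longrightarrow> set (cs r) \<subseteq> carrier A"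
    and d: "\<And>r. r \<in> rg i \<Longrightarrow> d r \<in> carrier A"
  defines "X \<equiv> lprod A (ps @ [lsum A (map (\<lambda>r. lprod A (cs r @ [d r])) [1..<aa n a i + 1])])"
  shows "X \<in> carrier A" "J X = (\<Sum>r\<in>rg i. Q.io (p * f r) * J (d r))"
proof -
  let ?l = "map (\<lambda>r. lprod A (cs r @ [d r])) [1..<aa n a i + 1]"
  have t: "lprod A (cs r @ [d r]) = lprod A (cs r) \<otimes>\<^bsub>A\<^esub> d r" "lprod A (cs r) \<otimes>\<^bsub>A\<^esub> d r \<in> carrier A"
     "J (lprod A (cs r) \<otimes>\<^bsub>A\<^esub> d r) = Q.io (f r) * J (d r)" if "r \<in> rg i" for r
    using c[OF that] d[OF that] by (simp_all add: lprod_append Q.lprod_closed Q.g_mult Q.rp_def)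
  have l: "set ?l \<subseteq> carrier A" using t by (auto simp: set_upt_rg[symmetric] simp del: upt_Suc)
  have X: "X = lprod A ps \<otimes>\<^bsub>A\<^esub> lsum A ?l"
    unfolding X_def using P(2) Q.lsum_closed[OF l] by (rule lprod_append)
  then show "X \<in> carrier A" using P Q.lsum_closed[OF l] by (simp add: Q.lprod_closed del: upt_Suc)
  have "J (lsum A ?l) = (\<Sum>r\<leftarrow>[1..<aa n a i + 1]. J (lprod A (cs r @ [d r])))"
    using Q.g_lsum[OF l] by (simp add: o_def del: upt_Suc)
  also have "\<dots> = (\<Sum>r\<in>rg i. J (lprod A (cs r @ [d r])))"
    unfolding interv_sum_list_conv_sum_set_nat set_upt_rg[symmetric] by (simp del: upt_Suc)
  also have "\<dots> = (\<Sum>r\<in>rg i. Q.io (f r) * J (d r))" using t by simp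
  finally have "J X = Q.io p * (\<Sum>r\<in>rg i. Q.io (f r) * J (d r))"
    unfolding X using P Q.lsum_closed[OF l] by (simp add: Q.g_mult Q.lprod_closed Q.rp_def del: upt_Suc)
  also have "\<dots> = (\<Sum>r\<in>rg i. Q.io (p * f r) * J (d r))"
    unfolding sum_distrib_left using P c by (intro sum.cong refl) (simp add: Q.io_mult Q.rp_def mult.assoc)
  finally show "J X = (\<Sum>r\<in>rg i. Q.io (p * f r) * J (d r))" .
qed

lemma rp_lprod_Cons: "Q.rp x f \<Longrightarrow> Q.rp (lprod A zs) h \<Longrightarrow> Q.rp (lprod A (x # zs)) (f * h)"
  by (simp add: Q.rp_mult)

lemma rp_lprod_Nil: "Q.rp (lprod A []) 1"
  by (simp add: Q.rp_one)

lemma rp_map_upt: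
  assumes "\<And>r. r \<in> rg i \<Longrightarrow> Q.rp (x r) (f r)"
  shows "Q.rp (lprod A (map x [1..<aa n a i + 1])) (\<Prod>r\<in>rg i. f r)" "set (map x [1..<aa n a i + 1]) \<subseteq> carrier A"
proof -
  show "Q.rp (lprod A (map x [1..<aa n a i + 1])) (\<Prod>r\<in>rg i. f r)"
    unfolding set_upt_rg[symmetric] using assms
    by (intro Q.rp_lprod) (auto simp: rg_def)
  show "set (map x [1..<aa n a i + 1]) \<subseteq> carrier A"
    using assms rp_closed unfolding set_map set_upt_rg by blast
qed

lemma Eimg_J:
  assumes i: "1 \<le> i"
  shows "Eimg n a mp N is xs gam i k \<in> carrier A"
    "J (Eimg n a mp N is xs gam i k) = (\<Sum>r\<in>rg i. Q.io (EE i r k) * Dm i r)"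
proof -
  define p where "p = k - (mp i - mp (i + 1))"
  define ps where "ps = map (wA n a i) [1..<aa n a i + 1] @ map (\<lambda>t. gA n a (AWi (i - 1) t)) [1..<aa n a (i - 1) + 1]"
  define cs where "cs r = [sA n a (vv powi (int i * p)), wpowA n a i r p,
                   ZA n a N is xs gam i (wA n a i r),
                   m_inv A (WexA n a i r (wA n a i r)),
                   WA n a (i - 1) (Group.monoid.mult A (sA n a (inverse vv)) (wA n a i r))]" for r
  have X: "Eimg n a mp N is xs gam i k
     = lprod A (ps @ [lsum A (map (\<lambda>r. lprod A (cs r @ [gA n a (ADi i r)])) [1..<aa n a i + 1])])"
    by (simp add: Eimg_def Let_def ps_def cs_def p_def)
  \<comment> \<open>The nesting and the final 1 copy the way \<open>lprod\<close> folds the list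
    \<open>cs r\<close>.\<close>
  define f where "f r = cst (vv powi (int i * p)) * (w i r powi p * (Zp i r * (inverse (Wp i r) * (Wm i r * 1))))" for r
  define pp where "pp = (\<Prod>t\<in>rg i. w i t) * (\<Prod>t\<in>rg (i - 1). inverse (u (i - 1) t))"
  have P: "Q.rp (lprod A ps) pp" "set ps \<subseteq> carrier A"
    unfolding ps_def pp_def using rp_map_upt[of i "wA n a i" "w i"] rp_map_upt[of "i - 1" "\<lambda>t. gA n a (AWi (i - 1) t)" "\<lambda>t. inverse (u (i - 1) t)"]
    by (auto intro!: rp_lprod_append simp: rp_wA rp_AWi simp del: upt_Suc)
  have C: "Q.rp (lprod A (cs r)) (f r)" "set (cs r) \<subseteq> carrier A" if r: "r \<in> rg i" for r
  proof -
    note all = rp_sA rp_wpowA[OF r] rp_ZA[OF r i] rp_WexA_inv[OF r] rp_Wm[OF r]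
    show "Q.rp (lprod A (cs r)) (f r)" unfolding cs_def f_def by (intro rp_lprod_Cons rp_lprod_Nil all)
    show "set (cs r) \<subseteq> carrier A" using all[THEN rp_closed] by (simp add: cs_def)
  qed
  have d: "gA n a (ADi i r) \<in> carrier A" if "r \<in> rg i" for r using that by (simp add: gA_closed AG_mem)
  note JX = J_current[of ps pp i cs f "\<lambda>r. gA n a (ADi i r)", OF P C d]
  show "Eimg n a mp N is xs gam i k \<in> carrier A" unfolding X by (rule JX(1))
  have "pp * f r = EE i r k" if "r \<in> rg i" for r
  proof -
    have "cst (vv powi (int i * p)) * w i r powi p = xx i r powi p"
      by (simp add: xx_def power_int_mult_distrib cst_power_int power_int_mult flip: power_int_of_nat)
    moreover have "p = k + \<kappa> i" by (simp add: p_def \<kappa>_def)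
    ultimately show ?thesis by (simp add: f_def pp_def EE_def eC_def mult_ac)
  qed
  moreover have "J (Eimg n a mp N is xs gam i k) = (\<Sum>r\<in>rg i. Q.io (pp * f r) * J (gA n a (ADi i r)))"
    unfolding X by (rule JX(2))
  ultimately show "J (Eimg n a mp N is xs gam i k) = (\<Sum>r\<in>rg i. Q.io (EE i r k) * Dm i r)"
    by (simp add: Dm_def jj_def gA_def)
qed

lemma Fimg_J:
  shows "Fimg n a i k \<in> carrier A"
    "J (Fimg n a i k) = (\<Sum>r\<in>rg i. Q.io (FF i r k) * Dp i r)"
proof -
  define ps where "ps = [sA n a (inverse vv)] @ map (\<lambda>t. gA n a (AWi (i + 1) t)) [1..<aa n a (i + 1) + 1]"
  define cs where "cs r = [sA n a (vv powi (int (i + 2) * k)), wpowA n a i r k,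
                   WA n a (i + 1) (Group.monoid.mult A (sA n a vv) (wA n a i r)),
                   m_inv A (WexA n a i r (wA n a i r))]" for r
  define X where "X = lprod A (ps @ [lsum A (map (\<lambda>r. lprod A (cs r @ [gA n a (AD i r)])) [1..<aa n a i + 1])])"
  have X: "Fimg n a i k = a_inv A X"
    by (simp add: Fimg_def Let_def ps_def cs_def X_def)
  define f where "f r = cst (vv powi (int (i + 2) * k)) * (w i r powi k * (Wq i r * (inverse (Wp i r) * 1)))" for r
  define pp where "pp = inverse q * 1 * (\<Prod>t\<in>rg (i + 1). inverse (u (i + 1) t))"
  have s: "Q.rp (lprod A [sA n a (inverse vv)]) (inverse q * 1)"
    unfolding cst_iv[symmetric] by (intro rp_lprod_Cons rp_lprod_Nil rp_sA)
  have P: "Q.rp (lprod A ps) pp" "set ps \<subseteq> carrier A"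
  proof -
    note m = rp_map_upt[of "i + 1" "\<lambda>t. gA n a (AWi (i + 1) t)" "\<lambda>t. inverse (u (i + 1) t)", OF rp_AWi]
    show "Q.rp (lprod A ps) pp" unfolding ps_def pp_def
      by (rule rp_lprod_append[OF s m(1) _ m(2)]) (simp_all add: sA_closed)
    show "set ps \<subseteq> carrier A" unfolding ps_def set_append using m(2) by (simp add: sA_closed del: upt_Suc)
  qed
  have C: "Q.rp (lprod A (cs r)) (f r)" "set (cs r) \<subseteq> carrier A" if r: "r \<in> rg i" for r
  proof -
    note all = rp_sA rp_wpowA[OF r] rp_WexA_inv[OF r] rp_Wq[OF r]
    show "Q.rp (lprod A (cs r)) (f r)" unfolding cs_def f_def by (intro rp_lprod_Cons rp_lprod_Nil all)
    show "set (cs r) \<subseteq> carrier A" using all[THEN rp_closed] by (simp add: cs_def)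
  qed
  have d: "gA n a (AD i r) \<in> carrier A" if "r \<in> rg i" for r using that by (simp add: gA_closed AG_mem)
  have JX: "X \<in> carrier A" "J X = (\<Sum>r\<in>rg i. Q.io (pp * f r) * J (gA n a (AD i r)))"
    unfolding X_def by (rule J_current[of ps pp i cs f "\<lambda>r. gA n a (AD i r)", OF P C d]; assumption)+
  show "Fimg n a i k \<in> carrier A" unfolding X using JX(1) by (rule Q.a_inv_closed)
  have fd: "f r \<in> Q.dom" "pp \<in> Q.dom" if "r \<in> rg i" for r using C(1)[OF that] P by (simp_all add: Q.rp_def)
  have "- (pp * f r) = FF i r k" if "r \<in> rg i" for r
  proof -
    have "cst (vv powi (int (i + 2) * k)) * w i r powi k = yy i r powi k"
      unfolding yy_def by (simp only: power_int_mult_distrib cst_power_int power_int_mult power_int_of_nat cst_power)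
    then show ?thesis by (simp add: f_def pp_def FF_def fC_def mult_ac)
  qed
  then have "Q.io (FF i r k) = - Q.io (pp * f r)" if "r \<in> rg i" for r
    using that fd[OF that] Q.io_minus[OF Q.dom_mult, of pp "f r"] by metis
  moreover have "J (Fimg n a i k) = - (\<Sum>r\<in>rg i. Q.io (pp * f r) * J (gA n a (AD i r)))"
    unfolding X Q.g_a_inv[OF JX(1)] JX(2) ..
  ultimately show "J (Fimg n a i k) = (\<Sum>r\<in>rg i. Q.io (FF i r k) * Dp i r)"
    by (simp add: Dp_def jj_def gA_def sum_negf)
qed

end


lemma fst_sprod: "fst (sprod R Ss) = (\<Sum>S\<leftarrow>Ss. fst S)"
  by (induction Ss) (simp_all add: sprod_def smul_def sone_def)

context faeval
begin

lemma ev_linrel: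
  assumes "\<And>k. X k \<in> carrier (FA UNIV)" "\<And>k. Y k \<in> carrier (FA UNIV)"
  shows "ev (linrel (\<alpha>, \<beta>, \<gamma>, \<epsilon>) X Y k l)
    = s \<alpha> * (ev (X (k + 1)) * ev (Y l)) + s \<beta> * (ev (X k) * ev (Y (l + 1)))
    - (s \<gamma> * (ev (Y l) * ev (X (k + 1))) + s \<epsilon> * (ev (Y (l + 1)) * ev (X k)))"
  using assms by (simp add: linrel_def ev_fsub ev_fadd ev_fscal ev_fmul fadd_FA fscal_FA fmul_FA)

end

text \<open>The Cartan quotients are computed in the algebra on all letters, while the relations
  have to lie in the algebra on the prescribed generators. The operations are the same, so the
  smaller carrier is preserved.\<close>

lemma scoef_smul_FA:
  assumes "\<And>m. scoef (FA UNIV) S m \<in> carrier (FA G)" "\<And>m. scoef (FA UNIV) T m \<in> carrier (FA G)"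
  shows "scoef (FA UNIV) (smul (FA UNIV) S T) m \<in> carrier (FA G)"
proof -
  have l: "set xs \<subseteq> carrier (FA G) \<Longrightarrow> lsum (FA UNIV) xs \<in> carrier (FA G)" for xs
    by (induction xs) (auto simp: lsum_def fadd_FA)
  have "scoef (FA UNIV) (smul (FA UNIV) S T) m = (if m < fst S + fst T then fzero
      else lsum (FA UNIV) (map (\<lambda>j. fmul (scoef (FA UNIV) S j) (scoef (FA UNIV) T (m - j))) [fst S..m - fst T]))"
    by (simp add: scoef_def smul_def)
  then show ?thesis using assms by (auto intro!: l fmul_FA)
qed

lemma scoef_sinvb_FA:
  assumes S: "\<And>m. scoef (FA UNIV) S m \<in> carrier (FA G)" and b: "b \<in> carrier (FA G)"
  shows "scoef (FA UNIV) (sinvb (FA UNIV) S b) m \<in> carrier (FA G)"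
proof -
  have l: "set xs \<subseteq> carrier (FA G) \<Longrightarrow> lsum (FA UNIV) xs \<in> carrier (FA G)" for xs
    by (induction xs) (auto simp: lsum_def fadd_FA)
  \<comment> \<open>\<open>a_inv\<close> is defined relative to the large carrier; its explicit form
    as multiplication by -1 keeps the value in the small one.\<close>
  have i: "a_inv (FA UNIV) x \<in> carrier (FA G)" if "x \<in> carrier (FA G)" for x
    using that FA_mono[of G UNIV] by (subst a_inv_FA) (auto intro: fscal_FA)
  have "length (sinvL (FA UNIV) S b k) = Suc k \<and> set (sinvL (FA UNIV) S b k) \<subseteq> carrier (FA G)" for k
  proof (induction k)
    case (Suc k)
    have "sinvL (FA UNIV) S b k ! (k - j) \<in> carrier (FA G)" for j
      using Suc nth_mem[of "k - j" "sinvL (FA UNIV) S b k"] by auto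
    then show ?case using Suc S b
      by (auto simp: Let_def simp del: upt_Suc intro!: i fmul_FA l)
  qed (simp add: b)
  then have "sinvL (FA UNIV) S b k ! k \<in> carrier (FA G)" for k
    by (metis lessI nth_mem subsetD)
  then show ?thesis by (simp add: scoef_def sinvb_def)
qed

context gklo
begin

section \<open>The Cartan series in the target algebra\<close>

text \<open>The leading coefficient of 1 - c/z is 1 when expanded in 1/z but -c when expanded in z,
  which is where invertibility of c enters.\<close>

lemma srelU_facA:
  assumes x: "Q.rp x f" "f \<noteq> 0" "inverse f \<in> Q.dom"
  shows "Q.srelU (facA n a eps x) (fac eps f)"
proof (cases eps)
  case True
  have "Q.rp (scoef A (facA n a True x) m) (fac True f $$ m)" for m
    using x Q.rp_zero Q.rp_one Q.rp_a_inv[OF x(1)] by (simp add: scoef_def facA_def fac_nth)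
  then show ?thesis using True by (simp add: Q.srelU_def Q.srel_def fac_nth Q.dom_one) (simp add: facA_def fac_nth Q.dom_one)
next
  case False
  have "Q.rp (scoef A (facA n a False x) m) (fac False f $$ m)" for m
    using x Q.rp_zero Q.rp_one Q.rp_a_inv[OF x(1)] by (simp add: scoef_def facA_def fac_nth)
  then show ?thesis using False x Q.dom_minus[OF x(3)]
    by (simp add: Q.srelU_def Q.srel_def) (simp add: facA_def fac_nth)
qed

lemma srelU_WserA: "Q.srelU (WserA n a eps j (vv ^ m)) (PW eps j m)"
proof -
  have "Q.srelU (WserA n a eps j (vv ^ m)) (\<Prod>r\<in>set [1..<aa n a j + 1]. fac eps (cst (vv ^ m) * w j r))"
    unfolding WserA_def
  proof (intro Q.srelU_sprod srelU_facA Q.rp_mult rp_sA rp_wA)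
    fix r assume "r \<in> set [1..<aa n a j + 1]"
    then show r: "r \<in> rg j" by (simp only: set_upt_rg)
    show "inverse (cst (vv ^ m) * w j r) \<in> Q.dom" using r by (simp add: Q.dom_mult cst_inv_dom w_inv_dom)
  qed simp_all
  then show ?thesis unfolding set_upt_rg by (simp add: PW_def cst_power)
qed

lemma srelU_sinvA: "Q.srelU S F \<Longrightarrow> Q.srelU (sinvA n a S) (inverse F)"
  unfolding sinvA_def
  by (rule Q.srelU_sinvb, assumption, rule Q.rp_m_inv) (simp_all add: Q.srelU_def Q.srel_def)

lemma srelU_spowA: "Q.srelU S F \<Longrightarrow> Q.srelU (spowA n a e S) (F powi e)"
proof -
  have *: "Q.srelU S F \<Longrightarrow> Q.srelU (sprod A (replicate k S)) (F ^ k)" for k S F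
    by (induction k) (simp_all add: sprod_def Q.srelU_sone Q.srelU_smul)
  show "Q.srelU S F \<Longrightarrow> Q.srelU (spowA n a e S) (F powi e)"
    using *[of S F "nat e"] *[OF srelU_sinvA, of S F "nat (- e)"] by (simp add: spowA_def power_int_def)
qed

lemma srelU_phiS:
  assumes "1 \<le> i"
  shows "Q.srelU (phiS n a mp N is xs gam eps i) (Phi eps i)"
proof -
  let ?c = "lprod A (map (\<lambda>t. gA n a (AWi i t)) [1..<aa n a i + 1] @ map (\<lambda>t. gA n a (AW (i - 1) t)) [1..<aa n a (i - 1) + 1])"
  let ?X = "map (\<lambda>x. spowA n a (- lamx N is xs gam x i) (facA n a eps (sA n a (cK x)))) (remdups (map xs [1..<N + 1]))"
  have c: "Q.rp ?c (pre i)" unfolding pre_def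
    using rp_map_upt[of i "\<lambda>t. gA n a (AWi i t)", OF rp_AWi] rp_map_upt[of "i - 1" "\<lambda>t. gA n a (AW (i - 1) t)", OF rp_AW]
    by (intro rp_lprod_append)
  have "inverse (pre i) \<in> Q.dom"
    unfolding pre_def by (simp add: prod_inversef[symmetric] Q.dom_mult dom_prod u_dom u_inv)
  then have c': "Q.srelU (sconst A ?c) (fls_const (pre i))" using c by (intro Q.srelU_sconst) simp_all
  have cK: "cK (xs s) \<noteq> 0" if "s \<in> {1..N}" for s
    using div that by (simp add: cK_def Zero_fract_def eq_fract)
  have XS: "set (remdups (map xs [1..<N + 1])) = XS" by (auto simp: XS_def)
  have "Q.srelU (sprod A ?X) (\<Prod>x\<in>set (remdups (map xs [1..<N + 1])). fac eps (cst (cK x)) powi (- lamx N is xs gam x i))"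
  proof (intro Q.srelU_sprod srelU_spowA srelU_facA rp_sA)
    fix x assume "x \<in> set (remdups (map xs [1..<N + 1]))"
    then show "cst (cK x) \<noteq> 0" unfolding XS using cK by (auto simp: XS_def)
  qed (simp_all add: cst_inv_dom)
  then have X: "Q.srelU (sprod A ?X) (PX eps i)" unfolding XS PX_def .
  have "Q.srelU (sprod A (sconst A ?c # WserA n a eps i (vv ^ i) # sinvA n a (WserA n a eps (i - 1) (vv ^ (i + 1))) # ?X))
     (fls_const (pre i) * (PW eps i i * (inverse (PW eps (i - 1) (i + 1)) * PX eps i)))"
    by (intro Q.srelU_Cons c' srelU_WserA srelU_sinvA X)
  from Q.srelU_sshift[OF this, of "if eps then - mp i else mp i"]
  show ?thesis by (simp add: phiS_def Let_def Phi_def zshift_def mult.assoc split: if_splits)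
qed

lemma sum_lamx: "(\<Sum>x\<in>XS. lamx N is xs gam x i) = lam N is gam i"
  unfolding lamx_def lam_def by (rule sum.group) (auto simp: XS_def)

text \<open>Reads off the coefficient of epsilon_j in the sum of the a_i alpha_i; \<open>aa\<close>
  supplies a_0 = a_n = 0 at the two ends.\<close>

lemma balance:
  assumes "j \<in> {1..n}"
  shows "lam N is gam j + mp j + mm j = int (aa n a j) - int (aa n a (j - 1))"
proof -
  have "(\<Sum>i=1..n-1. int (a i) * alpha i j)
     = (\<Sum>i=1..n-1. if i = j then int (a i) else 0) - (\<Sum>i=1..n-1. if i = j - 1 then int (a i) else 0)"
    unfolding sum_subtractf[symmetric] using assms by (intro sum.cong) (auto simp: alpha_def)
  also have "\<dots> = int (aa n a j) - int (aa n a (j - 1))"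
    using assms by (auto simp: aa_def)
  finally show ?thesis using bal assms by simp
qed

text \<open>In powers of 1/z every factor starts at 0, so only the shift by \<open>- mp i\<close>
  counts. In powers of z a factor 1 - c/z starts at -1 and its inverse at 1; the total a_{i-1} - a_i
  + lambda_i + mu^+_i equals -mu^-_i by \<open>balance\<close>.\<close>

lemma fst_phiS:
  assumes "1 \<le> i" "i \<le> n"
  shows "fst (phiS n a mp N is xs gam eps i) = (if eps then - mp i else - mm i)"
proof -
  define d :: int where "d = (if eps then 0 else -1)"
  have f: "fst (facA n a eps x) = d" for x by (simp add: facA_def d_def)
  have W: "fst (WserA n a eps j c) = d * int (aa n a j)" for j c
    by (simp add: WserA_def fst_sprod f o_def sum_list_triv)
  have p: "fst (spowA n a e (facA n a eps x)) = d * e" for e x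
    by (simp add: spowA_def fst_sprod f sinvA_def sinvb_def sum_list_replicate)
  have "(\<Sum>x\<leftarrow>remdups (map xs [1..<N + 1]). d * - lamx N is xs gam x i)
     = (\<Sum>x\<in>set (remdups (map xs [1..<N + 1])). d * - lamx N is xs gam x i)"
    by (intro sum_list_distinct_conv_sum_set) simp
  also have "set (remdups (map xs [1..<N + 1])) = XS" by (auto simp: XS_def)
  also have "(\<Sum>x\<in>XS. d * - lamx N is xs gam x i) = - d * lam N is gam i"
    by (simp add: sum_distrib_left[symmetric] sum_lamx sum_negf)
  finally have X: "(\<Sum>x\<leftarrow>remdups (map xs [1..<N + 1]). d * - lamx N is xs gam x i) = - d * lam N is gam i" .
  have "fst (phiS n a mp N is xs gam eps i) = d * int (aa n a i) - d * int (aa n a (i - 1)) - d * lam N is gam i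
     + (if eps then - mp i else mp i)"
    unfolding phiS_def Let_def sshift_def fst_conv fst_sprod map_append sum_list_append map_map o_def p X
    by (simp add: sconst_def W sinvA_def sinvb_def)
  then show ?thesis using balance[of i] assms by (simp add: d_def split: if_splits)
qed

lemma Phi_below: "1 \<le> i \<Longrightarrow> i \<le> n \<Longrightarrow> m < (if eps then - mp i else - mm i) \<Longrightarrow> Phi eps i $$ m = 0"
  and Phi_lead: "1 \<le> i \<Longrightarrow> i \<le> n \<Longrightarrow> Phi eps i $$ (if eps then - mp i else - mm i) \<noteq> 0"
  and Phi_lead_inv: "1 \<le> i \<Longrightarrow> i \<le> n \<Longrightarrow> inverse (Phi eps i $$ (if eps then - mp i else - mm i)) \<in> Q.dom"
  and Phi_rp: "1 \<le> i \<Longrightarrow> Q.rp (scoef A (phiS n a mp N is xs gam eps i) m) (Phi eps i $$ m)"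
  using srelU_phiS[of i eps] fst_phiS[of i eps] by (auto simp: Q.srelU_def Q.srel_def)

lemma Phi_dom: "1 \<le> i \<Longrightarrow> Phi eps i $$ m \<in> Q.dom"
  using Phi_rp by (simp add: Q.rp_def)

lemma xx_yy_powi_dom: "r \<in> rg i \<Longrightarrow> xx i r powi p \<in> Q.dom" "r \<in> rg i \<Longrightarrow> yy i r powi p \<in> Q.dom"
  using rp_wpowA[of r i p]
  unfolding xx_def yy_def power_int_mult_distrib cst_power[symmetric] cst_power_int[symmetric]
  by (auto simp: Q.rp_def intro!: Q.dom_mult Q.cst_dom)

lemma EE_dom: "r \<in> rg i \<Longrightarrow> 1 \<le> i \<Longrightarrow> EE i r k \<in> Q.dom"
  unfolding EE_def eC_def using rp_ZA[of r i] rp_Wm[of r i]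
  by (auto simp: Q.rp_def intro!: Q.dom_mult xx_yy_powi_dom dom_prod w_dom u_inv Wp_inv_dom)

lemma FF_dom: "r \<in> rg i \<Longrightarrow> FF i r k \<in> Q.dom"
  unfolding FF_def fC_def using rp_Wq[of r i] cst_inv_dom[of vv]
  by (auto simp: Q.rp_def intro!: Q.dom_mult Q.dom_minus xx_yy_powi_dom dom_prod u_inv Wp_inv_dom)

section \<open>Verification of the defining relations\<close>

text \<open>Letters with an index out of range go to 0, so that the evaluation is defined on the
  algebra over all letters. The two families of inverses go to the values of the inverse leading
  coefficients of \<open>Phi\<close>.\<close>

definition gm :: "Ugen \<Rightarrow> Agen fa set ringprod" where
  "gm x = (case x of
      UE i k \<Rightarrow> if 1 \<le> i \<and> i < n then J (Eimg n a mp N is xs gam i k) else 0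
    | UF i k \<Rightarrow> if 1 \<le> i \<and> i < n then J (Fimg n a i k) else 0
    | UPp i m \<Rightarrow> if 1 \<le> i \<and> i \<le> n then Q.io (Phi True i $$ m) else 0
    | UPm i m \<Rightarrow> if 1 \<le> i \<and> i \<le> n then Q.io (Phi False i $$ m) else 0
    | UPpI i \<Rightarrow> if 1 \<le> i \<and> i \<le> n then Q.io (inverse (Phi True i $$ (- mp i))) else 0
    | UPmI i \<Rightarrow> if 1 \<le> i \<and> i \<le> n then Q.io (inverse (Phi False i $$ (- mm i))) else 0)"

lemma J_central:
  assumes "x \<in> carrier A"
  shows "e1 * J x = J x" "s1 c * J x = J x * s1 c"
proof -
  obtain f where "f \<in> carrier (FA (AG n a))" "J x = jj f"
    using assms by (auto simp: Aalg_def carrier_Pres jj_def)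
  then show "e1 * J x = J x" "s1 c * J x = J x * s1 c" by (simp_all add: e1_jj s1_jj)
qed

lemma io_central:
  assumes "f \<in> Q.dom"
  shows "e1 * Q.io f = Q.io f" "s1 c * Q.io f = Q.io f * s1 c"
  using Q.e_io[OF assms] Q.io_comm[OF Q.cst_dom assms, of c] by (simp_all add: Q.io_cst)

sublocale V: faeval e1 s1 gm
proof
  fix x c
  have "inverse (Phi True i $$ - mp i) \<in> Q.dom" "inverse (Phi False i $$ - mm i) \<in> Q.dom" if "1 \<le> i \<and> i \<le> n" for i
    using that Phi_lead_inv[of i True] Phi_lead_inv[of i False] by simp_all
  then show "e1 * gm x = gm x" "s1 c * gm x = gm x * s1 c"
    by (simp_all add: gm_def J_central Eimg_J(1) Fimg_J(1) io_central Phi_dom split: Ugen.split)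
qed

text \<open>Second instance of the series calculus, with the free algebra as coefficient ring: the
  formal quotients \<open>Cp\<close> and \<open>Cm\<close> become comparable with Laurent series
  over L.\<close>

sublocale W: rep "FA UNIV" V.ev e1 s1 U1 ks1
  by (simp add: rep_def V.ghom_ev Q.torus_axioms)

lemma genF [simp]: "gen x \<in> carrier (FA UNIV)"
  by simp

lemma ev_E: "1 \<le> i \<Longrightarrow> i < n \<Longrightarrow> V.ev (gen (UE i k)) = (\<Sum>r\<in>rg i. Q.io (EE i r k) * Dm i r)"
  by (simp add: gm_def Eimg_J)

lemma ev_F: "1 \<le> i \<Longrightarrow> i < n \<Longrightarrow> V.ev (gen (UF i k)) = (\<Sum>r\<in>rg i. Q.io (FF i r k) * Dp i r)"
  by (simp add: gm_def Fimg_J)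

lemma phiz_FA: "phiz mp mm eps i m \<in> carrier (FA UNIV)"
  by (simp add: phiz_def PhiP_def PhiM_def)

lemma ev_phiz: "1 \<le> i \<Longrightarrow> i \<le> n \<Longrightarrow> V.ev (phiz mp mm eps i m) = Q.io (zc eps (Phi eps i) m)"
  using Phi_below[of i m True] Phi_below[of i "- m" False]
  by (simp add: phiz_def PhiP_def PhiM_def zc_def gm_def V.ev_fzero Q.io_zero)

lemma zc_dom: "1 \<le> i \<Longrightarrow> zc eps (Phi eps i) m \<in> Q.dom"
  by (simp add: zc_def Phi_dom)

lemma ev_U2:
  assumes ij: "1 \<le> i" "i \<le> n" "1 \<le> j" "j < n"
  shows "V.ev (linrel (cU2 i j) (phiz mp mm eps i) (\<lambda>m. gen (UE j m)) k l) = 0"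
proof -
  obtain \<alpha> \<beta> \<gamma> \<epsilon> where cf: "cU2 i j = (\<alpha>, \<beta>, \<gamma>, \<epsilon>)" by (metis prod_cases4)
  show ?thesis
    unfolding cf V.ev_linrel[OF phiz_FA genF]
  \<comment> \<open>The Cartan coefficient is a sum with a single term, whose shift operator is
    e1.\<close>
  proof (rule Q.exchange_of_coefficients[of "{()}" "\<lambda>_. e1" "\<lambda>_ f. f" "rg j" "Dm j" "\<lambda>t. sh j t (inverse vv)"
        "\<lambda>_ k. zc eps (Phi eps i) k" "EE j"])
    show "Dm j t * e1 = e1 * Dm j t" if "t \<in> rg j" for t using that by (simp add: D_inv)
  qed (use ij cf in \<open>auto simp: Q.tw_e tw_Dm zc_dom EE_dom ev_E ev_phiz Q.io_e simp del: V.ev_gen intro!: phiE_rel\<close>)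
qed

lemma ev_U3:
  assumes ij: "1 \<le> i" "i \<le> n" "1 \<le> j" "j < n"
  shows "V.ev (linrel (cU3 i j) (phiz mp mm eps i) (\<lambda>m. gen (UF j m)) k l) = 0"
proof -
  obtain \<alpha> \<beta> \<gamma> \<epsilon> where cf: "cU3 i j = (\<alpha>, \<beta>, \<gamma>, \<epsilon>)" by (metis prod_cases4)
  show ?thesis
    unfolding cf V.ev_linrel[OF phiz_FA genF]
  proof (rule Q.exchange_of_coefficients[of "{()}" "\<lambda>_. e1" "\<lambda>_ f. f" "rg j" "Dp j" "\<lambda>t. sh j t vv"
        "\<lambda>_ k. zc eps (Phi eps i) k" "FF j"])
    show "Dp j t * e1 = e1 * Dp j t" if "t \<in> rg j" for t using that by (simp add: D_inv)
  qed (use ij cf in \<open>auto simp: Q.tw_e tw_Dp zc_dom FF_dom ev_F ev_phiz Q.io_e simp del: V.ev_gen intro!: phiF_rel\<close>)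
qed

lemma ev_U4:
  assumes ij: "1 \<le> i" "i < n" "1 \<le> j" "j < n"
  shows "V.ev (linrel (cU4 i j) (\<lambda>m. gen (UE i m)) (\<lambda>m. gen (UE j m)) k l) = 0"
proof -
  obtain \<alpha> \<beta> \<gamma> \<epsilon> where cf: "cU4 i j = (\<alpha>, \<beta>, \<gamma>, \<epsilon>)" by (metis prod_cases4)
  show ?thesis
    unfolding cf V.ev_linrel[OF genF genF]
    by (rule Q.exchange_of_coefficients[of "rg i" "Dm i" "\<lambda>t. sh i t (inverse vv)" "rg j" "Dm j" "\<lambda>t. sh j t (inverse vv)" "EE i" "EE j"])
      (use ij cf in \<open>auto simp: tw_Dm EE_dom ev_E D_comm(4) simp del: V.ev_gen intro!: E_rel\<close>)
qed

lemma ev_U5: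
  assumes ij: "1 \<le> i" "i < n" "1 \<le> j" "j < n"
  shows "V.ev (linrel (cU5 i j) (\<lambda>m. gen (UF i m)) (\<lambda>m. gen (UF j m)) k l) = 0"
proof -
  obtain \<alpha> \<beta> \<gamma> \<epsilon> where cf: "cU5 i j = (\<alpha>, \<beta>, \<gamma>, \<epsilon>)" by (metis prod_cases4)
  show ?thesis
    unfolding cf V.ev_linrel[OF genF genF]
    by (rule Q.exchange_of_coefficients[of "rg i" "Dp i" "\<lambda>t. sh i t vv" "rg j" "Dp j" "\<lambda>t. sh j t vv" "FF i" "FF j"])
      (use ij cf in \<open>auto simp: tw_Dp FF_dom ev_F D_comm(1) simp del: V.ev_gen intro!: F_rel\<close>)
qed

lemma ev_qc: "x \<in> carrier (FA UNIV) \<Longrightarrow> y \<in> carrier (FA UNIV) \<Longrightarrow> V.ev (qc x y c) = Q.qcb (V.ev x) (V.ev y) c"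
  by (simp add: qc_def Q.qcb_def V.ev_fsub V.ev_fmul V.ev_fscal fmul_FA fscal_FA)

lemma qc_FA: "x \<in> carrier (FA G) \<Longrightarrow> y \<in> carrier (FA G) \<Longrightarrow> qc x y c \<in> carrier (FA G)"
  by (simp add: qc_def fsub_FA fmul_FA fscal_FA)

lemma ev_U6:
  assumes ij: "1 \<le> i" "i < n" "1 \<le> j" "j < n" "i = j + 1 \<or> j = i + 1"
  shows "V.ev (fadd (qc (gen (UE i k1)) (qc (gen (UE i k2)) (gen (UE j l)) vv) (inverse vv))
           (qc (gen (UE i k2)) (qc (gen (UE i k1)) (gen (UE j l)) vv) (inverse vv))) = 0"
proof -
  have "Q.qcb (V.ev (gen (UE i k1))) (Q.qcb (V.ev (gen (UE i k2))) (V.ev (gen (UE j l))) vv) (inverse vv)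
     + Q.qcb (V.ev (gen (UE i k2))) (Q.qcb (V.ev (gen (UE i k1))) (V.ev (gen (UE j l))) vv) (inverse vv) = 0"
    by (rule Q.serre_of_coefficients[OF _ _ _ _ _ _ _ _ _ _ _ ev_E[OF ij(1,2)] ev_E[OF ij(1,2)] ev_E[OF ij(3,4)],
          of "\<lambda>r. sh i r (inverse vv)" "\<lambda>r. sh j r (inverse vv)"])
      (use ij in \<open>auto simp: tw_Dm EE_dom D_comm(4) s1_D intro!: E_serre\<close>)
  then show ?thesis by (simp add: V.ev_fadd ev_qc qc_FA)
qed

lemma ev_U7:
  assumes ij: "1 \<le> i" "i < n" "1 \<le> j" "j < n" "i = j + 1 \<or> j = i + 1"
  shows "V.ev (fadd (qc (gen (UF i k1)) (qc (gen (UF i k2)) (gen (UF j l)) vv) (inverse vv))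
           (qc (gen (UF i k2)) (qc (gen (UF i k1)) (gen (UF j l)) vv) (inverse vv))) = 0"
proof -
  have "Q.qcb (V.ev (gen (UF i k1))) (Q.qcb (V.ev (gen (UF i k2))) (V.ev (gen (UF j l))) vv) (inverse vv)
     + Q.qcb (V.ev (gen (UF i k2))) (Q.qcb (V.ev (gen (UF i k1))) (V.ev (gen (UF j l))) vv) (inverse vv) = 0"
    by (rule Q.serre_of_coefficients[OF _ _ _ _ _ _ _ _ _ _ _ ev_F[OF ij(1,2)] ev_F[OF ij(1,2)] ev_F[OF ij(3,4)],
          of "\<lambda>r. sh i r vv" "\<lambda>r. sh j r vv"])
      (use ij in \<open>auto simp: tw_Dp FF_dom D_comm(1) s1_D intro!: F_serre\<close>)
  then show ?thesis by (simp add: V.ev_fadd ev_qc qc_FA)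
qed

lemma srelU_PhiP:
  assumes "1 \<le> i" "i \<le> n"
  shows "W.srelU (- mp i, PhiP mp i) (Phi True i)"
proof -
  have "W.rp (scoef (FA UNIV) (- mp i, PhiP mp i) m) (Phi True i $$ m)" for m
    using assms Phi_below[of i m True] Phi_dom[of i True m]
    by (auto simp: W.rp_def scoef_def PhiP_def gm_def V.ev_fzero Q.io_zero Q.dom_zero)
  then show ?thesis using assms Phi_below[of i _ True] Phi_lead[of i True] Phi_lead_inv[of i True]
    by (simp add: W.srelU_def W.srel_def)
qed

lemma srelU_PhiM:
  assumes "1 \<le> i" "i \<le> n"
  shows "W.srelU (- mm i, \<lambda>m. PhiM mm i (- m)) (Phi False i)"
proof -
  have "W.rp (scoef (FA UNIV) (- mm i, \<lambda>m. PhiM mm i (- m)) m) (Phi False i $$ m)" for m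
    using assms Phi_below[of i m False] Phi_dom[of i False m]
    by (auto simp: W.rp_def scoef_def PhiM_def gm_def V.ev_fzero Q.io_zero Q.dom_zero)
  then show ?thesis using assms Phi_below[of i _ False] Phi_lead[of i False] Phi_lead_inv[of i False]
    by (simp add: W.srelU_def W.srel_def)
qed

text \<open>The formal inverse series is built from the generator \<open>UPpI i\<close>, whose value
  is that of the inverse leading coefficient of \<open>Phi\<close>; so it is represented by the
  inverse Laurent series.\<close>

lemma rp_Cp:
  assumes i: "1 \<le> i" "i < n"
  shows "W.rp (Cp mp i m) (zc True (GG True i) m)"
proof -
  have "W.rp (gen (UPpI i)) (inverse (Phi True i $$ fst (- mp i, PhiP mp i)))"
    using i Phi_lead_inv[of i True] by (simp add: W.rp_def gm_def)
  then have "W.srelU (smul (FA UNIV) (sinvb (FA UNIV) (- mp i, PhiP mp i) (gen (UPpI i))) (- mp (i + 1), PhiP mp (i + 1)))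
     (inverse (Phi True i) * Phi True (i + 1))"
    using i by (intro W.srelU_smul W.srelU_sinvb srelU_PhiP) auto
  then show ?thesis by (simp add: W.srelU_def W.srel_def Cp_def FU_def zc_def GG_def)
qed

lemma rp_Cm:
  assumes i: "1 \<le> i" "i < n"
  shows "W.rp (Cm mm i m) (zc False (GG False i) m)"
proof -
  have "W.rp (gen (UPmI i)) (inverse (Phi False i $$ fst (- mm i, \<lambda>m. PhiM mm i (- m))))"
    using i Phi_lead_inv[of i False] by (simp add: W.rp_def gm_def)
  then have "W.srelU (smul (FA UNIV) (sinvb (FA UNIV) (- mm i, \<lambda>m. PhiM mm i (- m)) (gen (UPmI i))) (- mm (i + 1), \<lambda>m. PhiM mm (i + 1) (- m)))
     (inverse (Phi False i) * Phi False (i + 1))"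
    using i by (intro W.srelU_smul W.srelU_sinvb srelU_PhiM) auto
  then show ?thesis by (simp add: W.srelU_def W.srel_def Cm_def FU_def zc_def GG_def)
qed

lemma ev_U1:
  assumes ij: "1 \<le> i" "i < n" "1 \<le> j" "j < n"
  shows "V.ev (fsub (fsub (fmul (gen (UE i k)) (gen (UF j l))) (fmul (gen (UF j l)) (gen (UE i k))))
          (fscal (if i = j then vv - inverse vv else 0) (fsub (Cp mp i (k + l)) (Cm mm i (k + l))))) = 0"
proof -
  let ?c = "if i = j then vv - inverse vv else 0"
  have C: "Cp mp i (k + l) \<in> carrier (FA UNIV)" "Cm mm i (k + l) \<in> carrier (FA UNIV)"
    "V.ev (Cp mp i (k + l)) = Q.io (zc True (GG True i) (k + l))" "zc True (GG True i) (k + l) \<in> Q.dom"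
    "V.ev (Cm mm i (k + l)) = Q.io (zc False (GG False i) (k + l))" "zc False (GG False i) (k + l) \<in> Q.dom"
    using rp_Cp[OF ij(1,2)] rp_Cm[OF ij(1,2)] by (simp_all add: W.rp_def)
  have "V.ev (gen (UE i k)) * V.ev (gen (UF j l)) - V.ev (gen (UF j l)) * V.ev (gen (UE i k))
     = (if i = j then (\<Sum>r\<in>rg i. Q.io (CC i r (k + l))) else 0)"
    unfolding ev_E[OF ij(1,2)] ev_F[OF ij(3,4)]
    by (rule Q.commutator_of_coefficients[of "rg i" "Dm i" "\<lambda>t. sh i t (inverse vv)" "rg j" "Dp j" "\<lambda>t. sh j t vv"])
      (use ij in \<open>auto simp: tw_Dm tw_Dp EE_dom FF_dom D_comm(3) D_inv EF_rel\<close>)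
  moreover have "s1 ?c * (Q.io (zc True (GG True i) (k + l)) - Q.io (zc False (GG False i) (k + l)))
     = (if i = j then (\<Sum>r\<in>rg i. Q.io (CC i r (k + l))) else 0)"
  proof (cases "i = j")
    case True
    \<comment> \<open>\<open>CC\<close> has a value because it is a difference of products of
      coefficients and shifted coefficients, all of which have one.\<close>
    have d: "CC i r (k + l) \<in> Q.dom" if r: "r \<in> rg i" for r
    proof -
      have "CC i r (k + l) = EE i r k * sh i r (inverse vv) (FF i r l) - FF i r l * sh i r vv (EE i r k)"
        using EF_rel[OF ij(1,1) r r, of k l] by simp
      then show ?thesis
        using r ij(1) by (simp add: Q.dom_diff Q.dom_mult EE_dom FF_dom Q.tw_dom[OF tw_Dm] Q.tw_dom[OF tw_Dp])
    qed
    have "s1 (vv - inverse vv) * (Q.io (zc True (GG True i) (k + l)) - Q.io (zc False (GG False i) (k + l)))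
       = Q.io (cst (vv - inverse vv) * (zc True (GG True i) (k + l) - zc False (GG False i) (k + l)))"
      using C by (simp add: Q.s_io Q.dom_diff flip: Q.io_diff)
    also have "\<dots> = (\<Sum>r\<in>rg i. Q.io (CC i r (k + l)))"
      unfolding U1_residues[OF ij(1)] using d by (rule Q.io_sum)
    finally show ?thesis using True by simp
  qed (simp add: Q.s_zero)
  ultimately show ?thesis using C
    by (simp add: V.ev_fsub V.ev_fmul V.ev_fscal fsub_FA fmul_FA fscal_FA del: V.ev_gen)
qed

lemma ev_U0:
  assumes "x \<in> PhiGens n mp mm" "y \<in> PhiGens n mp mm"
  shows "V.ev (fsub (fmul x y) (fmul y x)) = 0"
proof -
  have "x \<in> carrier (FA UNIV) \<and> (\<exists>f\<in>Q.dom. V.ev x = Q.io f)" if "x \<in> PhiGens n mp mm" for x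
    using that by (auto simp: PhiGens_def gm_def Phi_dom intro: Phi_dom)
  from this[OF assms(1)] this[OF assms(2)] show ?thesis
    by (auto simp: V.ev_fsub V.ev_fmul fmul_FA Q.io_comm)
qed

lemma ev_inverse_rel:
  assumes "1 \<le> i" "i \<le> n"
  shows "V.ev (fsub (fmul (gen (UPp i (- mp i))) (gen (UPpI i))) fone) = 0"
    "V.ev (fsub (fmul (gen (UPpI i)) (gen (UPp i (- mp i)))) fone) = 0"
    "V.ev (fsub (fmul (gen (UPm i (- mm i))) (gen (UPmI i))) fone) = 0"
    "V.ev (fsub (fmul (gen (UPmI i)) (gen (UPm i (- mm i)))) fone) = 0"
  using assms Q.io_inverse_cinv[OF Phi_dom[of i True "- mp i"]] Phi_lead[of i True] Phi_lead_inv[of i True]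
    Q.io_inverse_cinv[OF Phi_dom[of i False "- mm i"]] Phi_lead[of i False] Phi_lead_inv[of i False]
  by (simp_all add: V.ev_fsub V.ev_fmul fmul_FA V.ev_fone gm_def Q.cinv_def)

lemma ev_UR: "r \<in> UR n mp mm \<Longrightarrow> V.ev r = 0"
  unfolding UR_def
  by (elim UnE CollectE exE conjE; simp only: ev_U0 ev_inverse_rel ev_U1 ev_U2 ev_U3 ev_U4 ev_U5 ev_U6 ev_U7)

section \<open>The relations lie in the free algebra on the prescribed generators\<close>

lemma PhiP_FA: "1 \<le> i \<Longrightarrow> i \<le> n \<Longrightarrow> PhiP mp i m \<in> carrier (FA (UG n mp mm))"
  and PhiM_FA: "1 \<le> i \<Longrightarrow> i \<le> n \<Longrightarrow> PhiM mm i m \<in> carrier (FA (UG n mp mm))"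
  by (simp_all add: PhiP_def PhiM_def UG_def)

lemma C_FA:
  assumes i: "1 \<le> i" "i < n"
  shows "Cp mp i m \<in> carrier (FA (UG n mp mm))" "Cm mm i m \<in> carrier (FA (UG n mp mm))"
proof -
  have s: "scoef (FA UNIV) (- mp i, PhiP mp i) m \<in> carrier (FA (UG n mp mm))"
    "scoef (FA UNIV) (- mm i, \<lambda>m. PhiM mm i (- m)) m \<in> carrier (FA (UG n mp mm))" if "1 \<le> i" "i \<le> n" for i m
    using that by (simp_all add: scoef_def PhiP_FA PhiM_FA)
  have "gen (UPpI i) \<in> carrier (FA (UG n mp mm))" "gen (UPmI i) \<in> carrier (FA (UG n mp mm))"
    using i by (simp_all add: UG_def)
  then show "Cp mp i m \<in> carrier (FA (UG n mp mm))" "Cm mm i m \<in> carrier (FA (UG n mp mm))"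
    unfolding Cp_def Cm_def FU_def using i s by (auto intro!: scoef_smul_FA scoef_sinvb_FA)
qed

lemma linrel_FA:
  assumes "\<And>k. X k \<in> carrier (FA G)" "\<And>k. Y k \<in> carrier (FA G)"
  shows "linrel cf X Y k l \<in> carrier (FA G)"
  using assms by (cases cf) (simp add: linrel_def fsub_FA fadd_FA fscal_FA fmul_FA)

lemma UG_mem:
  "1 \<le> i \<Longrightarrow> i < n \<Longrightarrow> UE i k \<in> UG n mp mm" "1 \<le> i \<Longrightarrow> i < n \<Longrightarrow> UF i k \<in> UG n mp mm"
  "1 \<le> i \<Longrightarrow> i \<le> n \<Longrightarrow> UPp i (- mp i) \<in> UG n mp mm" "1 \<le> i \<Longrightarrow> i \<le> n \<Longrightarrow> UPm i (- mm i) \<in> UG n mp mm"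
  "1 \<le> i \<Longrightarrow> i \<le> n \<Longrightarrow> UPpI i \<in> UG n mp mm" "1 \<le> i \<Longrightarrow> i \<le> n \<Longrightarrow> UPmI i \<in> UG n mp mm"
  by (simp_all add: UG_def)

lemma PhiGens_FA: "x \<in> PhiGens n mp mm \<Longrightarrow> x \<in> carrier (FA (UG n mp mm))"
  by (auto simp: PhiGens_def UG_def)

lemma phiz_FA': "1 \<le> i \<Longrightarrow> i \<le> n \<Longrightarrow> phiz mp mm eps i m \<in> carrier (FA (UG n mp mm))"
  by (simp add: phiz_def PhiP_FA PhiM_FA)

lemma UR_FA: "UR n mp mm \<subseteq> carrier (FA (UG n mp mm))"
proof
  fix r assume "r \<in> UR n mp mm"
  then show "r \<in> carrier (FA (UG n mp mm))"
    unfolding UR_def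
    by (elim UnE CollectE exE conjE; simp only: fsub_FA fadd_FA fmul_FA fscal_FA qc_FA linrel_FA fone_FA C_FA phiz_FA'
      PhiGens_FA gen_FA UG_mem)
qed

section \<open>The homomorphism\<close>

abbreviation "Ualg1 \<equiv> Ualg n mp mm"

lemma J_inj: "x \<in> carrier A \<Longrightarrow> y \<in> carrier A \<Longrightarrow> J x = J y \<Longrightarrow> x = y"
  using Q.g_inj by (auto simp: inj_on_def)

text \<open>Every value of the evaluation lies in the corner of e1, hence in the image of
  \<open>J\<close>. Choosing preimages gives a homomorphism because \<open>J\<close> is injective,
  and it kills the relations.\<close>

lemma hom_exists:
  "\<exists>\<Psi>. \<Psi> \<in> ring_hom Ualg1 A \<and> \<Psi> \<in> extensional (carrier Ualg1)
    \<and> (\<forall>f\<in>carrier (FA (UG n mp mm)). \<Psi> (cls (UG n mp mm) (UR n mp mm) f) \<in> carrier A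
      \<and> J (\<Psi> (cls (UG n mp mm) (UR n mp mm) f)) = V.ev f)"
proof -
  have "\<exists>x\<in>carrier A. J x = V.ev f" for f
    using Q.g_surj[of "V.ev f"] V.e_ev[of f] 
    by (metis (no_types, lifting) emb_surj[OF ring_Aalg] J_def e1_def image_iff)
  then obtain h where h: "\<And>f. h f \<in> carrier A" "\<And>f. J (h f) = V.ev f" by metis
  have U: "f \<in> carrier (FA UNIV)" if "f \<in> carrier (FA (UG n mp mm))" for f
    using that FA_mono[of "UG n mp mm" UNIV] by auto
  have "h \<in> ring_hom (FA (UG n mp mm)) A"
  proof (rule ring_hom_memI)
    fix x y assume xy: "x \<in> carrier (FA (UG n mp mm))" "y \<in> carrier (FA (UG n mp mm))"
    show "h (x \<otimes>\<^bsub>FA (UG n mp mm)\<^esub> y) = h x \<otimes>\<^bsub>A\<^esub> h y"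
      by (rule J_inj) (use xy in \<open>simp_all add: h Q.g_mult V.ev_fmul U\<close>)
    show "h (x \<oplus>\<^bsub>FA (UG n mp mm)\<^esub> y) = h x \<oplus>\<^bsub>A\<^esub> h y"
      by (rule J_inj) (use xy in \<open>simp_all add: h Q.g_add V.ev_fadd U\<close>)
  next
    show "h \<one>\<^bsub>FA (UG n mp mm)\<^esub> = \<one>\<^bsub>A\<^esub>"
      by (rule J_inj) (simp_all add: h V.ev_fone Q.g_one)
  qed (rule h)
  moreover have "h r = \<zero>\<^bsub>A\<^esub>" if "r \<in> UR n mp mm" for r
    by (rule J_inj) (simp_all add: h ev_UR[OF that] Q.g_zero)
  ultimately obtain \<Psi> where "\<Psi> \<in> ring_hom (Pres (UG n mp mm) (UR n mp mm)) A"
    "\<Psi> \<in> extensional (carrier (Pres (UG n mp mm) (UR n mp mm)))"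
    "\<And>f. f \<in> carrier (FA (UG n mp mm)) \<Longrightarrow> \<Psi> (cls (UG n mp mm) (UR n mp mm) f) = h f"
    using Pres_hom_exists[OF UR_FA ring_Aalg] by metis
  then show ?thesis using h unfolding Ualg_def by (intro exI[of _ \<Psi>]) simp
qed

definition spec :: "(Ugen fa set \<Rightarrow> Agen fa set) \<Rightarrow> bool" where
  "spec \<Psi> \<longleftrightarrow> \<Psi> \<in> ring_hom (Ualg n mp mm) (Aalg n a)
           \<and> \<Psi> \<in> extensional (carrier (Ualg n mp mm))
           \<and> (\<forall>c. \<Psi> (sU n mp mm c) = sA n a c)
           \<and> (\<forall>i k. 1 \<le> i \<and> i < n \<longrightarrow> \<Psi> (gU n mp mm (UE i k)) = Eimg n a mp N is xs gam i k)
           \<and> (\<forall>i k. 1 \<le> i \<and> i < n \<longrightarrow> \<Psi> (gU n mp mm (UF i k)) = Fimg n a i k)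
           \<and> (\<forall>i s. 1 \<le> i \<and> i \<le> n \<and> - mp i \<le> s \<longrightarrow>
                \<Psi> (gU n mp mm (UPp i s)) = scoef (Aalg n a) (phiS n a mp N is xs gam True i) s)
           \<and> (\<forall>i s. 1 \<le> i \<and> i \<le> n \<and> - mm i \<le> s \<longrightarrow>
                \<Psi> (gU n mp mm (UPm i s)) = scoef (Aalg n a) (phiS n a mp N is xs gam False i) s)"

lemma spec_exists: "\<exists>\<Psi>. spec \<Psi>"
proof -
  obtain \<Psi> where \<Psi>: "\<Psi> \<in> ring_hom Ualg1 A" "\<Psi> \<in> extensional (carrier Ualg1)"
    "\<And>f. f \<in> carrier (FA (UG n mp mm)) \<Longrightarrow> \<Psi> (cls (UG n mp mm) (UR n mp mm) f) \<in> carrier A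
      \<and> J (\<Psi> (cls (UG n mp mm) (UR n mp mm) f)) = V.ev f" using hom_exists by blast
  have P: "\<Psi> (cls (UG n mp mm) (UR n mp mm) f) = x"
    if "f \<in> carrier (FA (UG n mp mm))" "x \<in> carrier A" "J x = V.ev f" for f x
    using \<Psi>(3)[OF that(1)] that by (intro J_inj) auto
  have "spec \<Psi>"
    unfolding spec_def gU_def sU_def
  proof (intro conjI allI impI)
    show "\<Psi> (cls (UG n mp mm) (UR n mp mm) (sc c)) = sA n a c" for c
      by (rule P) (simp_all add: cls_closed s1_def jj_def sA_def)
  next
    fix i k assume "1 \<le> i \<and> i < n"
    then show "\<Psi> (cls (UG n mp mm) (UR n mp mm) (gen (UE i k))) = Eimg n a mp N is xs gam i k"
      "\<Psi> (cls (UG n mp mm) (UR n mp mm) (gen (UF i k))) = Fimg n a i k"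
      by (intro P; simp add: UG_mem Eimg_J(1) Fimg_J(1); simp add: gm_def)+
  next
    fix i s assume i: "1 \<le> i \<and> i \<le> n \<and> - mp i \<le> s"
    show "\<Psi> (cls (UG n mp mm) (UR n mp mm) (gen (UPp i s))) = scoef (Aalg n a) (phiS n a mp N is xs gam True i) s"
      by (rule P) (use i Phi_rp[of i True s] in \<open>simp_all add: UG_def gm_def Q.rp_def\<close>)
  next
    fix i s assume i: "1 \<le> i \<and> i \<le> n \<and> - mm i \<le> s"
    show "\<Psi> (cls (UG n mp mm) (UR n mp mm) (gen (UPm i s))) = scoef (Aalg n a) (phiS n a mp N is xs gam False i) s"
      by (rule P) (use i Phi_rp[of i False s] in \<open>simp_all add: UG_def gm_def Q.rp_def\<close>)
  qed (use \<Psi> in auto)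
  then show ?thesis by blast
qed

text \<open>The left inverse \<open>h y\<close> and the right inverse \<open>h' y\<close> of the
  common element \<open>h x = h' x\<close> coincide. This fixes the images of the inverse leading
  Cartan coefficients, for which \<open>spec\<close> prescribes no value.\<close>

lemma inverse_determined:
  assumes h: "h \<in> ring_hom Ualg1 A" and h': "h' \<in> ring_hom Ualg1 A"
    and x: "x \<in> carrier Ualg1" and y: "y \<in> carrier Ualg1"
    and inv: "x \<otimes>\<^bsub>Ualg1\<^esub> y = \<one>\<^bsub>Ualg1\<^esub>" "y \<otimes>\<^bsub>Ualg1\<^esub> x = \<one>\<^bsub>Ualg1\<^esub>" and eq: "h x = h' x"
  shows "h y = h' y"
proof -
  have 1: "h y \<otimes>\<^bsub>A\<^esub> h x = \<one>\<^bsub>A\<^esub>" 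
    using ring_hom_mult[OF h y x] ring_hom_one[OF h] inv by simp
  have 2: "h' x \<otimes>\<^bsub>A\<^esub> h' y = \<one>\<^bsub>A\<^esub>"
    using ring_hom_mult[OF h' x y] ring_hom_one[OF h'] inv by simp
  show ?thesis
    using 1 2 eq ring_hom_closed[OF h] ring_hom_closed[OF h'] x y
    by (intro Q.inv_unique[of "h y" "h x" "h' y"]) auto
qed

lemma cls_inverse:
  assumes "f \<in> carrier (FA (UG n mp mm))" "g \<in> carrier (FA (UG n mp mm))" "fsub (fmul f g) fone \<in> UR n mp mm"
  shows "cls (UG n mp mm) (UR n mp mm) f \<otimes>\<^bsub>Ualg1\<^esub> cls (UG n mp mm) (UR n mp mm) g = \<one>\<^bsub>Ualg1\<^esub>"
proof -
  let ?c = "cls (UG n mp mm) (UR n mp mm)"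
  interpret U: ring Ualg1 unfolding Ualg_def by (rule ring_Pres[OF UR_FA])
  have hom: "?c \<in> ring_hom (FA (UG n mp mm)) Ualg1" unfolding Ualg_def by (rule cls_hom[OF UR_FA])
  have "?c (fsub (fmul f g) fone) = \<zero>\<^bsub>Ualg1\<^esub>" unfolding Ualg_def using assms by (intro cls_rel[OF UR_FA])
  then have "?c (fadd (fsub (fmul f g) fone) fone) = ?c fone"
    using ring_hom_add[OF hom, of "fsub (fmul f g) fone" fone] ring_hom_closed[OF hom] assms
    by (simp add: fsub_FA fmul_FA)
  moreover have "fadd (fsub (fmul f g) fone) fone = fmul f g" by (auto simp: fadd_def fsub_def)
  ultimately show ?thesis
    using ring_hom_mult[OF hom assms(1,2)] ring_hom_one[OF hom] by simp
qed

lemma UR_inverse: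
  assumes "1 \<le> i" "i \<le> n"
  shows "fsub (fmul (gen (UPp i (- mp i))) (gen (UPpI i))) fone \<in> UR n mp mm"
    "fsub (fmul (gen (UPpI i)) (gen (UPp i (- mp i)))) fone \<in> UR n mp mm"
    "fsub (fmul (gen (UPm i (- mm i))) (gen (UPmI i))) fone \<in> UR n mp mm"
    "fsub (fmul (gen (UPmI i)) (gen (UPm i (- mm i)))) fone \<in> UR n mp mm"
  using assms by - (unfold UR_def,
    (rule UnI1, rule UnI1, rule UnI1, rule UnI1, rule UnI1, rule UnI1, rule UnI1, rule UnI1, rule UnI1, rule UnI1, rule UnI2, rule CollectI, (rule exI)+, rule conjI, rule refl, simp),
    (rule UnI1, rule UnI1, rule UnI1, rule UnI1, rule UnI1, rule UnI1, rule UnI1, rule UnI1, rule UnI1, rule UnI2, rule CollectI, (rule exI)+, rule conjI, rule refl, simp),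
    (rule UnI1, rule UnI1, rule UnI1, rule UnI1, rule UnI1, rule UnI1, rule UnI1, rule UnI1, rule UnI2, rule CollectI, (rule exI)+, rule conjI, rule refl, simp),
    (rule UnI1, rule UnI1, rule UnI1, rule UnI1, rule UnI1, rule UnI1, rule UnI1, rule UnI2, rule CollectI, (rule exI)+, rule conjI, rule refl, simp))

lemma spec_unique:
  assumes "spec h" "spec h'"
  shows "h = h'"
proof (rule Pres_hom_eqI[OF UR_FA ring_Aalg])
  note s = assms[unfolded spec_def Ualg_def gU_def sU_def]
  show "h \<in> ring_hom (Pres (UG n mp mm) (UR n mp mm)) A" "h' \<in> ring_hom (Pres (UG n mp mm) (UR n mp mm)) A"
    "h \<in> extensional (carrier (Pres (UG n mp mm) (UR n mp mm)))" "h' \<in> extensional (carrier (Pres (UG n mp mm) (UR n mp mm)))"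
    "h (cls (UG n mp mm) (UR n mp mm) (sc c)) = h' (cls (UG n mp mm) (UR n mp mm) (sc c))" for c
    using s by simp_all
  fix x assume x: "x \<in> UG n mp mm"
  let ?c = "cls (UG n mp mm) (UR n mp mm)"
  have closed: "?c f \<in> carrier Ualg1" if "f \<in> carrier (FA (UG n mp mm))" for f
    unfolding Ualg_def using ring_hom_closed[OF cls_hom[OF UR_FA] that] .
  have hom: "h \<in> ring_hom Ualg1 A" "h' \<in> ring_hom Ualg1 A" using assms by (simp_all add: spec_def)
  have inv: "h (?c (gen y)) = h' (?c (gen y))"
    if "h (?c (gen z)) = h' (?c (gen z))" "y \<in> UG n mp mm" "z \<in> UG n mp mm"
      "fsub (fmul (gen z) (gen y)) fone \<in> UR n mp mm" "fsub (fmul (gen y) (gen z)) fone \<in> UR n mp mm" for y z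
    by (rule inverse_determined[OF hom closed closed cls_inverse cls_inverse]) (use that in simp_all)
  show "h (?c (gen x)) = h' (?c (gen x))"
  proof (cases x)
    case (UPpI i)
    then have i: "1 \<le> i" "i \<le> n" using x by (auto simp: UG_def)
    show ?thesis unfolding UPpI
      by (rule inv[of "UPp i (- mp i)"]) (use i s in \<open>simp_all add: UG_mem UR_inverse\<close>)
  next
    case (UPmI i)
    then have i: "1 \<le> i" "i \<le> n" using x by (auto simp: UG_def)
    show ?thesis unfolding UPmI
      by (rule inv[of "UPm i (- mm i)"]) (use i s in \<open>simp_all add: UG_mem UR_inverse\<close>)
  qed (use x s in \<open>auto simp: UG_def\<close>)
qed

end

theorem theorem3p9:
  fixes n N :: nat and "is" :: "nat \<Rightarrow> nat" and xs :: "nat \<Rightarrow> complex" and gam :: "nat \<Rightarrow> int"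
    and mp mm :: "nat \<Rightarrow> int" and a :: "nat \<Rightarrow> nat"
  assumes "2 \<le> n"
    and "\<forall>s\<in>{1..N}. is s \<le> n - 1 \<and> xs s \<noteq> 0
            \<and> (is s \<noteq> 0 \<longrightarrow> gam s = 1) \<and> (is s = 0 \<longrightarrow> gam s = 1 \<or> gam s = -1)"
    and "\<forall>j\<in>{1..n}. lam N is gam j + mp j + mm j = (\<Sum>i=1..n-1. int (a i) * alpha i j)"
  shows "\<exists>!\<Psi>. \<Psi> \<in> ring_hom (Ualg n mp mm) (Aalg n a)
           \<and> \<Psi> \<in> extensional (carrier (Ualg n mp mm))
           \<and> (\<forall>c. \<Psi> (sU n mp mm c) = sA n a c)
           \<and> (\<forall>i k. 1 \<le> i \<and> i < n \<longrightarrow> \<Psi> (gU n mp mm (UE i k)) = Eimg n a mp N is xs gam i k)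
           \<and> (\<forall>i k. 1 \<le> i \<and> i < n \<longrightarrow> \<Psi> (gU n mp mm (UF i k)) = Fimg n a i k)
           \<and> (\<forall>i s. 1 \<le> i \<and> i \<le> n \<and> - mp i \<le> s \<longrightarrow>
                \<Psi> (gU n mp mm (UPp i s)) = scoef (Aalg n a) (phiS n a mp N is xs gam True i) s)
           \<and> (\<forall>i s. 1 \<le> i \<and> i \<le> n \<and> - mm i \<le> s \<longrightarrow>
                \<Psi> (gU n mp mm (UPm i s)) = scoef (Aalg n a) (phiS n a mp N is xs gam False i) s)"
proof -
  interpret gklo n N "is" xs gam mp mm a by unfold_locales (use assms in auto)
  have "\<exists>!\<Psi>. spec \<Psi>" using spec_exists spec_unique by blast
  then show ?thesis unfolding spec_def .
qed

end
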